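(* Let $\mathbb{K}$ be a field of characteristic zero and $\alpha\in\mathbb{K}^\times$. The time reversal maps $\tau:\mathcal{O}^q_\alpha(I)\to\mathcal{O}^q_\alpha(-I)$ induced by $f\mapsto(x\mapsto f(-x))$ are isomorphisms defining a $C_2$-equivariant structure on the $\mathbf{D}_1^1$-algebra $\mathcal{O}^q_\alpha$. The induced map $\tau$ on $(A_\alpha,\star)$ is an anti-involution which, through the identification of $(A_\alpha,\star)$ with the Weyl algebra $\mathbf{K}\langle\mathbf{q},\mathbf{p}\rangle/(\mathbf{p}\mathbf{q}-\mathbf{q}\mathbf{p}=\hbar)$, is the anti-involution determined by $\mathbf{q}\mapsto\mathbf{q}$ and $\mathbf{p}\mapsto-\mathbf{p}$.
   Context: For a set $S$, $\mathrm{Map}(S,\mathbb{K})$ is the vector space of functions $S\to\mathbb{K}$; for $S\subset T$, functions on $S$ are identified with functions on $T$ supported in $S$ (extension by $0$). $\delta_x$ denotes the function equal to $1$ at $x$ and $0$ elsewhere. Cochain complexes have differential of degree $+1$. Scalars: either $\hbar\in\mathbb{K}^\times$ and $\mathbf{K}=\mathbb{K}$, or $\hbar$ is a formal parameter and $\mathbf{K}=\mathbb{K}[\hbar]$ or $\mathbb{K}[\![\hbar]\!]$. Scalars are extended to $\mathbf{K}$ throughout. The operator $Q_\alpha$ on $\mathrm{Map}(\mathbb{Z},\mathbb{K})$ is $(Q_\alpha h)(x)=h(x-1)-(\alpha+\alpha^{-1})h(x)+h(x+1)$. For $a<b$ real, $\mathbb{V}_\alpha(a,b)$ is the cone of $Q_\alpha:\mathrm{Map}(\mathbb{Z}\cap(a+1,b-1),\mathbb{K})\to\mathrm{Map}(\mathbb{Z}\cap(a,b),\mathbb{K})$,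 i.e. the two-term complex with source in degree $-1$, target in degree $0$. An element $g$ of the source, seen in degree $-1$, is written $\overline{g}$, so the differential is $d\overline{g}=Q_\alpha g$. Thus $\mathrm{Sym}(\mathbb{V}_\alpha(a,b))$ is the free graded commutative algebra on degree $0$ generators $\delta_x$ ($x\in\mathbb{Z}\cap(a,b)$) and degree $-1$ generators $\overline{\delta}_x$ ($x\in\mathbb{Z}\cap(a+1,b-1)$); $d$ is extended by the Leibniz rule. Put $\Delta=\sum_x\frac{\partial^2}{\partial\overline{\delta}_x\partial\delta_x}$ (sum over integers $x\in(a+1,b-1)$), $d_\hbar=d+\hbar\Delta$, and $\mathcal{O}^q_\alpha(a,b)=(\mathrm{Sym}(\mathbb{V}_\alpha(a,b)),d_\hbar)$. Write $[\,\cdot\,]$ for classes in $H^0$. $\mathbf{D}_1^1$ is the colored operad whose colors are bounded open intervals of $\mathbb{R}$ of length greater than $2$, with exactly one operation $(I_1,\dots,I_n)\to J$ if $I_1,\dots,I_n$ are pairwise disjoint and contained in $J$, and none otherwise. $\mathcal{O}^q_\alpha$ is an algebra over it in cochain complexes with $\otimes$: the operation multiplies in $\mathrm{Sym}(\mathbb{V}_\alpha(J))$ the images of the factors (the factorization product), and inclusions $I\subset J$ induce quasi-isomorphisms. The group $C_2$ of order two acts on $\mathbf{D}_1^1$ by $I\mapsto -I$ on colors and by sending the operation $I_1\sqcup\cdots\sqcup I_n\subset J$ to $(-I_1)\sqcup\cdots\sqcup(-I_n)\subset -J$. A $C_2$-equivariant structure on $\mathcal{O}^q_\alpha$ consists of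 isomorphisms of complexes $\tau:\mathcal{O}^q_\alpha(I)\to\mathcal{O}^q_\alpha(-I)$ with $\tau\circ\tau=\mathrm{id}$ that intertwine each operation map with the operation map of its image under this action. Here $\tau(\delta_x)=\delta_{-x}$ and $\tau(\overline{\delta}_x)=\overline{\delta}_{-x}$. Let $J=(-4,4)=-J$ and $A_\alpha=H^0(\mathcal{O}^q_\alpha(J))$; the induced map on $A_\alpha$ is $H^0(\tau)$. The product $\star$ on $A_\alpha$ is the composition $A_\alpha\otimes A_\alpha\cong H^0(\mathcal{O}^q_\alpha(I_1))\otimes H^0(\mathcal{O}^q_\alpha(I_2))\to A_\alpha$ of the inverses of the isomorphisms induced by the inclusions with the factorization product, for any disjoint open intervals $I_1,I_2\subset J$ of length greater than $2$ with $I_1$ to the left of $I_2$ (it does not depend on this choice). The Weyl algebra is identified with $(A_\alpha,\star)$ via the algebra isomorphism $\mathbf{q}\mapsto[\delta_0]$, $\mathbf{p}\mapsto\frac12[\delta_1-\delta_{-1}]$. An anti-involution is an algebra isomorphism $\tau:A\to A^{\mathrm{op}}$ with $\tau^2=\mathrm{id}$. *)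

theory Defs
  imports "HOL-Algebra.Algebra" "HOL-Library.Poly_Mapping"
    "HOL-Computational_Algebra.Computational_Algebra"
begin

section \<open>Scalars\<close>

definition comm_ring_iso :: "('a::comm_ring_1 \<Rightarrow> 'b::comm_ring_1) \<Rightarrow> bool" where
  "comm_ring_iso \<phi> \<longleftrightarrow> bij \<phi> \<and> \<phi> 1 = 1 \<and>
     (\<forall>x y. \<phi> (x + y) = \<phi> x + \<phi> y) \<and> (\<forall>x y. \<phi> (x * y) = \<phi> x * \<phi> y)"

text \<open>
  The type \<^typ>\<open>'r\<close> with structure map \<open>emb\<close> and distinguished element \<open>hb\<close> is, up to
  isomorphism, one of: the field itself with \<open>hb \<noteq> 0\<close>; polynomials, or formal power series,
  over the field with \<open>hb\<close> the formal parameter.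
\<close>

definition quantum_scalars :: "('k::field_char_0 \<Rightarrow> 'r::comm_ring_1) \<Rightarrow> 'r \<Rightarrow> bool" where
  "quantum_scalars emb hb \<longleftrightarrow>
     (comm_ring_iso emb \<and> hb \<noteq> 0) \<or>
     (\<exists>\<phi> :: 'k poly \<Rightarrow> 'r. comm_ring_iso \<phi> \<and> (\<forall>c. emb c = \<phi> [:c:]) \<and> hb = \<phi> [:0, 1:]) \<or>
     (\<exists>\<phi> :: 'k fps \<Rightarrow> 'r. comm_ring_iso \<phi> \<and> (\<forall>c. emb c = \<phi> (fps_const c)) \<and> hb = \<phi> fps_X)"

abbreviation scale :: "'r::comm_ring_1 \<Rightarrow> ('a \<Rightarrow>\<^sub>0 'r) \<Rightarrow> ('a \<Rightarrow>\<^sub>0 'r)" where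
  "scale r \<equiv> Poly_Mapping.map ((*) r)"


section \<open>Intervals and the colored operad\<close>

text \<open>The pair \<open>(a, b)\<close> stands for the open interval from \<open>a\<close> to \<open>b\<close>.\<close>

type_synonym ivl = "real \<times> real"

definition ivl_set :: "ivl \<Rightarrow> real set" where
  "ivl_set I = {fst I <..< snd I}"

definition color :: "ivl \<Rightarrow> bool" where
  "color I \<longleftrightarrow> snd I - fst I > 2"

definition neg_ivl :: "ivl \<Rightarrow> ivl" where
  "neg_ivl I = (- snd I, - fst I)"

text \<open>There is at most one operation of each type; this predicate says when it exists.\<close>

definition D11_op :: "ivl list \<Rightarrow> ivl \<Rightarrow> bool" where
  "D11_op Is J \<longleftrightarrow> color J \<and> (\<forall>I \<in> set Is. color I \<and> ivl_set I \<subseteq> ivl_set J) \<and>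
     (\<forall>i < length Is. \<forall>j < length Is. i \<noteq> j \<longrightarrow> ivl_set (Is ! i) \<inter> ivl_set (Is ! j) = {})"

definition sites :: "ivl \<Rightarrow> int set" where
  "sites I = {x. fst I < of_int x \<and> of_int x < snd I}"

definition inner_sites :: "ivl \<Rightarrow> int set" where
  "inner_sites I = {x. fst I + 1 < of_int x \<and> of_int x < snd I - 1}"


section \<open>Cochain complexes\<close>

text \<open>
  The components are subsets of one ambient additive group; the differential is only
  meaningful on the components.
\<close>

record ('r, 'a) cochain =
  component :: "int \<Rightarrow> 'a set"
  diff :: "'a \<Rightarrow> 'a"
  scal :: "'r \<Rightarrow> 'a \<Rightarrow> 'a"

definition complex_iso ::
  "('r, 'a::ab_group_add) cochain \<Rightarrow> ('r, 'b::ab_group_add) cochain \<Rightarrow> ('a \<Rightarrow> 'b) \<Rightarrow> bool" where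
  "complex_iso C D \<phi> \<longleftrightarrow> (\<forall>n. bij_betw \<phi> (component C n) (component D n) \<and>
     (\<forall>x \<in> component C n. \<forall>y \<in> component C n. \<phi> (x + y) = \<phi> x + \<phi> y) \<and>
     (\<forall>r. \<forall>x \<in> component C n. \<phi> (scal C r x) = scal D r (\<phi> x)) \<and>
     (\<forall>x \<in> component C n. \<phi> (diff C x) = diff D (\<phi> x)))"

definition cocycles :: "('r, 'a::ab_group_add) cochain \<Rightarrow> int \<Rightarrow> 'a set" where
  "cocycles C n = {f \<in> component C n. diff C f = 0}"

definition coboundaries :: "('r, 'a::ab_group_add) cochain \<Rightarrow> int \<Rightarrow> 'a set" where
  "coboundaries C n = diff C ` component C (n - 1)"

definition cls :: "('r, 'a::ab_group_add) cochain \<Rightarrow> int \<Rightarrow> 'a \<Rightarrow> 'a set" where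
  "cls C n f = {f + b | b. b \<in> coboundaries C n}"

definition cohomology :: "('r, 'a::ab_group_add) cochain \<Rightarrow> int \<Rightarrow> 'a set set" where
  "cohomology C n = cls C n ` cocycles C n"

text \<open>
  Maps induced on classes are written as unions over representatives; when the map is
  compatible with coboundaries, all members of the union are the same class.
\<close>

definition induced ::
  "('r, 'b::ab_group_add) cochain \<Rightarrow> int \<Rightarrow> ('a \<Rightarrow> 'b) \<Rightarrow> 'a set \<Rightarrow> 'b set" where
  "induced D n \<phi> u = (\<Union>f \<in> u. cls D n (\<phi> f))"

definition induced2 ::
  "('r, 'c::ab_group_add) cochain \<Rightarrow> int \<Rightarrow> ('a \<Rightarrow> 'b \<Rightarrow> 'c) \<Rightarrow> 'a set \<Rightarrow> 'b set \<Rightarrow> 'c set" where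
  "induced2 D n \<mu> u v = (\<Union>f \<in> u. \<Union>g \<in> v. cls D n (\<mu> f g))"


section \<open>Algebras over the operad and equivariant structures\<close>

text \<open>
  \<open>act Is J\<close> is the operation map as a multilinear function of the list of its arguments,
  i.e. its value on pure tensors.
\<close>

record ('r, 'a) D11_alg =
  obj :: "ivl \<Rightarrow> ('r, 'a) cochain"
  act :: "ivl list \<Rightarrow> ivl \<Rightarrow> 'a list \<Rightarrow> 'a"

definition C2_equivariant_structure ::
  "('r, 'a::ab_group_add) D11_alg \<Rightarrow> (ivl \<Rightarrow> 'a \<Rightarrow> 'a) \<Rightarrow> bool" where
  "C2_equivariant_structure F \<tau> \<longleftrightarrow>
     (\<forall>I. color I \<longrightarrow> complex_iso (obj F I) (obj F (neg_ivl I)) (\<tau> I)) \<and>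
     (\<forall>I n. color I \<longrightarrow> (\<forall>f \<in> component (obj F I) n. \<tau> (neg_ivl I) (\<tau> I f) = f)) \<and>
     (\<forall>Is J fs. D11_op Is J \<longrightarrow> length fs = length Is \<longrightarrow>
        (\<forall>i < length Is. \<exists>n. fs ! i \<in> component (obj F (Is ! i)) n) \<longrightarrow>
        \<tau> J (act F Is J fs) = act F (map neg_ivl Is) (neg_ivl J) (map2 \<tau> Is fs))"


section \<open>The graded symmetric algebra\<close>

text \<open>
  The free graded commutative algebra on even generators \<open>\<delta>\<^sub>x\<close> and odd generators
  \<open>\<delta>bar\<^sub>x\<close>, with \<open>x\<close> an integer. The key \<open>(m, S)\<close> is the monomial
  \<open>\<Prod>\<^sub>x\<^sub>\<in>\<^sub>m \<delta>\<^sub>x\<close> times the product of the \<open>\<delta>bar\<^sub>x\<close>, \<open>x \<in> S\<close>, in increasing order of \<open>x\<close>.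
  In this representation the maps given by extension of functions by zero are the identity.
\<close>

type_synonym 'r symalg = "(int multiset \<times> int set) \<Rightarrow>\<^sub>0 'r"

definition koszul_sign :: "int set \<Rightarrow> int set \<Rightarrow> 'r::comm_ring_1" where
  "koszul_sign S T = (- 1) ^ card {(s, t). s \<in> S \<and> t \<in> T \<and> t < s}"

definition sym_mult :: "'r::comm_ring_1 symalg \<Rightarrow> 'r symalg \<Rightarrow> 'r symalg" where
  "sym_mult f g = (\<Sum>(m, S) \<in> Poly_Mapping.keys f. \<Sum>(m', S') \<in> Poly_Mapping.keys g.
     if S \<inter> S' = {}
     then Poly_Mapping.single (m + m', S \<union> S')
       (koszul_sign S S' * Poly_Mapping.lookup f (m, S) * Poly_Mapping.lookup g (m', S'))
     else 0)"

definition sym_one :: "'r::comm_ring_1 symalg" where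
  "sym_one = Poly_Mapping.single ({#}, {}) 1"

definition sym_prod :: "'r::comm_ring_1 symalg list \<Rightarrow> 'r symalg" where
  "sym_prod fs = foldr sym_mult fs sym_one"

definition sym_comp :: "ivl \<Rightarrow> int \<Rightarrow> 'r::comm_ring_1 symalg set" where
  "sym_comp I n = {f. \<forall>(m, S) \<in> Poly_Mapping.keys f.
     set_mset m \<subseteq> sites I \<and> S \<subseteq> inner_sites I \<and> - int (card S) = n}"

definition delta :: "int \<Rightarrow> int \<Rightarrow> 'r::comm_ring_1" where
  "delta x = (\<lambda>y. if y = x then 1 else 0)"

text \<open>
  A function supported in the sites (resp. the inner sites) of \<open>I\<close>, viewed as a generator of
  degree \<open>0\<close> (resp. \<open>-1\<close>).
\<close>

definition even_elem :: "ivl \<Rightarrow> (int \<Rightarrow> 'r::comm_ring_1) \<Rightarrow> 'r symalg" where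
  "even_elem I h = (\<Sum>x \<in> sites I. Poly_Mapping.single ({#x#}, {}) (h x))"

definition odd_elem :: "ivl \<Rightarrow> (int \<Rightarrow> 'r::comm_ring_1) \<Rightarrow> 'r symalg" where
  "odd_elem I g = (\<Sum>x \<in> inner_sites I. Poly_Mapping.single ({#}, {x}) (g x))"

text \<open>
  The algebra map \<open>Sym V(I) \<rightarrow> Sym V(I')\<close> induced by a linear map \<open>\<phi>\<close> of functions, applied to
  both the even and the odd generators.
\<close>

definition sym_map ::
  "ivl \<Rightarrow> ((int \<Rightarrow> 'r) \<Rightarrow> (int \<Rightarrow> 'r)) \<Rightarrow> 'r::comm_ring_1 symalg \<Rightarrow> 'r symalg" where
  "sym_map I' \<phi> f = (\<Sum>(m, S) \<in> Poly_Mapping.keys f. scale (Poly_Mapping.lookup f (m, S))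
     (sym_mult
       (sym_prod (map (\<lambda>x. even_elem I' (\<phi> (delta x))) (sorted_list_of_multiset m)))
       (sym_prod (map (\<lambda>x. odd_elem I' (\<phi> (delta x))) (sorted_list_of_set S)))))"

definition even_deriv :: "int \<Rightarrow> 'r::comm_ring_1 symalg \<Rightarrow> 'r symalg" where
  "even_deriv x f = (\<Sum>(m, S) \<in> Poly_Mapping.keys f.
     Poly_Mapping.single (m - {#x#}, S) (of_nat (count m x) * Poly_Mapping.lookup f (m, S)))"

text \<open>The left derivative, i.e. the derivation of degree \<open>1\<close> sending \<open>\<delta>bar\<^sub>x\<close> to \<open>1\<close>.\<close>

definition odd_deriv :: "int \<Rightarrow> 'r::comm_ring_1 symalg \<Rightarrow> 'r symalg" where
  "odd_deriv x f = (\<Sum>(m, S) \<in> Poly_Mapping.keys f.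
     if x \<in> S
     then Poly_Mapping.single (m, S - {x})
       ((- 1) ^ card {y \<in> S. y < x} * Poly_Mapping.lookup f (m, S))
     else 0)"


section \<open>The quantum observables\<close>

definition Q_op :: "('k::field_char_0 \<Rightarrow> 'r::comm_ring_1) \<Rightarrow> 'k \<Rightarrow> (int \<Rightarrow> 'r) \<Rightarrow> int \<Rightarrow> 'r" where
  "Q_op emb \<alpha> h x = h (x - 1) - emb (\<alpha> + inverse \<alpha>) * h x + h (x + 1)"

text \<open>
  The derivation of degree \<open>1\<close> determined by \<open>\<delta>bar\<^sub>x \<mapsto> Q \<delta>\<^sub>x\<close> and \<open>\<delta>\<^sub>x \<mapsto> 0\<close>: by the Leibniz
  rule it is \<open>\<Sum>\<^sub>x (Q \<delta>\<^sub>x) \<partial>/\<partial>\<delta>bar\<^sub>x\<close>.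
\<close>

definition d_classical ::
  "('k::field_char_0 \<Rightarrow> 'r::comm_ring_1) \<Rightarrow> 'k \<Rightarrow> ivl \<Rightarrow> 'r symalg \<Rightarrow> 'r symalg" where
  "d_classical emb \<alpha> I f =
     (\<Sum>x \<in> inner_sites I. sym_mult (even_elem I (Q_op emb \<alpha> (delta x))) (odd_deriv x f))"

definition BV_laplacian :: "ivl \<Rightarrow> 'r::comm_ring_1 symalg \<Rightarrow> 'r symalg" where
  "BV_laplacian I f = (\<Sum>x \<in> inner_sites I. odd_deriv x (even_deriv x f))"

definition Oq_complex ::
  "('k::field_char_0 \<Rightarrow> 'r::comm_ring_1) \<Rightarrow> 'k \<Rightarrow> 'r \<Rightarrow> ivl \<Rightarrow> ('r, 'r symalg) cochain" where
  "Oq_complex emb \<alpha> hb I =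
     \<lparr>component = sym_comp I,
      diff = (\<lambda>f. d_classical emb \<alpha> I f + scale hb (BV_laplacian I f)),
      scal = scale\<rparr>"

definition Oq ::
  "('k::field_char_0 \<Rightarrow> 'r::comm_ring_1) \<Rightarrow> 'k \<Rightarrow> 'r \<Rightarrow> ('r, 'r symalg) D11_alg" where
  "Oq emb \<alpha> hb = \<lparr>obj = Oq_complex emb \<alpha> hb, act = (\<lambda>Is J fs. sym_prod fs)\<rparr>"

definition reflect :: "(int \<Rightarrow> 'r) \<Rightarrow> int \<Rightarrow> 'r" where
  "reflect f = (\<lambda>x. f (- x))"

definition time_reversal :: "ivl \<Rightarrow> 'r::comm_ring_1 symalg \<Rightarrow> 'r symalg" where
  "time_reversal I = sym_map (neg_ivl I) reflect"


section \<open>Associative algebras\<close>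

text \<open>
  Algebras over \<^typ>\<open>'r\<close> are records of the module type; unlike in the library's
  locale \<open>algebra\<close>, the multiplication need not be commutative.
\<close>

definition algebra_iso ::
  "('r, 'a) module \<Rightarrow> ('r, 'b) module \<Rightarrow> ('a \<Rightarrow> 'b) \<Rightarrow> bool" where
  "algebra_iso A B \<phi> \<longleftrightarrow> \<phi> \<in> ring_iso A B \<and>
     (\<forall>r. \<forall>x \<in> carrier A. \<phi> (r \<odot>\<^bsub>A\<^esub> x) = r \<odot>\<^bsub>B\<^esub> \<phi> x)"

definition opposite :: "('r, 'a) module \<Rightarrow> ('r, 'a) module" where
  "opposite A = A\<lparr>monoid.mult := (\<lambda>x y. y \<otimes>\<^bsub>A\<^esub> x)\<rparr>"

definition anti_involution :: "('r, 'a) module \<Rightarrow> ('a \<Rightarrow> 'a) \<Rightarrow> bool" where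
  "anti_involution A \<sigma> \<longleftrightarrow> algebra_iso A (opposite A) \<sigma> \<and> (\<forall>x \<in> carrier A. \<sigma> (\<sigma> x) = x)"


section \<open>The algebra of observables on the line\<close>

definition J0 :: ivl where
  "J0 = (- 4, 4)"

definition left_right_pair :: "ivl \<Rightarrow> ivl \<Rightarrow> bool" where
  "left_right_pair I1 I2 \<longleftrightarrow> D11_op [I1, I2] J0 \<and> snd I1 \<le> fst I2"

text \<open>The inverse of the map on \<open>H\<^sup>0\<close> induced by the inclusion of \<open>I\<close> in \<open>J0\<close>.\<close>

definition restrict_class ::
  "('k::field_char_0 \<Rightarrow> 'r::comm_ring_1) \<Rightarrow> 'k \<Rightarrow> 'r \<Rightarrow> ivl \<Rightarrow> 'r symalg set \<Rightarrow> 'r symalg set" where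
  "restrict_class emb \<alpha> hb I =
     inv_into (cohomology (obj (Oq emb \<alpha> hb) I) 0)
       (induced (obj (Oq emb \<alpha> hb) J0) 0 (\<lambda>f. act (Oq emb \<alpha> hb) [I] J0 [f]))"

definition star ::
  "('k::field_char_0 \<Rightarrow> 'r::comm_ring_1) \<Rightarrow> 'k \<Rightarrow> 'r \<Rightarrow> ivl \<Rightarrow> ivl \<Rightarrow>
     'r symalg set \<Rightarrow> 'r symalg set \<Rightarrow> 'r symalg set" where
  "star emb \<alpha> hb I1 I2 u v =
     induced2 (obj (Oq emb \<alpha> hb) J0) 0 (\<lambda>f g. act (Oq emb \<alpha> hb) [I1, I2] J0 [f, g])
       (restrict_class emb \<alpha> hb I1 u) (restrict_class emb \<alpha> hb I2 v)"

text \<open>The class in \<open>H\<^sup>0\<close> over \<open>J0\<close> of a function, seen as a linear observable.\<close>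

definition obs_class ::
  "('k::field_char_0 \<Rightarrow> 'r::comm_ring_1) \<Rightarrow> 'k \<Rightarrow> 'r \<Rightarrow> (int \<Rightarrow> 'r) \<Rightarrow> 'r symalg set" where
  "obs_class emb \<alpha> hb h = cls (obj (Oq emb \<alpha> hb) J0) 0 (even_elem J0 h)"

definition A_alg ::
  "('k::field_char_0 \<Rightarrow> 'r::comm_ring_1) \<Rightarrow> 'k \<Rightarrow> 'r \<Rightarrow> ivl \<Rightarrow> ivl \<Rightarrow> ('r, 'r symalg set) module" where
  "A_alg emb \<alpha> hb I1 I2 = (let C = obj (Oq emb \<alpha> hb) J0 in
     \<lparr>carrier = cohomology C 0,
      monoid.mult = star emb \<alpha> hb I1 I2,
      one = cls C 0 sym_one,
      ring.zero = cls C 0 0,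
      add = induced2 C 0 (+),
      module.smult = (\<lambda>r. induced C 0 (scale r))\<rparr>)"


section \<open>The Weyl algebra\<close>

datatype weyl_gen = Gen_q | Gen_p

datatype word = Word "weyl_gen list"

instantiation word :: monoid_add
begin

definition zero_word :: word where
  "zero_word = Word []"

fun plus_word :: "word \<Rightarrow> word \<Rightarrow> word" where
  "plus_word (Word u) (Word v) = Word (u @ v)"

instance
proof
  fix a b c :: word
  show "a + b + c = a + (b + c)" by (cases a; cases b; cases c) simp
  show "0 + a = a" by (cases a) (simp add: zero_word_def)
  show "a + 0 = a" by (cases a) (simp add: zero_word_def)
qed

end

text \<open>
  With concatenation of words as the (additively written) monoid operation, the convolution
  product of finitely supported functions on words is that of the free associative algebra.
\<close>

type_synonym 'r free_alg = "word \<Rightarrow>\<^sub>0 'r"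

definition free_gen :: "weyl_gen \<Rightarrow> 'r::comm_ring_1 free_alg" where
  "free_gen g = Poly_Mapping.single (Word [g]) 1"

definition free_ring :: "'r::comm_ring_1 free_alg ring" where
  "free_ring = \<lparr>carrier = UNIV, monoid.mult = (*), one = 1, ring.zero = 0, add = (+)\<rparr>"

definition weyl_ideal :: "'r::comm_ring_1 \<Rightarrow> 'r free_alg set" where
  "weyl_ideal hb = Idl\<^bsub>free_ring\<^esub>
     {free_gen Gen_p * free_gen Gen_q - free_gen Gen_q * free_gen Gen_p - scale hb 1}"

definition weyl_class :: "'r::comm_ring_1 \<Rightarrow> 'r free_alg \<Rightarrow> 'r free_alg set" where
  "weyl_class hb f = weyl_ideal hb +>\<^bsub>free_ring\<^esub> f"

definition weyl_alg :: "'r::comm_ring_1 \<Rightarrow> ('r, 'r free_alg set) module" where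
  "weyl_alg hb = ring.extend (free_ring Quot weyl_ideal hb)
     (module.fields (\<lambda>r u. \<Union>f \<in> u. weyl_class hb (scale r f)))"

definition weyl_q :: "'r::comm_ring_1 \<Rightarrow> 'r free_alg set" where
  "weyl_q hb = weyl_class hb (free_gen Gen_q)"

definition weyl_p :: "'r::comm_ring_1 \<Rightarrow> 'r free_alg set" where
  "weyl_p hb = weyl_class hb (free_gen Gen_p)"

definition weyl_identification ::
  "('k::field_char_0 \<Rightarrow> 'r::comm_ring_1) \<Rightarrow> 'k \<Rightarrow> 'r \<Rightarrow> ivl \<Rightarrow> ivl \<Rightarrow>
     ('r free_alg set \<Rightarrow> 'r symalg set) \<Rightarrow> bool" where
  "weyl_identification emb \<alpha> hb I1 I2 \<Phi> \<longleftrightarrow>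
     algebra_iso (weyl_alg hb) (A_alg emb \<alpha> hb I1 I2) \<Phi> \<and>
     \<Phi> (weyl_q hb) = obs_class emb \<alpha> hb (delta 0) \<and>
     \<Phi> (weyl_p hb) = obs_class emb \<alpha> hb (\<lambda>x. emb (1 / 2) * (delta 1 x - delta (- 1) x))"

definition weyl_reversal :: "'r::comm_ring_1 \<Rightarrow> ('r free_alg set \<Rightarrow> 'r free_alg set) \<Rightarrow> bool" where
  "weyl_reversal hb \<sigma> \<longleftrightarrow> anti_involution (weyl_alg hb) \<sigma> \<and>
     \<sigma> (weyl_q hb) = weyl_q hb \<and> \<sigma> (weyl_p hb) = \<ominus>\<^bsub>weyl_alg hb\<^esub> weyl_p hb"

end

theory Submission
  imports Defs
begin

text \<open>
  Let \<open>phi\<close> be the solution of \<open>Q phi = 0\<close> with values in the free algebra on \<open>q\<close>, \<open>p\<close> and initial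
  values \<open>phi 0 = q\<close>, \<open>(phi 1 - phi (- 1)) / 2 = p\<close>. Its Wronskian is constant, so
  \<open>[phi (x + 1), phi x] = hb\<close> modulo the Weyl relation, and therefore the time-ordered product, which
  sends a monomial in the \<open>\<delta>\<^sub>x\<close> to the product of the \<open>phi x\<close> in increasing order of \<open>x\<close>, kills the
  coboundaries in degree \<open>0\<close>. Conversely, if \<open>b\<close> is the leftmost site of an interval, letting
  \<open>phi b\<close> act as multiplication by \<open>\<delta>\<^sub>b\<close> and \<open>phi (b + 1)\<close> as \<open>\<delta>\<^sub>b\<^sub>+\<^sub>1 + hb \<partial>/\<partial>\<delta>\<^sub>b\<close> defines an action of the
  Weyl algebra on polynomials, and acting on \<open>1\<close> inverts time ordering up to coboundaries. So time
  ordering identifies \<open>H\<^sup>0\<close> of every interval with the Weyl algebra; it turns the factorization product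
  of an interval and one to its right into the product, and, since the solutions \<open>h\<close> and \<open>h (- x)\<close>
  only differ by the sign of \<open>p\<close>, time reversal into the reversal of words with \<open>p \<mapsto> - p\<close>.
\<close>

section \<open>Linear maps between spaces of finitely supported functions\<close>

text \<open>The exponential solutions \<alpha>^x and \<alpha>^(-x) become dependent at \<alpha> = 1
  and \<alpha> = -1. Solutions are therefore generated from initial values by the recursion,
  uniformly in \<alpha>; the only division is by 2. The transfer matrix of the recursion has
  determinant one, so initial values can be moved from \<open>0\<close>, \<open>1\<close> to
  \<open>b\<close>, \<open>b + 1\<close> over any commutative ring. The difficult point is that time
  ordering kills nothing but coboundaries. Over general scalars no dimension count is available, so
  an explicit inverse is built. In the action based at \<open>b\<close>, the operator of
  \<open>phi y\<close> differs from multiplication by the generator at \<open>y\<close>, modulo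
  equations of motion, by contractions with sites before \<open>y\<close>, weighted by the retarded
  propagator. A time-ordered monomial is built from its latest site backwards, so each new site
  meets only later or equal ones and all contractions vanish. This is why the action is based at the
  leftmost site and acts from the left.\<close>

lemma lookup_scale [simp]: "Poly_Mapping.lookup (scale r f) k = r * Poly_Mapping.lookup f k"
  by (simp add: Poly_Mapping.map.rep_eq when_def)

lemma scale_zero_right [simp]: "scale r 0 = 0"
  and scale_zero_left [simp]: "scale 0 f = 0"
  and scale_one [simp]: "scale 1 f = f"
  and scale_add_right: "scale r (f + g) = scale r f + scale r g"
  and scale_add_left: "scale (r + s) f = scale r f + scale s f"
  and scale_minus_right [simp]: "scale r (- f) = - scale r f"
  and scale_minus_left [simp]: "scale (- r) f = - scale r f"
  and scale_diff_right: "scale r (f - g) = scale r f - scale r g"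
  and scale_diff_left: "scale (r - s) f = scale r f - scale s f"
  and scale_scale [simp]: "scale r (scale s f) = scale (r * s) f"
  and scale_single: "scale r (Poly_Mapping.single k s) = Poly_Mapping.single k (r * s)"
  by (simp_all add: poly_mapping_eq_iff fun_eq_iff lookup_add lookup_minus lookup_single when_def
      algebra_simps)

text \<open>The simplifier normalizes below \<open>Poly_Mapping.map\<close>, which hides the scalars \<open>0\<close>, \<open>1\<close>, \<open>- r\<close>.\<close>

lemma map_scalar_simps [simp]:
  fixes f :: "'a \<Rightarrow>\<^sub>0 'r::comm_ring_1"
  shows "Poly_Mapping.map (\<lambda>_. 0) f = 0" "Poly_Mapping.map (\<lambda>a. a) f = f"
    "Poly_Mapping.map (\<lambda>a. - a) f = - f" "Poly_Mapping.map uminus f = - f"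
    "Poly_Mapping.map (\<lambda>a. - (r * a)) f = - scale r f"
  by (simp_all add: poly_mapping_eq_iff fun_eq_iff Poly_Mapping.map.rep_eq when_def)

lemma scale_sum: "scale r (sum f A) = (\<Sum>x\<in>A. scale r (f x))"
  by (induction A rule: infinite_finite_induct) (simp_all add: scale_add_right)

text \<open>The operations of the statement are sums over the keys of their argument, which hides
  linearity. Rewritten as \<open>lin\<close> of their values on monomials, they satisfy an identity
  as soon as it holds on each \<open>Poly_Mapping.single k 1\<close>.\<close>

definition lin :: "('a \<Rightarrow> ('b \<Rightarrow>\<^sub>0 'r)) \<Rightarrow> ('a \<Rightarrow>\<^sub>0 'r::comm_ring_1) \<Rightarrow> ('b \<Rightarrow>\<^sub>0 'r)" where
  "lin F f = (\<Sum>k\<in>Poly_Mapping.keys f. scale (Poly_Mapping.lookup f k) (F k))"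

definition is_lin :: "(('a \<Rightarrow>\<^sub>0 'r::comm_ring_1) \<Rightarrow> ('b \<Rightarrow>\<^sub>0 'r)) \<Rightarrow> bool" where
  "is_lin L \<longleftrightarrow> (\<forall>f g. L (f + g) = L f + L g) \<and> (\<forall>r f. L (scale r f) = scale r (L f))"

lemma is_linD:
  assumes "is_lin L"
  shows "L (f + g) = L f + L g" "L (scale r f) = scale r (L f)" "L 0 = 0"
    "L (- f) = - L f" "L (f - g) = L f - L g" "L (sum h A) = (\<Sum>x\<in>A. L (h x))"
proof -
  show add: "L (f + g) = L f + L g" for f g
    using assms by (simp add: is_lin_def)
  show scal: "L (scale r f) = scale r (L f)" for r f
    using assms by (simp add: is_lin_def)
  show zero: "L 0 = 0"
    using scal[of 0 0] by simp
  show minus: "L (- f) = - L f" for f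
    using scal[of "-1" f] by simp
  show "L (f - g) = L f - L g"
    using add[of f "- g"] by (simp add: minus)
  show "L (sum h A) = (\<Sum>x\<in>A. L (h x))"
    by (induction A rule: infinite_finite_induct) (simp_all add: add zero)
qed

text \<open>Cancellation can shrink the keys of a sum, so additivity becomes visible only when all
  terms are summed over one common finite set.\<close>

lemma lin_superset:
  assumes "finite A" "Poly_Mapping.keys f \<subseteq> A"
  shows "lin F f = (\<Sum>k\<in>A. scale (Poly_Mapping.lookup f k) (F k))"
  unfolding lin_def using assms
  by (intro sum.mono_neutral_left) (auto simp: in_keys_iff)

lemma is_lin_lin [intro, simp]:
  fixes F :: "'a \<Rightarrow> ('b \<Rightarrow>\<^sub>0 'r::comm_ring_1)"
  shows "is_lin (lin F)"
  unfolding is_lin_def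
proof (intro conjI allI)
  fix f g :: "'a \<Rightarrow>\<^sub>0 'r"
  let ?A = "Poly_Mapping.keys f \<union> Poly_Mapping.keys g"
  have "Poly_Mapping.keys (f + g) \<subseteq> ?A"
    by (rule Poly_Mapping.keys_add)
  then show "lin F (f + g) = lin F f + lin F g"
    by (simp add: lin_superset[of ?A] lookup_add scale_add_left sum.distrib)
next
  fix r and f :: "'a \<Rightarrow>\<^sub>0 'r"
  have "Poly_Mapping.keys (scale r f) \<subseteq> Poly_Mapping.keys f"
    by (auto simp: in_keys_iff)
  then show "lin F (scale r f) = scale r (lin F f)"
    by (simp add: lin_superset[of "Poly_Mapping.keys f"] scale_sum)
qed

lemma lin_single [simp]: "lin F (Poly_Mapping.single k r) = scale r (F k)"
  by (simp add: lin_def)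

lemma is_lin_id [intro]: "is_lin (\<lambda>f. f)"
  and is_lin_zero [intro]: "is_lin (\<lambda>f. 0)"
  and is_lin_scale [intro]: "is_lin L \<Longrightarrow> is_lin (\<lambda>f. scale r (L f))"
  and is_lin_add [intro]: "is_lin L \<Longrightarrow> is_lin L' \<Longrightarrow> is_lin (\<lambda>f. L f + L' f)"
  and is_lin_diff [intro]: "is_lin L \<Longrightarrow> is_lin L' \<Longrightarrow> is_lin (\<lambda>f. L f - L' f)"
  and is_lin_comp: "is_lin L \<Longrightarrow> is_lin K \<Longrightarrow> is_lin (\<lambda>f. L (K f))"
  unfolding is_lin_def
  by (simp_all add: scale_add_right scale_diff_right scale_sum sum.distrib mult.commute)

lemma is_lin_if [intro]: "is_lin L \<Longrightarrow> is_lin L' \<Longrightarrow> is_lin (\<lambda>f. if P then L f else L' f)"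
  by (cases P) simp_all

lemma is_lin_lin_param [intro]: "(\<And>k. is_lin (G k)) \<Longrightarrow> is_lin (\<lambda>g. lin (\<lambda>k. G k g) f)"
  unfolding is_lin_def lin_def
  by (simp add: scale_add_right scale_sum sum.distrib mult.commute)

definition supp :: "'a set \<Rightarrow> ('a \<Rightarrow>\<^sub>0 'r::comm_ring_1) set" where
  "supp A = {f. Poly_Mapping.keys f \<subseteq> A}"

lemma supp_iff: "f \<in> supp A \<longleftrightarrow> (\<forall>k. k \<notin> A \<longrightarrow> Poly_Mapping.lookup f k = 0)"
  by (auto simp: supp_def in_keys_iff)

lemma supp_single [intro]: "k \<in> A \<Longrightarrow> Poly_Mapping.single k r \<in> supp A"
  by (simp add: supp_def)

lemma supp_UNIV [simp]: "f \<in> supp UNIV"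
  by (simp add: supp_def)

lemma supp_closed [intro]:
  "0 \<in> supp A"
  "f \<in> supp A \<Longrightarrow> g \<in> supp A \<Longrightarrow> f + g \<in> supp A"
  "f \<in> supp A \<Longrightarrow> scale r f \<in> supp A"
  "f \<in> supp A \<Longrightarrow> - f \<in> supp A"
  "f \<in> supp A \<Longrightarrow> g \<in> supp A \<Longrightarrow> f - g \<in> supp A"
  by (simp_all add: supp_iff lookup_add lookup_minus)

lemma supp_sum [intro]: "(\<And>x. x \<in> N \<Longrightarrow> h x \<in> supp A) \<Longrightarrow> sum h N \<in> supp A"
  by (induction N rule: infinite_finite_induct) auto

lemma supp_mono: "A \<subseteq> B \<Longrightarrow> f \<in> supp A \<Longrightarrow> f \<in> supp B"
  by (auto simp: supp_def)

lemma lin_supp: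
  assumes "f \<in> supp A" "\<And>k. k \<in> A \<Longrightarrow> F k \<in> supp B"
  shows "lin F f \<in> supp B"
  using assms unfolding lin_def by (intro supp_sum supp_closed) (auto simp: supp_def)

lemma sum_singles: "(\<Sum>k\<in>Poly_Mapping.keys f. Poly_Mapping.single k (Poly_Mapping.lookup f k)) = f"
proof (rule poly_mapping_eqI)
  fix k
  have "(\<Sum>l\<in>Poly_Mapping.keys f. Poly_Mapping.lookup f l when l = k) = Poly_Mapping.lookup f k"
    by (simp add: when_def in_keys_iff)
  then show "Poly_Mapping.lookup (\<Sum>l\<in>Poly_Mapping.keys f. Poly_Mapping.single l (Poly_Mapping.lookup f l)) k
      = Poly_Mapping.lookup f k"
    by (simp add: lookup_sum lookup_single)
qed

lemma supp_induct [consumes 1, case_names zero add scale single]: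
  assumes "f \<in> supp A"
    and "P 0"
    and "\<And>f g. f \<in> supp A \<Longrightarrow> g \<in> supp A \<Longrightarrow> P f \<Longrightarrow> P g \<Longrightarrow> P (f + g)"
    and "\<And>r f. f \<in> supp A \<Longrightarrow> P f \<Longrightarrow> P (scale r f)"
    and "\<And>k. k \<in> A \<Longrightarrow> P (Poly_Mapping.single k 1)"
  shows "P f"
proof -
  have keys: "Poly_Mapping.keys f \<subseteq> A"
    using assms(1) by (simp add: supp_def)
  define S where "S = (\<lambda>N. \<Sum>k\<in>N. Poly_Mapping.single k (Poly_Mapping.lookup f k))"
  have "S N \<in> supp A \<and> P (S N)" if "finite N" "N \<subseteq> Poly_Mapping.keys f" for N
    using that
  proof (induction N)
    case empty
    then show ?case using assms(2) by (auto simp: S_def)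
  next
    case (insert x N)
    then have x: "x \<in> A" using keys by auto
    have "P (scale (Poly_Mapping.lookup f x) (Poly_Mapping.single x 1))"
      using x by (intro assms(4,5) supp_single)
    then have "P (Poly_Mapping.single x (Poly_Mapping.lookup f x))"
      by simp
    moreover have "S (insert x N) = Poly_Mapping.single x (Poly_Mapping.lookup f x) + S N"
      using insert by (simp add: S_def)
    moreover have "S N \<in> supp A" "P (S N)"
      using insert by simp_all
    moreover have "Poly_Mapping.single x (Poly_Mapping.lookup f x) \<in> supp A"
      using x by (rule supp_single)
    ultimately show ?case
      by (simp add: assms(3) supp_closed(2))
  qed
  from this[of "Poly_Mapping.keys f"] show ?thesis
    by (simp add: S_def sum_singles)
qed

lemma is_lin_eq_on:
  assumes "f \<in> supp A" "is_lin L" "is_lin L'"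
    and "\<And>k. k \<in> A \<Longrightarrow> L (Poly_Mapping.single k 1) = L' (Poly_Mapping.single k 1)"
  shows "L f = L' f"
  using assms(1)
proof (induction rule: supp_induct)
  case (single k)
  then show ?case by (rule assms(4))
qed (simp_all only: is_linD[OF assms(2)] is_linD[OF assms(3)])

lemma is_lin_ext:
  assumes "is_lin L" "is_lin L'"
    and "\<And>k. L (Poly_Mapping.single k 1) = L' (Poly_Mapping.single k 1)"
  shows "L f = L' f"
  using is_lin_eq_on[of f UNIV L L'] assms by simp

section \<open>Congruence modulo the Weyl relation\<close>

lemma scale_conv_mult: "scale r (f :: 'r::comm_ring_1 free_alg) = Poly_Mapping.single 0 r * f"
  by (rule mult_map_scale_conv_mult)

lemma scale_mult_left: "scale r f * g = scale r (f * g :: 'r::comm_ring_1 free_alg)"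
  by (simp add: scale_conv_mult mult.assoc)

text \<open>Scalars are central although words do not commute: they sit on the empty word
  \<open>0\<close>, which commutes with every word.\<close>

lemma scale_mult_right: "f * scale r g = scale r (f * g :: 'r::comm_ring_1 free_alg)"
proof (rule is_lin_ext[where f = f])
  show "is_lin (\<lambda>f. f * scale r g)" "is_lin (\<lambda>f. scale r (f * g))"
    by (simp_all add: is_lin_def distrib_right scale_mult_left scale_add_right mult.commute)
  fix k
  show "Poly_Mapping.single k 1 * scale r g = scale r (Poly_Mapping.single k 1 * g)"
    by (simp add: scale_conv_mult mult.assoc[symmetric] mult_single)
qed

lemma ring_free_ring: "ring (free_ring :: 'r::comm_ring_1 free_alg ring)"
  by unfold_locales
    (auto simp: free_ring_def algebra_simps Units_def intro: exI[of _ "- _"] add.left_inverse)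

lemma ideal_free_ringI:
  fixes N :: "'r::comm_ring_1 free_alg set"
  assumes "0 \<in> N" "\<And>f g. f \<in> N \<Longrightarrow> g \<in> N \<Longrightarrow> f + g \<in> N"
    "\<And>f g. f \<in> N \<Longrightarrow> g * f \<in> N" "\<And>f g. f \<in> N \<Longrightarrow> f * g \<in> N"
  shows "ideal N free_ring"
proof (rule idealI[OF ring_free_ring])
  interpret ring "free_ring :: 'r free_alg ring" by (rule ring_free_ring)
  show "subgroup N (add_monoid free_ring)"
  proof (rule add.subgroupI)
    fix a assume a: "a \<in> N"
    have "\<ominus>\<^bsub>free_ring\<^esub> a = - a"
      by (rule minus_equality) (simp_all add: free_ring_def)
    then show "\<ominus>\<^bsub>free_ring\<^esub> a \<in> N"
      using assms(3)[OF a, of "-1"] by simp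
  qed (use assms in \<open>auto simp: free_ring_def\<close>)
qed (use assms in \<open>auto simp: free_ring_def\<close>)

abbreviation weyl_rel :: "'r::comm_ring_1 \<Rightarrow> 'r free_alg" where
  "weyl_rel hb \<equiv> free_gen Gen_p * free_gen Gen_q - free_gen Gen_q * free_gen Gen_p - scale hb 1"

lemma ideal_weyl_ideal: "ideal (weyl_ideal hb) free_ring"
  unfolding weyl_ideal_def
  by (rule ring.genideal_ideal[OF ring_free_ring]) (simp add: free_ring_def)

lemma weyl_ideal_closed:
  "0 \<in> weyl_ideal hb"
  "f \<in> weyl_ideal hb \<Longrightarrow> g \<in> weyl_ideal hb \<Longrightarrow> f + g \<in> weyl_ideal hb"
  "f \<in> weyl_ideal hb \<Longrightarrow> g * f \<in> weyl_ideal hb"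
  "f \<in> weyl_ideal hb \<Longrightarrow> f * g \<in> weyl_ideal hb"
proof -
  interpret ideal "weyl_ideal hb" free_ring by (rule ideal_weyl_ideal)
  show "0 \<in> weyl_ideal hb" using additive_subgroup.zero_closed[OF is_additive_subgroup] by (simp add: free_ring_def)
  show "f \<in> weyl_ideal hb \<Longrightarrow> g \<in> weyl_ideal hb \<Longrightarrow> f + g \<in> weyl_ideal hb"
    using additive_subgroup.a_closed[OF is_additive_subgroup, of f g] by (simp add: free_ring_def)
  show "f \<in> weyl_ideal hb \<Longrightarrow> g * f \<in> weyl_ideal hb"
    using I_l_closed[of f g] by (simp add: free_ring_def)
  show "f \<in> weyl_ideal hb \<Longrightarrow> f * g \<in> weyl_ideal hb"
    using I_r_closed[of f g] by (simp add: free_ring_def)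
qed

lemma weyl_rel_in_ideal: "weyl_rel hb \<in> weyl_ideal hb"
  unfolding weyl_ideal_def
  by (rule ring.genideal_self'[OF ring_free_ring]) (simp add: free_ring_def)

text \<open>Minimality of the generated ideal as an induction principle: it shows that
  \<open>free_rev\<close> preserves the ideal and that \<open>rho\<close> kills it, by checking the
  single relation.\<close>

lemma weyl_ideal_subset:
  assumes "0 \<in> N" "\<And>f g. f \<in> N \<Longrightarrow> g \<in> N \<Longrightarrow> f + g \<in> N"
    "\<And>f g. f \<in> N \<Longrightarrow> g * f \<in> N" "\<And>f g. f \<in> N \<Longrightarrow> f * g \<in> N"
    "weyl_rel hb \<in> N"
  shows "weyl_ideal hb \<subseteq> N"
  unfolding weyl_ideal_def
  by (rule ring.genideal_minimal[OF ring_free_ring ideal_free_ringI]) (use assms in auto)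

text \<open>Calculations take place on representatives modulo the ideal; cosets appear only when the
  algebras of the statement are assembled.\<close>

definition wcong :: "'r::comm_ring_1 \<Rightarrow> 'r free_alg \<Rightarrow> 'r free_alg \<Rightarrow> bool" where
  "wcong hb f g \<longleftrightarrow> f - g \<in> weyl_ideal hb"

lemma wcong_refl [intro, simp]: "wcong hb f f"
  by (simp add: wcong_def weyl_ideal_closed)

lemma wcong_sym: "wcong hb f g \<Longrightarrow> wcong hb g f"
  using weyl_ideal_closed(3)[of "f - g" hb "-1"] by (simp add: wcong_def)

lemma wcong_trans [trans]: "wcong hb f g \<Longrightarrow> wcong hb g h \<Longrightarrow> wcong hb f h"
  using weyl_ideal_closed(2)[of "f - g" hb "g - h"] by (simp add: wcong_def)

lemma wcong_add: "wcong hb f g \<Longrightarrow> wcong hb f' g' \<Longrightarrow> wcong hb (f + f') (g + g')"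
  using weyl_ideal_closed(2)[of "f - g" hb "f' - g'"] by (simp add: wcong_def algebra_simps)

lemma wcong_mult_left: "wcong hb f g \<Longrightarrow> wcong hb (h * f) (h * g)"
  using weyl_ideal_closed(3)[of "f - g" hb h] by (simp add: wcong_def algebra_simps)

lemma wcong_mult_right: "wcong hb f g \<Longrightarrow> wcong hb (f * h) (g * h)"
  using weyl_ideal_closed(4)[of "f - g" hb h] by (simp add: wcong_def algebra_simps)

lemma wcong_mult: "wcong hb f g \<Longrightarrow> wcong hb f' g' \<Longrightarrow> wcong hb (f * f') (g * g')"
  by (meson wcong_mult_left wcong_mult_right wcong_trans)

lemma wcong_scale: "wcong hb f g \<Longrightarrow> wcong hb (scale r f) (scale r g)"
  by (simp add: scale_conv_mult wcong_mult_left)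

lemma wcong_uminus: "wcong hb f g \<Longrightarrow> wcong hb (- f) (- g)"
  using wcong_scale[of hb f g "-1"] by simp

lemma wcong_diff: "wcong hb f g \<Longrightarrow> wcong hb f' g' \<Longrightarrow> wcong hb (f - f') (g - g')"
  using wcong_add[OF _ wcong_uminus, of hb f g f' g'] by simp

lemma wcong_zero_iff: "wcong hb f 0 \<longleftrightarrow> f \<in> weyl_ideal hb"
  by (simp add: wcong_def)

lemma wcong_iff_diff: "wcong hb f g \<longleftrightarrow> wcong hb (f - g) 0"
  by (simp add: wcong_def)

lemma wcong_sum: "(\<And>x. x \<in> A \<Longrightarrow> wcong hb (f x) (g x)) \<Longrightarrow> wcong hb (sum f A) (sum g A)"
  by (induction A rule: infinite_finite_induct) (auto intro: wcong_add)

lemma weyl_commutator: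
  "wcong hb (free_gen Gen_p * free_gen Gen_q - free_gen Gen_q * free_gen Gen_p) (scale hb 1)"
  using weyl_rel_in_ideal by (simp add: wcong_def)

text \<open>A scalar commutator acts on powers as a derivation, with one application of the relation
  per factor. At \<open>k = 0\<close> the truncated exponent \<open>k - 1\<close> is harmless
  because its coefficient is zero.\<close>

lemma wcong_power_commute:
  assumes "wcong hb (g * f - f * g) (scale r 1)"
  shows "wcong hb (g * f ^ k) (f ^ k * g + scale (of_nat k * r) (f ^ (k - 1)))"
proof (induction k)
  case (Suc k)
  have "wcong hb (g * f) (f * g + scale r 1)"
    using assms by (simp add: wcong_def algebra_simps)
  then have "wcong hb (g * f * f ^ k) ((f * g + scale r 1) * f ^ k)"
    by (rule wcong_mult_right)
  also have "(f * g + scale r 1) * f ^ k = f * (g * f ^ k) + scale r (f ^ k)"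
    by (simp add: algebra_simps scale_mult_left)
  also have "wcong hb \<dots> (f * (f ^ k * g + scale (of_nat k * r) (f ^ (k - 1))) + scale r (f ^ k))"
    by (intro wcong_add wcong_mult_left Suc.IH wcong_refl)
  also have "f * (f ^ k * g + scale (of_nat k * r) (f ^ (k - 1))) + scale r (f ^ k) =
      f ^ Suc k * g + scale (of_nat (Suc k) * r) (f ^ k)"
  proof (cases k)
    case (Suc n)
    have "scale (of_nat (Suc k) * r) (f ^ k) = scale (of_nat k * r) (f ^ k) + scale r (f ^ k)"
      by (simp add: distrib_right scale_add_left add.commute)
    then show ?thesis
      by (simp add: Suc distrib_left scale_mult_right mult.assoc del: of_nat_Suc)
  qed simp
  finally show ?case by (simp only: power_Suc mult.assoc[of g f] diff_Suc_1)
qed simp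


subsection \<open>Reversal of words\<close>

definition word_rev :: "word \<Rightarrow> 'r::comm_ring_1 free_alg" where
  "word_rev w = (case w of Word l \<Rightarrow>
     Poly_Mapping.single (Word (rev l)) ((- 1) ^ count_list l Gen_p))"

definition free_rev :: "'r::comm_ring_1 free_alg \<Rightarrow> 'r free_alg" where
  "free_rev = lin word_rev"

lemma is_lin_free_rev: "is_lin free_rev"
  by (simp add: free_rev_def)

lemmas free_rev_lin = is_linD[OF is_lin_free_rev]

lemma is_lin_mult: "is_lin (\<lambda>f. f * g :: 'r::comm_ring_1 free_alg)" "is_lin (\<lambda>g. f * g :: 'r::comm_ring_1 free_alg)"
  by (simp_all add: is_lin_def distrib_left distrib_right scale_mult_left scale_mult_right)

lemma is_lin_free_rev_comp: "is_lin L \<Longrightarrow> is_lin (\<lambda>f. free_rev (L f))"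
  by (rule is_lin_comp[OF is_lin_free_rev])

lemma free_rev_mult: "free_rev (f * g) = free_rev g * free_rev f"
proof (rule is_lin_ext[where f = f])
  fix k
  show "free_rev (Poly_Mapping.single k 1 * g) = free_rev g * free_rev (Poly_Mapping.single k 1)"
  proof (rule is_lin_ext[where f = g])
    fix l
    obtain u v where "k = Word u" "l = Word v" by (metis word.exhaust)
    then show "free_rev (Poly_Mapping.single k 1 * Poly_Mapping.single l 1) =
        free_rev (Poly_Mapping.single l 1) * free_rev (Poly_Mapping.single k 1)"
      by (simp add: free_rev_def mult_single word_rev_def power_add mult.commute)
  qed (intro is_lin_free_rev_comp is_lin_mult is_lin_comp[OF is_lin_mult(1) is_lin_free_rev] is_lin_comp[OF is_lin_mult(2)] is_lin_free_rev)+
qed (intro is_lin_free_rev_comp is_lin_mult is_lin_comp[OF is_lin_mult(2) is_lin_free_rev])+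

lemma free_rev_free_rev [simp]: "free_rev (free_rev f) = f"
proof (rule is_lin_ext[where f = f])
  fix k
  show "free_rev (free_rev (Poly_Mapping.single k 1)) = Poly_Mapping.single k 1"
    by (cases k) (simp add: free_rev_def word_rev_def count_list_rev flip: power_add mult_2)
qed (intro is_lin_free_rev_comp is_lin_free_rev is_lin_id)+

lemma free_rev_one [simp]: "free_rev 1 = 1"
  by (simp add: free_rev_def word_rev_def zero_word_def flip: single_one)

lemma free_rev_gen [simp]:
  "free_rev (free_gen Gen_q) = free_gen Gen_q"
  "free_rev (free_gen Gen_p) = - free_gen Gen_p"
  by (simp_all add: free_rev_def free_gen_def word_rev_def single_uminus)

lemma free_rev_prod_list: "free_rev (prod_list fs) = prod_list (rev (map free_rev fs))"
  by (induction fs) (simp_all add: free_rev_mult)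

text \<open>Reversing the words flips the commutator of \<open>p\<close> and \<open>q\<close>, and
  the sign of \<open>p\<close> flips it back, so the defining relation is fixed.\<close>

lemma free_rev_weyl_ideal: "f \<in> weyl_ideal hb \<Longrightarrow> free_rev f \<in> weyl_ideal hb"
proof -
  have "weyl_ideal hb \<subseteq> {f. free_rev f \<in> weyl_ideal hb}"
  proof (rule weyl_ideal_subset)
    have "free_rev (weyl_rel hb) = weyl_rel hb"
      by (simp add: free_rev_lin free_rev_mult)
    then show "weyl_rel hb \<in> {f. free_rev f \<in> weyl_ideal hb}"
      by (simp add: weyl_rel_in_ideal)
  qed (simp_all add: free_rev_lin free_rev_mult weyl_ideal_closed)
  then show "f \<in> weyl_ideal hb \<Longrightarrow> free_rev f \<in> weyl_ideal hb" by auto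
qed

lemma wcong_free_rev: "wcong hb f g \<Longrightarrow> wcong hb (free_rev f) (free_rev g)"
  using free_rev_weyl_ideal[of "f - g"] by (simp add: wcong_def free_rev_lin)

text \<open>Letters are peeled off on the left, which is how the left action \<open>rho\<close>
  composes.\<close>

lemma free_alg_induct [case_names add scale one gen]:
  fixes f :: "'r::comm_ring_1 free_alg"
  assumes "\<And>f g. P f \<Longrightarrow> P g \<Longrightarrow> P (f + g)" "\<And>r f. P f \<Longrightarrow> P (scale r f)"
    and "P 1" "\<And>x f. P f \<Longrightarrow> P (free_gen x * f)"
  shows "P f"
proof -
  have word: "P (Poly_Mapping.single (Word l) 1)" for l
  proof (induction l)
    case Nil
    then show ?case using assms(3) by (simp add: zero_word_def flip: single_one)
  next
    case (Cons x l)
    have "Poly_Mapping.single (Word (x # l)) (1::'r) = free_gen x * Poly_Mapping.single (Word l) 1"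
      by (simp add: free_gen_def mult_single)
    then show ?case using assms(4)[OF Cons] by simp
  qed
  have "f \<in> supp UNIV" by simp
  then show ?thesis
  proof (induction rule: supp_induct)
    case zero
    then show ?case using assms(2)[OF assms(3), of 0] by simp
  next
    case (single k)
    then show ?case using word by (cases k) simp
  qed (use assms in auto)
qed

section \<open>Polynomial observables\<close>

text \<open>Multiplication by an even generator (see \<open>sym_mult_pos\<close>), kept apart from
  \<open>sym_mult\<close> because it involves no signs and pairs with \<open>even_deriv\<close> as
  position and momentum.\<close>

definition pos_mult :: "int \<Rightarrow> 'r::comm_ring_1 symalg \<Rightarrow> 'r symalg" where
  "pos_mult y = lin (\<lambda>(m, S). Poly_Mapping.single (add_mset y m, S) 1)"

lemma even_deriv_conv_lin:
  "even_deriv x f = lin (\<lambda>(m, S). Poly_Mapping.single (m - {#x#}, S) (of_nat (count m x))) f"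
  unfolding even_deriv_def lin_def
  by (rule sum.cong) (auto simp: scale_single mult.commute)

lemma pos_mult_single [simp]:
  "pos_mult y (Poly_Mapping.single (m, S) r) = Poly_Mapping.single (add_mset y m, S) r"
  by (simp add: pos_mult_def)

lemma even_deriv_single [simp]:
  "even_deriv x (Poly_Mapping.single (m, S) r) =
    Poly_Mapping.single (m - {#x#}, S) (of_nat (count m x) * r)"
  by (simp add: even_deriv_conv_lin mult.commute)

lemma is_lin_pos_mult [intro]: "is_lin (pos_mult y)"
  and is_lin_even_deriv [intro]: "is_lin (even_deriv y)"
  unfolding pos_mult_def even_deriv_conv_lin by auto

lemmas pos_mult_lin = is_linD[OF is_lin_pos_mult]
lemmas even_deriv_lin = is_linD[OF is_lin_even_deriv]

lemma is_lin_pos_mult_comp [intro]: "is_lin L \<Longrightarrow> is_lin (\<lambda>f. pos_mult y (L f))"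
  and is_lin_even_deriv_comp [intro]: "is_lin L \<Longrightarrow> is_lin (\<lambda>f. even_deriv y (L f))"
  by (rule is_lin_comp[OF is_lin_pos_mult] is_lin_comp[OF is_lin_even_deriv], assumption)+

lemma pos_mult_commute: "pos_mult y (pos_mult z f) = pos_mult z (pos_mult y f)"
proof (rule is_lin_ext[where f = f])
  fix k
  show "pos_mult y (pos_mult z (Poly_Mapping.single k 1)) =
      pos_mult z (pos_mult y (Poly_Mapping.single k 1))"
    by (cases k) (simp add: add_mset_commute)
qed auto

lemma even_deriv_commute: "even_deriv y (even_deriv z f) = even_deriv z (even_deriv y f)"
proof (rule is_lin_ext[where f = f])
  fix k :: "int multiset \<times> int set"
  show "even_deriv y (even_deriv z (Poly_Mapping.single k 1)) =
      even_deriv z (even_deriv y (Poly_Mapping.single k (1::'a)))"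
    by (cases k; cases "y = z") (simp_all add: mult.commute add_mset_commute)
qed auto

text \<open>The canonical commutation relation on polynomials, from which the \<open>hb\<close> in
  the action \<open>rho\<close> arises.\<close>

lemma even_deriv_pos_mult:
  "even_deriv y (pos_mult z f) = pos_mult z (even_deriv y f) + (if y = z then f else 0)"
proof (rule is_lin_ext[where f = f])
  fix k :: "int multiset \<times> int set"
  obtain m S where k: "k = (m, S)" by (cases k)
  show "even_deriv y (pos_mult z (Poly_Mapping.single k 1)) =
      pos_mult z (even_deriv y (Poly_Mapping.single k (1::'a))) +
      (if y = z then Poly_Mapping.single k 1 else 0)"
  proof (cases "y = z")
    case True
    show ?thesis
    proof (cases "y \<in># m")
      case mem: True
      then show ?thesis
        using True by (simp add: k insert_DiffM flip: single_add) (simp add: add.commute)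
    next
      case False
      \<comment> \<open>Here truncated subtraction would leave \<open>m\<close> unchanged, but the
        multiplicity in front of it is zero.\<close>
      then have "count m y = 0" by (simp add: not_in_iff)
      then show ?thesis using True by (simp add: k pos_mult_lin)
    qed
  next
    case False
    then show ?thesis by (simp add: k)
  qed
qed (intro is_lin_add is_lin_if is_lin_pos_mult_comp is_lin_even_deriv_comp is_lin_id is_lin_zero)+

definition even_mons :: "int set \<Rightarrow> (int multiset \<times> int set) set" where
  "even_mons A = {(m, S). set_mset m \<subseteq> A \<and> S = {}}"

lemma single_in_even_mons: "set_mset m \<subseteq> A \<Longrightarrow> Poly_Mapping.single (m, {}) r \<in> supp (even_mons A)"
  by (auto simp: even_mons_def)

lemma even_mons_mono: "A \<subseteq> B \<Longrightarrow> f \<in> supp (even_mons A) \<Longrightarrow> f \<in> supp (even_mons B)"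
  by (erule supp_mono[rotated]) (auto simp: even_mons_def)

lemma sym_one_in_even_mons [simp]: "sym_one \<in> supp (even_mons A)"
  unfolding sym_one_def by (rule single_in_even_mons) simp

lemma pos_mult_closed: "y \<in> A \<Longrightarrow> f \<in> supp (even_mons A) \<Longrightarrow> pos_mult y f \<in> supp (even_mons A)"
  unfolding pos_mult_def by (erule lin_supp) (auto simp: even_mons_def intro!: supp_single)

lemma even_deriv_closed: "f \<in> supp (even_mons A) \<Longrightarrow> even_deriv y f \<in> supp (even_mons A)"
  unfolding even_deriv_conv_lin by (erule lin_supp) (auto simp: even_mons_def intro!: supp_single dest: in_diffD)

section \<open>Time-ordered products\<close>

fun recur :: "'r::comm_ring_1 \<Rightarrow> 'r \<Rightarrow> 'r \<Rightarrow> nat \<Rightarrow> 'r" where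
  "recur c s t 0 = s"
| "recur c s t (Suc 0) = t"
| "recur c s t (Suc (Suc n)) = c * recur c s t (Suc n) - recur c s t n"

text \<open>\<open>c\<close> and \<open>half\<close> stand for the images of \<alpha> + 1/\<alpha>
  and of 1/2 in the scalars; \<open>half\<close> normalizes the even solution.\<close>

locale lattice_field =
  fixes c half hb :: "'r::comm_ring_1"
  assumes half: "half + half = 1"
begin

text \<open>Solutions of \<open>h (x + 1) - c h x + h (x - 1) = 0\<close>, normalized so that \<open>phi 0\<close> and
  \<open>(phi 1 - phi (- 1)) / 2\<close> below are the generators \<open>q\<close> and \<open>p\<close>.\<close>

definition even_sol :: "int \<Rightarrow> 'r" where
  "even_sol x = recur c 1 (half * c) (nat \<bar>x\<bar>)"

definition odd_sol :: "int \<Rightarrow> 'r" where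
  "odd_sol x = (if x < 0 then -1 else 1) * recur c 0 1 (nat \<bar>x\<bar>)"

lemma even_sol_minus [simp]: "even_sol (- x) = even_sol x"
  by (simp add: even_sol_def)

lemma odd_sol_minus [simp]: "odd_sol (- x) = - odd_sol x"
  by (simp add: odd_sol_def)

lemma even_sol_0 [simp]: "even_sol 0 = 1" and even_sol_1: "even_sol 1 = half * c"
  and odd_sol_0 [simp]: "odd_sol 0 = 0" and odd_sol_1 [simp]: "odd_sol 1 = 1"
  by (simp_all add: even_sol_def odd_sol_def)

lemma even_sol_rec: "even_sol (x + 1) = c * even_sol x - even_sol (x - 1)"
proof -
  have pos: "even_sol (x + 1) = c * even_sol x - even_sol (x - 1)" if "x \<ge> 1" for x
  proof -
    obtain n where "x = int n + 1" using \<open>x \<ge> 1\<close> by (metis add.commute le_add_diff_inverse zero_le_imp_eq_int diff_ge_0_iff_ge)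
    then show ?thesis by (simp add: even_sol_def nat_add_distrib)
  qed
  \<comment> \<open>The equation at \<open>x = 0\<close> is the matching condition between the two
    half-lines; together with evenness it forces the value \<open>half * c\<close> at
    \<open>1\<close>.\<close>
  have "even_sol 1 + even_sol (- 1) = c"
    using half by (simp only: even_sol_minus even_sol_1 flip: distrib_right) simp
  then have zero: "even_sol 1 = c - even_sol (- 1)"
    by (simp add: algebra_simps)
  consider "x \<ge> 1" | "x = 0" | "- x \<ge> 1" by linarith
  then show ?thesis
  proof cases
    case 3
    have "even_sol (- x + 1) = even_sol (x - 1)" "even_sol (- x - 1) = even_sol (x + 1)"
      using even_sol_minus[of "x - 1"] even_sol_minus[of "x + 1"] by (simp_all only: minus_diff_eq minus_add_distrib) simp_all
    with pos[OF 3] show ?thesis by (simp add: algebra_simps)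
  qed (use pos zero in simp_all)
qed

lemma odd_sol_rec: "odd_sol (x + 1) = c * odd_sol x - odd_sol (x - 1)"
proof -
  have pos: "odd_sol (x + 1) = c * odd_sol x - odd_sol (x - 1)" if "x \<ge> 1" for x
  proof -
    obtain n where "x = int n + 1" using \<open>x \<ge> 1\<close> by (metis add.commute le_add_diff_inverse zero_le_imp_eq_int diff_ge_0_iff_ge)
    then show ?thesis by (simp add: odd_sol_def nat_add_distrib)
  qed
  consider "x \<ge> 1" | "x = 0" | "- x \<ge> 1" by linarith
  then show ?thesis
  proof cases
    case 3
    have "odd_sol (- x + 1) = - odd_sol (x - 1)" "odd_sol (- x - 1) = - odd_sol (x + 1)"
      using odd_sol_minus[of "x - 1"] odd_sol_minus[of "x + 1"] by (simp_all only: minus_diff_eq minus_add_distrib) simp_all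
    with pos[OF 3] show ?thesis by (simp add: algebra_simps)
  qed (use pos in simp_all)
qed

text \<open>Both solutions obey the same recursion, whose transfer matrix has determinant one. The
  value is propagated from \<open>x = 0\<close> in both directions.\<close>

lemma wronskian: "even_sol x * odd_sol (x + 1) - even_sol (x + 1) * odd_sol x = 1"
proof (induction x rule: int_induct[where k = 0])
  case (step1 i)
  have "even_sol (i + 1 + 1) = c * even_sol (i + 1) - even_sol i" "odd_sol (i + 1 + 1) = c * odd_sol (i + 1) - odd_sol i"
    using even_sol_rec[of "i + 1"] odd_sol_rec[of "i + 1"] by simp_all
  then show ?case using step1(2) by (simp only:) (simp add: algebra_simps)
next
  case (step2 i)
  have "even_sol (i + 1) = c * even_sol i - even_sol (i - 1)" "odd_sol (i + 1) = c * odd_sol i - odd_sol (i - 1)" "i - 1 + 1 = i"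
    using even_sol_rec[of i] odd_sol_rec[of i] by simp_all
  then show ?case using step2(2) by (simp only:) (simp add: algebra_simps)
qed simp

definition phi :: "int \<Rightarrow> 'r free_alg" where
  "phi x = scale (even_sol x) (free_gen Gen_q) + scale (odd_sol x) (free_gen Gen_p)"

lemma phi_rec: "phi (x + 1) = scale c (phi x) - phi (x - 1)"
  by (simp add: phi_def even_sol_rec[of x] odd_sol_rec[of x] scale_diff_left scale_add_right)

lemma phi_0 [simp]: "phi 0 = free_gen Gen_q"
  by (simp add: phi_def)

text \<open>By bilinearity the commutator is the Wronskian times that of \<open>p\<close> and
  \<open>q\<close>.\<close>

lemma phi_commutator: "wcong hb (phi (x + 1) * phi x - phi x * phi (x + 1)) (scale hb 1)"
proof -
  let ?q = "free_gen Gen_q :: 'r free_alg" and ?p = "free_gen Gen_p :: 'r free_alg"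
  let ?k = "odd_sol (x + 1) * even_sol x - odd_sol x * even_sol (x + 1)"
  have "phi (x + 1) * phi x - phi x * phi (x + 1) = scale ?k (?p * ?q - ?q * ?p)"
    unfolding phi_def
    by (simp add: distrib_left distrib_right scale_mult_left scale_mult_right
      scale_add_right scale_diff_right scale_diff_left mult.commute)
  also have "?k = 1"
    using wronskian[of x] by (simp add: mult.commute)
  finally show ?thesis
    using weyl_commutator[of hb] by simp
qed

lemma phi_power_commute:
  "wcong hb (phi (x + 1) * phi x ^ k) (phi x ^ k * phi (x + 1) + scale (of_nat k * hb) (phi x ^ (k - 1)))"
  by (rule wcong_power_commute[OF phi_commutator])

section \<open>Ordered products over multisets of sites\<close>

definition ordprod :: "int multiset \<Rightarrow> 'r free_alg" where
  "ordprod m = prod_list (map phi (sorted_list_of_multiset m))"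

text \<open>The odd part of a key is dropped, so the value is meaningful in degree zero; being
  total, it lets \<open>time_ord_eom\<close> be stated for all arguments.\<close>

definition time_ord :: "'r symalg \<Rightarrow> 'r free_alg" where
  "time_ord = lin (\<lambda>(m, S). ordprod m)"

lemma ordprod_mset: "sorted l \<Longrightarrow> ordprod (mset l) = prod_list (map phi l)"
  by (simp add: ordprod_def sorted_sort_id)

lemma ordprod_empty [simp]: "ordprod {#} = 1"
  by (simp add: ordprod_def)

lemma ordprod_union:
  assumes "\<And>x y. x \<in># m \<Longrightarrow> y \<in># n \<Longrightarrow> x \<le> y"
  shows "ordprod (m + n) = ordprod m * ordprod n"
proof -
  let ?l = "sorted_list_of_multiset m @ sorted_list_of_multiset n"
  have "sorted ?l"
    using assms by (auto simp: sorted_append)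
  from ordprod_mset[OF this] show ?thesis
    by (simp add: ordprod_def)
qed

lemma ordprod_replicate [simp]: "ordprod (replicate_mset k x) = phi x ^ k"
proof -
  have "replicate_mset k x = mset (replicate k x)" by simp
  then show ?thesis by (simp only: ordprod_mset sorted_replicate) (induction k, simp_all)
qed

lemma ordprod_single [simp]: "ordprod {#x#} = phi x"
  using ordprod_replicate[of 1 x] by simp

lemma time_ord_single [simp]: "time_ord (Poly_Mapping.single (m, S) r) = scale r (ordprod m)"
  by (simp add: time_ord_def)

lemma is_lin_time_ord: "is_lin time_ord"
  by (simp add: time_ord_def)

lemmas time_ord_lin = is_linD[OF is_lin_time_ord]

lemma time_ord_one [simp]: "time_ord sym_one = 1"
  by (simp add: sym_one_def)

lemma time_ord_pos_mult:
  assumes "f \<in> supp (even_mons A)" "\<And>y. y \<in> A \<Longrightarrow> x \<le> y"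
  shows "time_ord (pos_mult x f) = phi x * time_ord f"
  using assms(1)
proof (rule is_lin_eq_on)
  fix k :: "int multiset \<times> int set"
  assume "k \<in> even_mons A"
  then obtain m where m: "k = (m, {})" "set_mset m \<subseteq> A" by (auto simp: even_mons_def)
  have "ordprod ({#x#} + m) = phi x * ordprod m"
    by (subst ordprod_union) (use m assms(2) in auto)
  then show "time_ord (pos_mult x (Poly_Mapping.single k 1)) = phi x * time_ord (Poly_Mapping.single k 1)"
    by (simp add: m)
qed (rule is_lin_comp[OF is_lin_time_ord is_lin_pos_mult] is_lin_comp[OF is_lin_mult(2) is_lin_time_ord])+

section \<open>Time ordering kills the equations of motion\<close>

lemma multiset_split:
  "m = {#y \<in># m. y < x#} + (replicate_mset (count m x) x + {#y \<in># m. x < y#})" for x :: int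
  by (rule multiset_eqI) auto

text \<open>The differential of \<open>g \<delta>bar\<^sub>x\<close>, for \<open>g\<close> of degree \<open>0\<close>.\<close>

definition eom :: "int \<Rightarrow> 'r symalg \<Rightarrow> 'r symalg" where
  "eom x g = pos_mult (x - 1) g - scale c (pos_mult x g) + pos_mult (x + 1) g
     + scale hb (even_deriv x g)"

lemma is_lin_eom: "is_lin (eom x)"
  unfolding eom_def[abs_def] by (intro is_lin_add is_lin_diff is_lin_scale is_lin_pos_mult is_lin_even_deriv)

lemmas eom_lin = is_linD[OF is_lin_eom]

text \<open>After \<open>phi (x - 1)\<close> is eliminated by the recursion, the terms with
  \<open>c\<close> cancel. What is left is minus the commutator of \<open>phi (x + 1)\<close> with
  the block of factors \<open>phi x\<close>, and the contraction term \<open>hb\<close> times the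
  derivative is exactly its value.\<close>

lemma time_ord_eom_single:
  "wcong hb (time_ord (eom x (Poly_Mapping.single (m, S) 1))) 0"
proof -
  define L R k where "L = {#y \<in># m. y < x#}" and "R = {#y \<in># m. x < y#}" and "k = count m x"
  have m: "m = L + (replicate_mset k x + R)"
    unfolding L_def R_def k_def by (rule multiset_split)
  have split: "ordprod (L' + (M + R')) = ordprod L' * (ordprod M * ordprod R')"
    if "set_mset L' \<subseteq> {..<x}" "set_mset M \<subseteq> {x}" "set_mset R' \<subseteq> {x<..}" for L' M R'
  proof -
    have "ordprod (M + R') = ordprod M * ordprod R'"
      using that by (intro ordprod_union) (force simp: subset_iff)
    moreover have "ordprod (L' + (M + R')) = ordprod L' * ordprod (M + R')"
      using that by (intro ordprod_union) (force simp: subset_iff)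
    ultimately show ?thesis by simp
  qed
  have lt: "set_mset L \<subseteq> {..<x}" and gt: "set_mset R \<subseteq> {x<..}"
    by (auto simp: L_def R_def)
  have rep: "set_mset (replicate_mset n x) \<subseteq> {x}" for n by simp
  \<comment> \<open>Sites are integers, so everything before \<open>x\<close> is at most
    \<open>x - 1\<close>: the new factor lands at the very end of the left block. Likewise
    \<open>x + 1\<close> lands at the start of the right block.\<close>
  have "ordprod (L + {#x - 1#}) = ordprod L * ordprod {#x - 1#}"
    by (rule ordprod_union) (use lt in \<open>auto simp: subset_iff\<close>)
  then have L: "ordprod (add_mset (x - 1) L) = ordprod L * phi (x - 1)" by simp
  have "ordprod ({#x + 1#} + R) = ordprod {#x + 1#} * ordprod R"
    by (rule ordprod_union) (use gt in \<open>auto simp: subset_iff\<close>)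
  then have R: "ordprod (add_mset (x + 1) R) = phi (x + 1) * ordprod R" by simp
  have 1: "ordprod (add_mset (x - 1) m) = ordprod L * phi (x - 1) * (phi x ^ k * ordprod R)"
    using split[of "add_mset (x - 1) L" "replicate_mset k x" R] lt gt rep[of k]
    by (simp add: m L)
  have 2: "ordprod (add_mset x m) = ordprod L * (phi x ^ Suc k * ordprod R)"
    using split[of L "replicate_mset (Suc k) x" R] lt gt rep[of "Suc k"] ordprod_replicate[of "Suc k" x]
    by (simp add: m)
  have 3: "ordprod (add_mset (x + 1) m) = ordprod L * (phi x ^ k * (phi (x + 1) * ordprod R))"
    using split[of L "replicate_mset k x" "add_mset (x + 1) R"] lt gt rep[of k]
    by (simp add: m R)
  \<comment> \<open>The factor \<open>of_nat k\<close> is kept on both sides: for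
    \<open>k = 0\<close> neither \<open>m - {#x#}\<close> nor \<open>k - 1\<close> is really
    smaller, but both sides are zero.\<close>
  have 4: "scale (of_nat k) (ordprod (m - {#x#})) =
      scale (of_nat k) (ordprod L * (phi x ^ (k - 1) * ordprod R))"
  proof (cases k)
    case (Suc n)
    have "m - {#x#} = L + (replicate_mset n x + R)"
      by (simp add: m Suc)
    then show ?thesis
      using split[of L "replicate_mset n x" R] lt gt rep[of n] by (simp add: Suc)
  qed simp
  let ?P = "phi (x + 1) * phi x ^ k"
  let ?Q = "phi x ^ k * phi (x + 1) + scale (of_nat k * hb) (phi x ^ (k - 1))"
  have prev: "phi (x - 1) = scale c (phi x) - phi (x + 1)"
    by (simp add: phi_rec)
  have "time_ord (eom x (Poly_Mapping.single (m, S) 1)) = ordprod (add_mset (x - 1) m)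
      - scale c (ordprod (add_mset x m)) + ordprod (add_mset (x + 1) m)
      + scale hb (scale (of_nat k) (ordprod (m - {#x#})))"
    by (simp add: eom_def time_ord_lin k_def)
  also have "\<dots> = ordprod L * ((?Q - ?P) * ordprod R)"
    unfolding 1 2 3 4 prev
    by (simp add: algebra_simps scale_mult_left scale_mult_right)
  finally have "time_ord (eom x (Poly_Mapping.single (m, S) 1)) = ordprod L * ((?Q - ?P) * ordprod R)" .
  moreover have "wcong hb (ordprod L * ((?Q - ?P) * ordprod R)) (ordprod L * (0 * ordprod R))"
    using wcong_sym[OF phi_power_commute[of x k]]
    by (intro wcong_mult_left wcong_mult_right) (simp add: wcong_def)
  ultimately show ?thesis by simp
qed

lemma time_ord_eom: "wcong hb (time_ord (eom x g)) 0"
proof -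
  have "g \<in> supp UNIV" by simp
  then show ?thesis
  proof (induction rule: supp_induct)
    case (add f g)
    then show ?case using wcong_add by (fastforce simp: eom_lin time_ord_lin)
  next
    case (scale r f)
    then show ?case using wcong_scale by (fastforce simp: eom_lin time_ord_lin)
  next
    case (single k)
    then show ?case by (cases k) (simp add: time_ord_eom_single)
  qed (simp add: eom_lin time_ord_lin)
qed

end

section \<open>The inverse of time ordering\<close>

fun letters :: "word \<Rightarrow> weyl_gen list" where
  "letters (Word l) = l"

lemma letters_plus [simp]: "letters (v + w) = letters v @ letters w"
  by (cases v; cases w) simp

lemma letters_zero [simp]: "letters 0 = []"
  by (simp add: zero_word_def)

context lattice_field
begin

section \<open>The action of the Weyl algebra on polynomials\<close>

definition next_mult :: "int \<Rightarrow> 'r symalg \<Rightarrow> 'r symalg" where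
  "next_mult b f = pos_mult (b + 1) f + scale hb (even_deriv b f)"

lemma is_lin_next_mult [intro]: "is_lin (next_mult b)"
  unfolding next_mult_def[abs_def]
  by (intro is_lin_add is_lin_scale is_lin_pos_mult is_lin_even_deriv)

lemmas next_mult_lin = is_linD[OF is_lin_next_mult]

lemma next_mult_pos_mult: "next_mult b (pos_mult b f) = pos_mult b (next_mult b f) + scale hb f"
  by (simp add: next_mult_def even_deriv_pos_mult pos_mult_lin pos_mult_commute[of b] scale_add_right
      add.assoc)

text \<open>
  On functions of the initial values at \<open>b\<close> and \<open>b + 1\<close> the generators act by left multiplication
  in normal order; \<open>pos_mult b\<close> and \<open>next_mult b\<close> are the actions of \<open>phi b\<close> and \<open>phi (b + 1)\<close>.
\<close>

definition rho_gen :: "int \<Rightarrow> weyl_gen \<Rightarrow> 'r symalg \<Rightarrow> 'r symalg" where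
  "rho_gen b g f = (case g of
     Gen_q \<Rightarrow> scale (odd_sol (b + 1)) (pos_mult b f) - scale (odd_sol b) (next_mult b f)
   | Gen_p \<Rightarrow> scale (even_sol b) (next_mult b f) - scale (even_sol (b + 1)) (pos_mult b f))"

definition rho :: "int \<Rightarrow> 'r free_alg \<Rightarrow> 'r symalg \<Rightarrow> 'r symalg" where
  "rho b w f = lin (\<lambda>k. foldr (rho_gen b) (letters k) f) w"

lemma is_lin_rho_gen: "is_lin (rho_gen b g)"
  by (cases g) (simp_all add: rho_gen_def[abs_def] is_lin_diff is_lin_scale is_lin_pos_mult is_lin_next_mult)

lemma is_lin_foldr_rho: "is_lin (foldr (rho_gen b) l)"
proof (induction l)
  case Nil
  then show ?case by (simp add: id_def is_lin_id)
next
  case (Cons g l)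
  then show ?case using is_lin_comp[OF is_lin_rho_gen] by (simp add: comp_def)
qed

lemma is_lin_rho: "is_lin (rho b w)" "is_lin (\<lambda>w. rho b w f)"
  unfolding rho_def[abs_def] by (auto intro: is_lin_foldr_rho is_lin_lin)

lemmas rho_lin = is_linD[OF is_lin_rho(1)]
lemmas rho_lin_left = is_linD[OF is_lin_rho(2)]

lemma rho_one [simp]: "rho b 1 f = f"
  by (simp add: rho_def flip: single_one)

lemma rho_free_gen [simp]: "rho b (free_gen g) f = rho_gen b g f"
  by (simp add: rho_def free_gen_def)

lemma rho_mult: "rho b (v * w) f = rho b v (rho b w f)"
proof (rule is_lin_ext[where f = v])
  show "is_lin (\<lambda>v. rho b (v * w) f)" "is_lin (\<lambda>v. rho b v (rho b w f))"
    by (rule is_lin_comp[OF is_lin_rho(2) is_lin_mult(1)]) (rule is_lin_rho)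
  fix k
  show "rho b (Poly_Mapping.single k 1 * w) f = rho b (Poly_Mapping.single k 1) (rho b w f)"
  proof (rule is_lin_ext[where f = w])
    show "is_lin (\<lambda>w. rho b (Poly_Mapping.single k 1 * w) f)"
      "is_lin (\<lambda>w. rho b (Poly_Mapping.single k 1) (rho b w f))"
      by (rule is_lin_comp[OF is_lin_rho(2) is_lin_mult(2)]) (rule is_lin_comp[OF is_lin_rho(1,2)])
  qed (simp add: rho_def mult_single)
qed

text \<open>Cramer's rule for the two equations defining \<open>phi b\<close> and
  \<open>phi (b + 1)\<close>: the determinant is the Wronskian, so no division occurs. These are the
  coefficients in \<open>rho_gen\<close>.\<close>

lemma gen_conv_phi:
  "free_gen Gen_q = scale (odd_sol (b + 1)) (phi b) - scale (odd_sol b) (phi (b + 1))"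
  "free_gen Gen_p = scale (even_sol b) (phi (b + 1)) - scale (even_sol (b + 1)) (phi b)"
proof -
  let ?q = "free_gen Gen_q :: 'r free_alg" and ?p = "free_gen Gen_p :: 'r free_alg"
  have "scale (odd_sol (b + 1)) (phi b) - scale (odd_sol b) (phi (b + 1)) =
      scale (even_sol b * odd_sol (b + 1) - even_sol (b + 1) * odd_sol b) ?q"
    unfolding phi_def by (simp add: scale_add_right scale_diff_left mult.commute)
  then show "?q = scale (odd_sol (b + 1)) (phi b) - scale (odd_sol b) (phi (b + 1))"
    by (simp only: wronskian scale_one)
  have "scale (even_sol b) (phi (b + 1)) - scale (even_sol (b + 1)) (phi b) =
      scale (even_sol b * odd_sol (b + 1) - even_sol (b + 1) * odd_sol b) ?p"
    unfolding phi_def by (simp add: scale_add_right scale_diff_left mult.commute)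
  then show "?p = scale (even_sol b) (phi (b + 1)) - scale (even_sol (b + 1)) (phi b)"
    by (simp only: wronskian scale_one)
qed

lemma rho_phi_base: "rho b (phi b) f = pos_mult b f" "rho b (phi (b + 1)) f = next_mult b f"
proof -
  have "rho b (phi b) f = scale (even_sol b * odd_sol (b + 1) - even_sol (b + 1) * odd_sol b) (pos_mult b f)"
    by (simp add: phi_def rho_lin_left rho_gen_def scale_diff_right scale_diff_left mult.commute)
  then show "rho b (phi b) f = pos_mult b f"
    by (simp only: wronskian scale_one)
  have "rho b (phi (b + 1)) f = scale (even_sol b * odd_sol (b + 1) - even_sol (b + 1) * odd_sol b) (next_mult b f)"
    by (simp add: phi_def rho_lin_left rho_gen_def scale_diff_right scale_diff_left mult.commute)
  then show "rho b (phi (b + 1)) f = next_mult b f"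
    by (simp only: wronskian scale_one)
qed

lemma rho_phi_rec: "rho b (phi (x + 1)) f = scale c (rho b (phi x) f) - rho b (phi (x - 1)) f"
  by (simp add: phi_rec rho_lin_left)

text \<open>The commutator of the two generators is the Wronskian times that of
  \<open>next_mult b\<close> and \<open>pos_mult b\<close>. The latter is \<open>hb\<close>, because
  the contraction in \<open>next_mult b\<close> differentiates at \<open>b\<close>.\<close>

lemma rho_weyl_rel: "rho b (weyl_rel hb) f = 0"
proof -
  let ?U = "pos_mult b" and ?V = "next_mult b"
  have "rho b (weyl_rel hb) f =
      scale (even_sol b * odd_sol (b + 1) - even_sol (b + 1) * odd_sol b) (?V (?U f) - ?U (?V f)) - scale hb f"
    by (simp add: rho_lin_left rho_mult rho_gen_def next_mult_lin pos_mult_lin scale_diff_right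
        scale_diff_left mult.commute)
  then show ?thesis
    by (simp only: wronskian scale_one next_mult_pos_mult) simp
qed

lemma rho_weyl_ideal: "w \<in> weyl_ideal hb \<Longrightarrow> rho b w f = 0"
proof -
  have "weyl_ideal hb \<subseteq> {w. \<forall>f. rho b w f = 0}"
  proof (rule weyl_ideal_subset)
    show "weyl_rel hb \<in> {w. \<forall>f. rho b w f = 0}"
      by (simp only: mem_Collect_eq rho_weyl_rel) simp
  qed (simp_all add: rho_lin_left rho_mult rho_lin)
  then show "w \<in> weyl_ideal hb \<Longrightarrow> rho b w f = 0" by auto
qed

lemma rho_wcong: "wcong hb v w \<Longrightarrow> rho b v f = rho b w f"
  using rho_weyl_ideal[of "v - w" b f] by (simp add: wcong_def rho_lin_left)

lemma next_mult_closed: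
  "b + 1 \<in> A \<Longrightarrow> f \<in> supp (even_mons A) \<Longrightarrow> next_mult b f \<in> supp (even_mons A)"
  unfolding next_mult_def by (intro supp_closed pos_mult_closed even_deriv_closed)

lemma rho_closed:
  assumes "b \<in> A" "b + 1 \<in> A" "f \<in> supp (even_mons A)"
  shows "rho b w f \<in> supp (even_mons A)"
proof (induction w rule: free_alg_induct)
  case (gen x w)
  then show ?case
    using assms by (cases x) (auto simp: rho_mult rho_gen_def intro!: supp_closed pos_mult_closed next_mult_closed)
qed (use assms in \<open>auto simp: rho_lin_left\<close>)

text \<open>With \<open>b\<close> leftmost, only factors \<open>phi b\<close> stand before the slot
  of \<open>b + 1\<close>. Pulling \<open>phi (b + 1)\<close> to the front past them produces the
  commutator terms that the contraction in \<open>next_mult b\<close> supplies.\<close>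

lemma time_ord_next_mult:
  assumes "f \<in> supp (even_mons A)" "\<And>y. y \<in> A \<Longrightarrow> b \<le> y"
  shows "wcong hb (time_ord (next_mult b f)) (phi (b + 1) * time_ord f)"
  using assms(1)
proof (induction rule: supp_induct)
  case (single j)
  then obtain m where j: "j = (m, {})" and m: "set_mset m \<subseteq> {b..}"
    using assms(2) by (auto simp: even_mons_def)
  define R k where "R = {#y \<in># m. b < y#}" and "k = count m b"
  have no_L: "{#y \<in># m. y < b#} = {#}"
    by (rule multiset_eqI) (use m in \<open>force simp: count_eq_zero_iff\<close>)
  have mR: "m = replicate_mset k b + R"
    using multiset_split[of m b, unfolded no_L] unfolding R_def k_def by (simp only: add_0)
  have R: "b < y" if "y \<in># R" for y
    using that by (simp add: R_def)
  have "ordprod (replicate_mset k b + ({#b + 1#} + R)) = phi b ^ k * (phi (b + 1) * ordprod R)"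
    using R by (subst ordprod_union, force split: if_splits, subst ordprod_union) force+
  then have 1: "ordprod (add_mset (b + 1) m) = phi b ^ k * (phi (b + 1) * ordprod R)"
    by (simp add: mR)
  have rep: "ordprod (replicate_mset n b + R) = phi b ^ n * ordprod R" for n
    using R by (subst ordprod_union) (force split: if_splits)+
  have 2: "ordprod m = phi b ^ k * ordprod R"
    unfolding mR by (rule rep)
  have 3: "scale (of_nat k) (ordprod (m - {#b#})) = scale (of_nat k) (phi b ^ (k - 1) * ordprod R)"
  proof (cases k)
    case (Suc n)
    then have "m - {#b#} = replicate_mset n b + R" by (simp add: mR)
    then show ?thesis by (simp add: Suc rep)
  qed simp
  have "time_ord (next_mult b (Poly_Mapping.single j 1)) =
      ordprod (add_mset (b + 1) m) + scale hb (scale (of_nat k) (ordprod (m - {#b#})))"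
    by (simp add: next_mult_def time_ord_lin j k_def)
  also have "\<dots> = (phi b ^ k * phi (b + 1) + scale (of_nat k * hb) (phi b ^ (k - 1))) * ordprod R"
    unfolding 1 3 by (simp add: distrib_right scale_mult_left mult.commute mult.assoc)
  also have "wcong hb \<dots> (phi (b + 1) * phi b ^ k * ordprod R)"
    by (intro wcong_mult_right wcong_sym[OF phi_power_commute])
  finally show ?case
    by (simp add: j 2 mult.assoc)
qed (auto simp: next_mult_lin time_ord_lin distrib_left scale_mult_right intro: wcong_add wcong_scale)

text \<open>Time ordering intertwines the action with left multiplication. For
  \<open>f = sym_one\<close> this makes \<open>rho b w sym_one\<close> a preimage of
  \<open>w\<close>, using only the sites \<open>b\<close> and \<open>b + 1\<close>.\<close>

lemma time_ord_rho:
  assumes "b \<in> A" "b + 1 \<in> A" "\<And>y. y \<in> A \<Longrightarrow> b \<le> y" "f \<in> supp (even_mons A)"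
  shows "wcong hb (time_ord (rho b w f)) (w * time_ord f)"
proof (induction w rule: free_alg_induct)
  case (gen x w)
  let ?g = "rho b w f"
  have g: "?g \<in> supp (even_mons A)"
    using assms by (intro rho_closed)
  have "wcong hb (time_ord (rho_gen b x ?g)) (free_gen x * time_ord ?g)"
  proof (cases x)
    case Gen_q
    show ?thesis
      unfolding Gen_q rho_gen_def
      by (subst gen_conv_phi(1)[of b])
        (auto simp: time_ord_lin left_diff_distrib scale_mult_left time_ord_pos_mult[OF g assms(3)]
          intro!: wcong_diff wcong_scale time_ord_next_mult[OF g assms(3)])
  next
    case Gen_p
    show ?thesis
      unfolding Gen_p rho_gen_def
      by (subst gen_conv_phi(2)[of b])
        (auto simp: time_ord_lin left_diff_distrib scale_mult_left time_ord_pos_mult[OF g assms(3)]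
          intro!: wcong_diff wcong_scale time_ord_next_mult[OF g assms(3)])
  qed
  also have "wcong hb (free_gen x * time_ord ?g) (free_gen x * (w * time_ord f))"
    by (rule wcong_mult_left[OF gen.IH])
  finally show ?case
    by (simp add: rho_mult mult.assoc)
qed (auto simp: rho_lin_left time_ord_lin distrib_right scale_mult_left intro: wcong_add wcong_scale)

subsection \<open>Observables vanishing by the equations of motion\<close>

text \<open>The degree-zero coboundaries, with \<open>A\<close> the sites and \<open>N\<close> the
  inner sites of an interval (\<open>coboundaries_0\<close>): one coefficient for each equation of
  motion.\<close>

definition bdry :: "int set \<Rightarrow> int set \<Rightarrow> 'r symalg set" where
  "bdry A N = {\<Sum>x\<in>N. eom x (g x) | g. \<forall>x\<in>N. g x \<in> supp (even_mons A)}"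

lemma bdryI: "(\<And>x. x \<in> N \<Longrightarrow> g x \<in> supp (even_mons A)) \<Longrightarrow> (\<Sum>x\<in>N. eom x (g x)) \<in> bdry A N"
  by (auto simp: bdry_def)

lemma bdry_zero: "0 \<in> bdry A N"
  using bdryI[of N "\<lambda>_. 0" A] by (simp add: eom_lin supp_closed)

lemma bdry_add:
  assumes "f \<in> bdry A N" "g \<in> bdry A N"
  shows "f + g \<in> bdry A N"
proof -
  obtain u v where "f = (\<Sum>x\<in>N. eom x (u x))" "g = (\<Sum>x\<in>N. eom x (v x))"
    and "\<forall>x\<in>N. u x \<in> supp (even_mons A)" "\<forall>x\<in>N. v x \<in> supp (even_mons A)"
    using assms by (auto simp: bdry_def)
  then show ?thesis
    using bdryI[of N "\<lambda>x. u x + v x" A] by (simp add: eom_lin sum.distrib supp_closed)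
qed

lemma bdry_scale:
  assumes "f \<in> bdry A N"
  shows "scale r f \<in> bdry A N"
proof -
  obtain u where "f = (\<Sum>x\<in>N. eom x (u x))" "\<forall>x\<in>N. u x \<in> supp (even_mons A)"
    using assms by (auto simp: bdry_def)
  then show ?thesis
    using bdryI[of N "\<lambda>x. scale r (u x)" A] by (simp add: eom_lin scale_sum supp_closed)
qed

lemma bdry_minus: "f \<in> bdry A N \<Longrightarrow> - f \<in> bdry A N"
  using bdry_scale[of f A N "-1"] by simp

lemma bdry_diff: "f \<in> bdry A N \<Longrightarrow> g \<in> bdry A N \<Longrightarrow> f - g \<in> bdry A N"
  using bdry_add[OF _ bdry_minus] by fastforce

lemma eom_in_bdry:
  assumes "finite N" "x \<in> N" "g \<in> supp (even_mons A)"
  shows "eom x g \<in> bdry A N"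
proof -
  have "(\<Sum>y\<in>N. eom y (if y = x then g else 0)) = (\<Sum>y\<in>N. if y = x then eom x g else 0)"
    by (rule sum.cong) (auto simp: eom_lin)
  also have "\<dots> = eom x g"
    using assms by simp
  finally show ?thesis
    using bdryI[of N "\<lambda>y. if y = x then g else 0" A] assms by (simp add: supp_closed)
qed

lemma bdry_image:
  assumes "is_lin L" "\<And>g. g \<in> supp (even_mons A) \<Longrightarrow> L g \<in> supp (even_mons A)"
    and "\<And>x g. x \<in> N \<Longrightarrow> L (eom x g) = eom x (L g)" and "f \<in> bdry A N"
  shows "L f \<in> bdry A N"
proof -
  obtain u where "f = (\<Sum>x\<in>N. eom x (u x))" "\<forall>x\<in>N. u x \<in> supp (even_mons A)"
    using assms by (auto simp: bdry_def)
  then show ?thesis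
    using bdryI[of N "\<lambda>x. L (u x)" A] assms by (simp add: is_linD[OF assms(1)])
qed

lemma time_ord_bdry: "f \<in> bdry A N \<Longrightarrow> wcong hb (time_ord f) 0"
  using wcong_sum[of N hb "\<lambda>x. time_ord (eom x (_ x))" "\<lambda>_. 0"] time_ord_eom
  by (fastforce simp: bdry_def time_ord_lin)

lemma pos_mult_eom: "y \<noteq> x \<Longrightarrow> pos_mult y (eom x g) = eom x (pos_mult y g)"
  by (simp add: eom_def pos_mult_lin even_deriv_pos_mult pos_mult_commute[of y])

text \<open>Two anomalies at \<open>x = b + 1\<close> cancel: the derivative at \<open>b\<close>
  hits the neighbour \<open>x - 1\<close> inside the equation of motion, and the contraction inside
  the equation of motion hits the factor at \<open>b + 1\<close>.\<close>

lemma next_mult_eom: "b < x \<Longrightarrow> next_mult b (eom x g) = eom x (next_mult b g)"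
proof -
  assume "b < x"
  have D: "even_deriv b (eom x g) = eom x (even_deriv b g) + (if x = b + 1 then g else 0)"
    using \<open>b < x\<close> by (auto simp: eom_def even_deriv_lin even_deriv_pos_mult even_deriv_commute[of b])
  have M: "pos_mult (b + 1) (eom x g) =
      eom x (pos_mult (b + 1) g) - (if x = b + 1 then scale hb g else 0)"
    by (simp add: eom_def pos_mult_lin even_deriv_pos_mult pos_mult_commute[of "b + 1"] scale_add_right)
  show ?thesis
    unfolding next_mult_def D M by (simp add: eom_lin scale_add_right)
qed

text \<open>All equations of motion in \<open>N\<close> lie strictly to the right of
  \<open>b\<close>, so both generating operators commute with them.\<close>

lemma rho_bdry:
  assumes "b \<in> A" "b + 1 \<in> A" "\<And>x. x \<in> N \<Longrightarrow> b < x" "f \<in> bdry A N"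
  shows "rho b w f \<in> bdry A N"
proof (induction w rule: free_alg_induct)
  case (gen x w)
  have U: "pos_mult b g \<in> bdry A N" if "g \<in> bdry A N" for g
    using that assms by (intro bdry_image[OF is_lin_pos_mult]) (auto intro: pos_mult_closed pos_mult_eom)
  have V: "next_mult b g \<in> bdry A N" if "g \<in> bdry A N" for g
    using that assms by (intro bdry_image[OF is_lin_next_mult]) (auto intro: next_mult_closed next_mult_eom)
  show ?case
    using gen U V by (cases x) (auto simp: rho_mult rho_gen_def intro!: bdry_diff bdry_scale)
qed (use assms in \<open>auto simp: rho_lin_left intro: bdry_add bdry_scale\<close>)

section \<open>The retarded propagator and the kernel of time ordering\<close>

text \<open>Modulo the equations of motion, \<open>phi y\<close> acts as multiplication by \<open>\<delta>\<^sub>y\<close> plus \<open>hb\<close> times this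
  contraction with the sites before \<open>y\<close>.\<close>

definition prop_corr :: "int \<Rightarrow> int \<Rightarrow> 'r symalg \<Rightarrow> 'r symalg" where
  "prop_corr b y g = (\<Sum>z\<in>{b..<y}. scale (odd_sol (y - z)) (even_deriv z g))"

text \<open>\<open>odd_sol (y - z)\<close> for \<open>z < y\<close> is the retarded Green function
  of the recursion. The source term comes from the new site \<open>z = y\<close>, where its value is
  \<open>odd_sol 1 = 1\<close>.\<close>

lemma prop_corr_rec:
  assumes "b < y"
  shows "prop_corr b (y + 1) g = scale c (prop_corr b y g) - prop_corr b (y - 1) g + even_deriv y g"
proof -
  have 1: "{b..<y + 1} = insert y {b..<y}" and 2: "{b..<y} = insert (y - 1) {b..<y - 1}"
    using assms by auto
  have rec: "odd_sol (y + 1 - z) = c * odd_sol (y - z) - odd_sol (y - 1 - z)" for z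
    using odd_sol_rec[of "y - z"] by (simp add: algebra_simps)
  have "prop_corr b (y + 1) g = even_deriv y g + (\<Sum>z\<in>{b..<y}. scale (odd_sol (y + 1 - z)) (even_deriv z g))"
    unfolding prop_corr_def 1 by simp
  also have "(\<Sum>z\<in>{b..<y}. scale (odd_sol (y + 1 - z)) (even_deriv z g)) =
      scale c (prop_corr b y g) - (\<Sum>z\<in>{b..<y}. scale (odd_sol (y - 1 - z)) (even_deriv z g))"
    unfolding prop_corr_def by (simp only: rec scale_diff_left sum_subtractf scale_sum scale_scale)
  \<comment> \<open>The surplus term \<open>z = y - 1\<close> has coefficient
    \<open>odd_sol 0 = 0\<close>.\<close>
  also have "(\<Sum>z\<in>{b..<y}. scale (odd_sol (y - 1 - z)) (even_deriv z g)) = prop_corr b (y - 1) g"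
    unfolding prop_corr_def 2 by simp
  finally show ?thesis by simp
qed

text \<open>The error vanishes at the two initial sites and then obeys the recursion up to one
  equation of motion. Reaching \<open>y + 1\<close> uses the equation at \<open>y\<close>, which is
  an inner site since \<open>y + 1 \<le> t\<close>.\<close>

lemma rho_phi_bdry:
  assumes "g \<in> supp (even_mons {b..t})" "b + int n \<le> t"
  shows "rho b (phi (b + int n)) g
      - (pos_mult (b + int n) g + scale hb (prop_corr b (b + int n) g)) \<in> bdry {b..t} {b<..<t}"
  using assms(2)
proof (induction n rule: induct_nat_012)
  case 0
  then show ?case by (simp add: rho_phi_base prop_corr_def bdry_zero)
next
  case 1
  have "{b..<b + 1} = {b}" by auto
  then show ?case
    by (simp add: rho_phi_base next_mult_def prop_corr_def bdry_zero)
next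
  case (ge2 n)
  define y where "y = b + int n + 1"
  define E where "E = (\<lambda>y. rho b (phi y) g - (pos_mult y g + scale hb (prop_corr b y g)))"
  have "E (y - 1) \<in> bdry {b..t} {b<..<t}" "E y \<in> bdry {b..t} {b<..<t}"
    using ge2 by (simp_all add: E_def y_def add_ac)
  moreover have "eom y g \<in> bdry {b..t} {b<..<t}"
    using assms(1) ge2(3) by (intro eom_in_bdry) (auto simp: y_def)
  moreover have "E (y + 1) = scale c (E y) - E (y - 1) - eom y g"
    unfolding E_def eom_def rho_phi_rec
    by (subst prop_corr_rec)
      (simp_all add: y_def scale_add_right scale_diff_right mult.commute)
  ultimately have "E (y + 1) \<in> bdry {b..t} {b<..<t}"
    by (simp add: bdry_diff bdry_scale)
  then show ?case
    by (simp add: E_def y_def add_ac)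
qed

text \<open>The sorted monomial is built from its last letter backwards. Prepending \<open>y\<close>
  acts as multiplication by the generator at \<open>y\<close> modulo the equations of motion, and
  \<open>rho_bdry\<close> carries along the error made so far.\<close>

lemma rho_time_ord:
  assumes "b < t" "f \<in> supp (even_mons {b..t})"
  shows "rho b (time_ord f) sym_one - f \<in> bdry {b..t} {b<..<t}"
  using assms(2)
proof (induction rule: supp_induct)
  case zero
  then show ?case by (simp add: time_ord_lin rho_lin_left bdry_zero)
next
  case (add f g)
  then show ?case
    using bdry_add by (fastforce simp: time_ord_lin rho_lin_left algebra_simps)
next
  case (scale r f)
  then show ?case
    using bdry_scale by (fastforce simp: time_ord_lin rho_lin_left simp flip: scale_diff_right)
next
  case (single k)
  then obtain m where m: "k = (m, {})" "set_mset m \<subseteq> {b..t}" by (auto simp: even_mons_def)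
  have "rho b (prod_list (map phi l)) sym_one - Poly_Mapping.single (mset l, {}) 1 \<in> bdry {b..t} {b<..<t}"
    if "sorted l" "set l \<subseteq> {b..t}" for l
    using that
  proof (induction l)
    case Nil
    then show ?case by (simp add: sym_one_def bdry_zero)
  next
    case (Cons y l)
    let ?l = "Poly_Mapping.single (mset l, {}) (1::'r)"
    obtain n where y: "y = b + int n"
      using Cons.prems by (metis atLeastAtMost_iff list.set_intros(1) subsetD zle_iff_zadd)
    have supp: "?l \<in> supp (even_mons {b..t})"
      using Cons.prems by (intro single_in_even_mons) auto
    \<comment> \<open>Every letter of \<open>l\<close> is at least \<open>y\<close>, so contraction
      with earlier sites finds nothing.\<close>
    have "prop_corr b y ?l = 0"
      unfolding prop_corr_def
    proof (rule sum.neutral, intro ballI)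
      fix z assume "z \<in> {b..<y}"
      then have "z \<notin> set l" using Cons.prems by auto
      then have "count (mset l) z = 0" by (simp add: count_eq_zero_iff)
      then have "even_deriv z ?l = 0" by (simp only: even_deriv_single) simp
      then show "scale (odd_sol (y - z)) (even_deriv z ?l) = 0" by (simp only: scale_zero_right)
    qed
    then have "rho b (phi y) ?l - pos_mult y ?l \<in> bdry {b..t} {b<..<t}"
      using rho_phi_bdry[OF supp, of n] Cons.prems y by simp
    moreover have "rho b (phi y) (rho b (prod_list (map phi l)) sym_one - ?l) \<in> bdry {b..t} {b<..<t}"
      using Cons assms(1) by (intro rho_bdry) auto
    ultimately have "rho b (phi y) (rho b (prod_list (map phi l)) sym_one) - pos_mult y ?l
        \<in> bdry {b..t} {b<..<t}"
      using bdry_add by (fastforce simp: rho_lin)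
    then show ?case by (simp add: rho_mult)
  qed
  from this[of "sorted_list_of_multiset m"] show ?case
    using m by (simp add: ordprod_def)
qed

text \<open>If the time-ordered product lies in the Weyl ideal, \<open>rho\<close> sends it to zero,
  and \<open>rho_time_ord\<close> then leaves \<open>f\<close> itself as a coboundary.\<close>

theorem time_ord_kernel:
  assumes "b < t" "f \<in> supp (even_mons {b..t})"
  shows "wcong hb (time_ord f) 0 \<longleftrightarrow> f \<in> bdry {b..t} {b<..<t}"
proof
  assume "wcong hb (time_ord f) 0"
  then have "rho b (time_ord f) sym_one = 0"
    using rho_wcong by (fastforce simp: rho_lin_left)
  then show "f \<in> bdry {b..t} {b<..<t}"
    using bdry_minus[OF rho_time_ord[OF assms]] by simp
qed (rule time_ord_bdry)

end

section \<open>Time reversal on the symmetric algebra\<close>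

definition mono_mult :: "int multiset \<times> int set \<Rightarrow> int multiset \<times> int set \<Rightarrow> 'r::comm_ring_1 symalg" where
  "mono_mult k l = (if snd k \<inter> snd l = {}
     then Poly_Mapping.single (fst k + fst l, snd k \<union> snd l) (koszul_sign (snd k) (snd l)) else 0)"

lemma sym_mult_conv_lin: "sym_mult f g = lin (\<lambda>k. lin (mono_mult k) g) f"
  unfolding sym_mult_def lin_def mono_mult_def
  by (auto simp: scale_sum scale_single intro!: sum.cong) (simp add: ac_simps)

lemma is_lin_sym_mult: "is_lin (\<lambda>f. sym_mult f g)" "is_lin (\<lambda>g. sym_mult f g)"
  unfolding sym_mult_conv_lin by (rule is_lin_lin) (rule is_lin_lin_param, rule is_lin_lin)

lemmas sym_mult_lin_left = is_linD[OF is_lin_sym_mult(1)]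

lemma sym_mult_single: "sym_mult (Poly_Mapping.single (m, S) r) (Poly_Mapping.single (m', S') s) =
    (if S \<inter> S' = {} then Poly_Mapping.single (m + m', S \<union> S') (koszul_sign S S' * r * s) else 0)"
  by (simp add: sym_mult_conv_lin mono_mult_def ac_simps)

lemma koszul_sign_empty [simp]: "koszul_sign {} S = 1" "koszul_sign S {} = 1"
  by (simp_all add: koszul_sign_def)

lemma sym_mult_one_right [simp]: "sym_mult f sym_one = f"
proof (rule is_lin_ext[where f = f])
  fix k
  show "sym_mult (Poly_Mapping.single k 1) sym_one = Poly_Mapping.single k 1"
    by (cases k) (simp add: sym_one_def sym_mult_single)
qed (rule is_lin_sym_mult is_lin_id)+

lemma sym_mult_pos: "sym_mult (Poly_Mapping.single ({#y#}, {}) 1) g = pos_mult y g"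
proof (rule is_lin_ext[where f = g])
  fix k
  show "sym_mult (Poly_Mapping.single ({#y#}, {}) 1) (Poly_Mapping.single k 1) = pos_mult y (Poly_Mapping.single k 1)"
    by (cases k) (simp add: sym_mult_single)
qed (rule is_lin_sym_mult is_lin_pos_mult)+

lemma odd_deriv_conv_lin:
  "odd_deriv x f = lin (\<lambda>(m, S). if x \<in> S
     then Poly_Mapping.single (m, S - {x}) ((- 1) ^ card {y \<in> S. y < x}) else 0) f"
  unfolding odd_deriv_def lin_def
  by (rule sum.cong) (auto simp: scale_single mult.commute)

lemma is_lin_odd_deriv: "is_lin (odd_deriv x)"
  unfolding odd_deriv_conv_lin[abs_def] by (rule is_lin_lin)

lemmas odd_deriv_lin = is_linD[OF is_lin_odd_deriv]

lemma odd_deriv_single: "odd_deriv x (Poly_Mapping.single (m, S) r) =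
    (if x \<in> S then Poly_Mapping.single (m, S - {x}) ((- 1) ^ card {y \<in> S. y < x} * r) else 0)"
  by (simp add: odd_deriv_conv_lin mult.commute)

lemma odd_even_deriv_commute: "odd_deriv x (even_deriv y f) = even_deriv y (odd_deriv x f)"
proof (rule is_lin_ext[where f = f])
  fix k :: "int multiset \<times> int set"
  show "odd_deriv x (even_deriv y (Poly_Mapping.single k 1)) = even_deriv y (odd_deriv x (Poly_Mapping.single k (1::'a)))"
    by (cases k) (simp add: odd_deriv_single even_deriv_lin ac_simps)
qed (intro is_lin_comp[OF is_lin_odd_deriv] is_lin_comp[OF is_lin_even_deriv] is_lin_odd_deriv is_lin_even_deriv)+

text \<open>The sign of the permutation that reverses \<open>k\<close> odd factors.\<close>

definition rev_sign :: "nat \<Rightarrow> 'r::comm_ring_1" where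
  "rev_sign k = (- 1) ^ (k choose 2)"

lemma rev_sign_0 [simp]: "rev_sign 0 = 1"
  by (simp add: rev_sign_def numeral_2_eq_2)

lemma rev_sign_Suc: "rev_sign (Suc k) = (- 1) ^ k * rev_sign k"
  by (simp add: rev_sign_def numeral_2_eq_2 power_add)

lemma rev_sign_square [simp]: "rev_sign k * rev_sign k = 1"
  by (simp add: rev_sign_def flip: power_add mult_2)

lemma rev_sign_add: "rev_sign (j + k) = (- 1) ^ (j * k) * (rev_sign j * rev_sign k)"
  by (induction j) (simp_all add: rev_sign_Suc power_add ac_simps)

text \<open>Closed form of reversal on monomials, independent of the interval;
  \<open>time_reversal_eq\<close> compares it with the given maps. Negation puts the odd factors in
  decreasing order, and the sign restores the increasing one.\<close>

definition time_rev :: "'r::comm_ring_1 symalg \<Rightarrow> 'r symalg" where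
  "time_rev = lin (\<lambda>(m, S). Poly_Mapping.single (image_mset uminus m, uminus ` S) (rev_sign (card S)))"

lemma is_lin_time_rev: "is_lin time_rev"
  by (simp add: time_rev_def)

lemmas time_rev_lin = is_linD[OF is_lin_time_rev]

lemma time_rev_single: "time_rev (Poly_Mapping.single (m, S) r) =
    Poly_Mapping.single (image_mset uminus m, uminus ` S) (rev_sign (card S) * r)"
  by (simp add: time_rev_def mult.commute)

lemma card_uminus [simp]: "card (uminus ` S) = card (S :: int set)"
  by (rule card_image) simp

lemma time_rev_time_rev [simp]: "time_rev (time_rev f) = f"
proof (rule is_lin_ext[where f = f])
  fix k
  show "time_rev (time_rev (Poly_Mapping.single k 1)) = Poly_Mapping.single k 1"
    by (cases k) (simp add: time_rev_single image_mset.compositionality image_image comp_def)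
qed (intro is_lin_comp[OF is_lin_time_rev] is_lin_time_rev is_lin_id)+

lemma time_rev_pos_mult: "time_rev (pos_mult y f) = pos_mult (- y) (time_rev f)"
proof (rule is_lin_ext[where f = f])
  fix k
  show "time_rev (pos_mult y (Poly_Mapping.single k 1)) = pos_mult (- y) (time_rev (Poly_Mapping.single k 1))"
    by (cases k) (simp add: time_rev_single)
qed (intro is_lin_comp[OF is_lin_time_rev] is_lin_comp[OF is_lin_pos_mult] is_lin_time_rev is_lin_pos_mult)+

lemma count_image_uminus: "count (image_mset uminus m) (- x) = count m (x :: int)"
  by (induction m) auto

lemma time_rev_even_deriv: "time_rev (even_deriv y f) = even_deriv (- y) (time_rev f)"
proof (rule is_lin_ext[where f = f])
  fix k :: "int multiset \<times> int set"
  obtain m S where k: "k = (m, S)" by (cases k)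
  have "image_mset uminus (m - {#y#}) = image_mset uminus m - {#- y#}"
    using image_mset_Diff[of "{#y#}" m uminus] image_mset_diff_if_inj[of uminus m "{#y#}"] by simp
  then show "time_rev (even_deriv y (Poly_Mapping.single k 1)) = even_deriv (- y) (time_rev (Poly_Mapping.single k (1::'a)))"
    by (simp add: k time_rev_single count_image_uminus mult.commute)
qed (intro is_lin_comp[OF is_lin_time_rev] is_lin_comp[OF is_lin_even_deriv] is_lin_time_rev is_lin_even_deriv)+

lemma neg_one_power_mult_self: "(- 1) ^ n * (- 1) ^ n = (1 :: 'r::comm_ring_1)"
  by (simp flip: power_add mult_2)

lemma neg_one_power_complement:
  assumes "i + j = n"
  shows "(- 1) ^ i = (- 1) ^ n * (- 1 :: 'r::comm_ring_1) ^ j"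
  by (simp add: assms[symmetric] power_add mult.assoc neg_one_power_mult_self)

text \<open>Keys may have an infinite odd part, for which \<open>card\<close> is zero and the signs
  lose their meaning.\<close>

abbreviation finite_mons :: "(int multiset \<times> int set) set" where
  "finite_mons \<equiv> {(m, S). finite S}"

text \<open>The left derivative counts the odd factors before \<open>x\<close>; after negation it
  counts those after \<open>x\<close>. The two counts add up to \<open>card S - 1\<close>, and
  \<open>rev_sign\<close> changes by that same parity when one factor is removed.\<close>

lemma time_rev_odd_deriv:
  assumes "f \<in> supp finite_mons"
  shows "time_rev (odd_deriv x f) = odd_deriv (- x) (time_rev f)"
  using assms
proof (rule is_lin_eq_on)
  fix k :: "int multiset \<times> int set"
  assume "k \<in> finite_mons"
  then obtain m S where k: "k = (m, S)" and fin: "finite S" by auto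
  show "time_rev (odd_deriv x (Poly_Mapping.single k 1)) = odd_deriv (- x) (time_rev (Poly_Mapping.single k (1::'a)))"
  proof (cases "x \<in> S")
    case True
    let ?l = "card {y \<in> S. y < x}" and ?g = "card {y \<in> S. x < y}"
    have "S - {x} = {y \<in> S. y < x} \<union> {y \<in> S. x < y}" by auto
    then have "card (S - {x}) = ?l + ?g"
      using fin by (simp add: card_Un_disjoint disjoint_iff)
    then have sign: "(- 1 :: 'a) ^ ?g = (- 1) ^ card (S - {x}) * (- 1) ^ ?l"
      by (intro neg_one_power_complement) simp
    have "card S = Suc (card (S - {x}))"
      by (rule card.remove[OF fin True])
    then have rs: "rev_sign (card S) = (- 1 :: 'a) ^ card (S - {x}) * rev_sign (card (S - {x}))"
      by (metis rev_sign_Suc)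
    have "{y \<in> uminus ` S. y < - x} = uminus ` {y \<in> S. x < y}" by auto
    then have g: "card {y \<in> uminus ` S. y < - x} = ?g" by simp
    have "uminus ` (S - {x}) = uminus ` S - {- x}" by auto
    moreover have "(- 1 :: 'a) ^ ?g * rev_sign (card S) = rev_sign (card (S - {x})) * (- 1) ^ ?l"
    proof -
      have swap: "(e * l) * (e * r) = (e * e) * (r * l)" for e l r :: 'a
        by (simp add: ac_simps)
      show ?thesis
        unfolding sign rs swap neg_one_power_mult_self by simp
    qed
    ultimately show ?thesis
      using True by (simp add: k odd_deriv_single time_rev_single g)
  next
    case False
    then show ?thesis by (auto simp: k odd_deriv_single time_rev_single time_rev_lin)
  qed
qed (intro is_lin_comp[OF is_lin_time_rev] is_lin_comp[OF is_lin_odd_deriv] is_lin_time_rev is_lin_odd_deriv)+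

text \<open>Negation exchanges the inverted with the non-inverted pairs, and for disjoint sets these
  exhaust \<open>S \<times> T\<close>.\<close>

lemma koszul_sign_uminus:
  assumes "finite S" "finite T" "S \<inter> T = {}"
  shows "koszul_sign (uminus ` S) (uminus ` T) = (- 1) ^ (card S * card T) * (koszul_sign S T :: 'r::comm_ring_1)"
proof -
  let ?L = "{(s, t). s \<in> S \<and> t \<in> T \<and> t < s}" and ?G = "{(s, t). s \<in> S \<and> t \<in> T \<and> s < t}"
  have ST: "S \<times> T = ?L \<union> ?G"
    using assms(3) by (auto simp: disjoint_iff) (metis linorder_neqE_linordered_idom)
  have fin: "finite (S \<times> T)"
    using assms by simp
  have finL: "finite ?L"
    by (rule finite_subset[OF _ fin]) auto
  have finG: "finite ?G"
    by (rule finite_subset[OF _ fin]) auto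
  have "card (?L \<union> ?G) = card ?L + card ?G"
    by (rule card_Un_disjoint[OF finL finG]) auto
  then have "card (S \<times> T) = card ?L + card ?G"
    by (simp only: ST)
  then have "(- 1) ^ card ?G = (- 1) ^ (card S * card T) * (- 1 :: 'r) ^ card ?L"
    by (intro neg_one_power_complement) (simp add: card_cartesian_product)
  moreover have "{(s, t). s \<in> uminus ` S \<and> t \<in> uminus ` T \<and> t < s} = (\<lambda>(s, t). (- s, - t)) ` ?G"
  proof (intro equalityI subsetI)
    fix p assume "p \<in> {(s, t). s \<in> uminus ` S \<and> t \<in> uminus ` T \<and> t < s}"
    then obtain s t where "p = (- s, - t)" "s \<in> S" "t \<in> T" "s < t" by auto
    then show "p \<in> (\<lambda>(s, t). (- s, - t)) ` ?G"
      by (intro image_eqI[of _ _ "(s, t)"]) auto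
  qed auto
  then have "card {(s, t). s \<in> uminus ` S \<and> t \<in> uminus ` T \<and> t < s} = card ?G"
    by (simp only:) (rule card_image, auto simp: inj_on_def)
  ultimately show ?thesis
    by (simp add: koszul_sign_def)
qed

text \<open>The change of the Koszul sign is exactly the failure of \<open>rev_sign\<close> to be
  multiplicative (\<open>rev_sign_add\<close>). Reversal is thus a homomorphism of the graded
  commutative product.\<close>

lemma time_rev_sym_mult:
  assumes "f \<in> supp finite_mons" "g \<in> supp finite_mons"
  shows "time_rev (sym_mult f g) = sym_mult (time_rev f) (time_rev g)"
  using assms(1)
proof (rule is_lin_eq_on)
  fix k :: "int multiset \<times> int set"
  assume "k \<in> finite_mons"
  then obtain m S where k: "k = (m, S)" and S: "finite S" by auto
  show "time_rev (sym_mult (Poly_Mapping.single k 1) g) = sym_mult (time_rev (Poly_Mapping.single k 1)) (time_rev g)"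
    using assms(2)
  proof (rule is_lin_eq_on)
    fix l :: "int multiset \<times> int set"
    assume "l \<in> finite_mons"
    then obtain n T where l: "l = (n, T)" and T: "finite T" by auto
    have disj: "uminus ` S \<inter> uminus ` T = {} \<longleftrightarrow> S \<inter> T = {}" by (auto simp: disjoint_iff)
    have "koszul_sign (uminus ` S) (uminus ` T) * rev_sign (card S) * rev_sign (card T) =
        rev_sign (card (S \<union> T)) * (koszul_sign S T :: 'a)" if "S \<inter> T = {}"
      using that S T by (simp add: koszul_sign_uminus card_Un_disjoint rev_sign_add ac_simps)
    then show "time_rev (sym_mult (Poly_Mapping.single k 1) (Poly_Mapping.single l 1)) =
        sym_mult (time_rev (Poly_Mapping.single k (1::'a))) (time_rev (Poly_Mapping.single l 1))"
      by (simp add: k l sym_mult_single time_rev_single disj image_Un time_rev_lin)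
  qed (intro is_lin_comp[OF is_lin_time_rev] is_lin_comp[OF is_lin_sym_mult(2)] is_lin_time_rev is_lin_sym_mult)+
qed (intro is_lin_comp[OF is_lin_time_rev] is_lin_comp[OF is_lin_sym_mult(1)] is_lin_time_rev is_lin_sym_mult)+

lemma sym_prod_simps [simp]: "sym_prod [] = sym_one" "sym_prod (f # fs) = sym_mult f (sym_prod fs)"
  by (simp_all add: sym_prod_def)

lemma time_rev_one [simp]: "time_rev sym_one = sym_one"
  by (simp add: sym_one_def time_rev_single)

section \<open>Intervals, sites and the comparison with the given reversal maps\<close>

definition ivl_mons :: "ivl \<Rightarrow> (int multiset \<times> int set) set" where
  "ivl_mons I = {(m, S). set_mset m \<subseteq> sites I \<and> S \<subseteq> inner_sites I}"

lemma finite_sites [simp, intro]: "finite (sites I)"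
proof -
  have "sites I \<subseteq> {\<lfloor>fst I\<rfloor>..\<lceil>snd I\<rceil>}"
    by (auto simp: sites_def) linarith+
  then show ?thesis by (rule finite_subset) simp
qed

lemma inner_sites_iff: "x \<in> inner_sites I \<longleftrightarrow> x - 1 \<in> sites I \<and> x \<in> sites I \<and> x + 1 \<in> sites I"
  by (auto simp: inner_sites_def sites_def)

lemma finite_inner_sites [simp, intro]: "finite (inner_sites I)"
  by (rule finite_subset[OF _ finite_sites[of I]]) (auto simp: inner_sites_iff)

lemma ivl_mons_finite: "f \<in> supp (ivl_mons I) \<Longrightarrow> f \<in> supp finite_mons"
  by (erule supp_mono[rotated]) (auto simp: ivl_mons_def intro: finite_subset)

lemma sites_neg [simp]: "x \<in> sites (neg_ivl I) \<longleftrightarrow> - x \<in> sites I"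
  by (auto simp: sites_def neg_ivl_def)

lemma inner_sites_neg [simp]: "x \<in> inner_sites (neg_ivl I) \<longleftrightarrow> - x \<in> inner_sites I"
  by (auto simp: inner_sites_def neg_ivl_def)

lemma inner_sites_neg_image: "inner_sites (neg_ivl I) = uminus ` inner_sites I"
proof (rule Set.set_eqI)
  fix x
  show "x \<in> inner_sites (neg_ivl I) \<longleftrightarrow> x \<in> uminus ` inner_sites I"
    by (auto intro: image_eqI[of x uminus "- x"])
qed

lemma neg_neg_ivl [simp]: "neg_ivl (neg_ivl I) = I"
  by (simp add: neg_ivl_def)

lemma color_neg [simp]: "color (neg_ivl I) = color I"
  by (auto simp: color_def neg_ivl_def)

lemma sym_comp_conv_supp:
  "sym_comp I n = supp {(m, S). set_mset m \<subseteq> sites I \<and> S \<subseteq> inner_sites I \<and> - int (card S) = n}"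
  unfolding sym_comp_def supp_def by blast

lemma sym_comp_subset: "f \<in> sym_comp I n \<Longrightarrow> f \<in> supp (ivl_mons I)"
  unfolding sym_comp_conv_supp by (erule supp_mono[rotated]) (auto simp: ivl_mons_def)

lemma reflect_delta: "reflect (delta x) = delta (- x)"
  by (auto simp: reflect_def delta_def fun_eq_iff)

lemma even_elem_delta: "x \<in> sites I \<Longrightarrow> even_elem I (delta x) = Poly_Mapping.single ({#x#}, {}) 1"
proof -
  assume x: "x \<in> sites I"
  have "even_elem I (delta x) = (\<Sum>y\<in>sites I. if y = x then Poly_Mapping.single ({#x#}, {}) (1::'a) else 0)"
    unfolding even_elem_def by (rule sum.cong) (auto simp: delta_def)
  then show "even_elem I (delta x) = Poly_Mapping.single ({#x#}, {}) (1::'a)"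
    using x by simp
qed

lemma odd_elem_delta: "x \<in> inner_sites I \<Longrightarrow> odd_elem I (delta x) = Poly_Mapping.single ({#}, {x}) 1"
proof -
  assume x: "x \<in> inner_sites I"
  have "odd_elem I (delta x) = (\<Sum>y\<in>inner_sites I. if y = x then Poly_Mapping.single ({#}, {x}) (1::'a) else 0)"
    unfolding odd_elem_def by (rule sum.cong) (auto simp: delta_def)
  then show "odd_elem I (delta x) = Poly_Mapping.single ({#}, {x}) (1::'a)"
    using x by simp
qed

lemma time_reversal_eq:
  assumes "f \<in> supp (ivl_mons I)"
  shows "time_reversal I f = time_rev f"
proof -
  let ?e = "\<lambda>x. even_elem (neg_ivl I) (reflect (delta x)) :: 'a symalg"
  let ?o = "\<lambda>x. odd_elem (neg_ivl I) (reflect (delta x)) :: 'a symalg"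
  have even: "sym_prod (map ?e l) = Poly_Mapping.single (image_mset uminus (mset l), {}) 1"
    if "set l \<subseteq> sites I" for l
    using that by (induction l) (simp_all add: sym_one_def reflect_delta even_elem_delta sym_mult_single)
  have odd: "sym_prod (map ?o l) = Poly_Mapping.single ({#}, uminus ` set l) (rev_sign (length l))"
    if "set l \<subseteq> inner_sites I" "sorted l" "distinct l" for l
    using that
  proof (induction l)
    case (Cons x l)
    \<comment> \<open>\<open>x\<close> is the least letter, so \<open>- x\<close> exceeds all later
      ones and each pair is an inversion; summing over the list gives
      \<open>rev_sign\<close>.\<close>
    have "{(s, t). s \<in> {- x} \<and> t \<in> uminus ` set l \<and> t < s} = (\<lambda>y. (- x, - y)) ` set l"
      using Cons.prems by (force simp: image_iff order_less_le)
    moreover have "card ((\<lambda>y. (- x, - y)) ` set l) = length l"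
      using Cons.prems by (simp add: card_image inj_on_def distinct_card)
    ultimately have "koszul_sign {- x} (uminus ` set l) = (- 1 :: 'a) ^ length l"
      by (simp add: koszul_sign_def)
    moreover have "{- x} \<inter> uminus ` set l = {}"
      using Cons.prems by auto
    ultimately show ?case
      using Cons by (simp add: reflect_delta odd_elem_delta sym_mult_single rev_sign_Suc)
  qed (simp add: sym_one_def)
  have "time_reversal I f = lin (\<lambda>(m, S). sym_mult (sym_prod (map ?e (sorted_list_of_multiset m)))
      (sym_prod (map ?o (sorted_list_of_set S)))) f"
    by (simp add: time_reversal_def sym_map_def lin_def split_def)
  also have "\<dots> = time_rev f"
    using assms
  proof (rule is_lin_eq_on)
    fix k :: "int multiset \<times> int set"
    assume "k \<in> ivl_mons I"
    then obtain m S where k: "k = (m, S)" "set_mset m \<subseteq> sites I" "S \<subseteq> inner_sites I"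
      by (auto simp: ivl_mons_def)
    then have "finite S" by (auto intro: finite_subset)
    then show "lin (\<lambda>(m, S). sym_mult (sym_prod (map ?e (sorted_list_of_multiset m)))
      (sym_prod (map ?o (sorted_list_of_set S)))) (Poly_Mapping.single k 1) = time_rev (Poly_Mapping.single k 1)"
      using k by (simp add: even odd sym_mult_single time_rev_single)
  qed (rule is_lin_lin is_lin_time_rev)+
  finally show ?thesis .
qed

lemma time_rev_comp:
  assumes "f \<in> sym_comp I n"
  shows "time_rev f \<in> sym_comp (neg_ivl I) n"
  using assms unfolding sym_comp_conv_supp time_rev_def
  by (rule lin_supp) (auto simp: subset_iff intro!: supp_single)

lemma sym_mult_closed:
  assumes "f \<in> supp (ivl_mons I)" "g \<in> supp (ivl_mons I)"
  shows "sym_mult f g \<in> supp (ivl_mons I)"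
  unfolding sym_mult_conv_lin
  by (intro lin_supp[OF assms(1)] lin_supp[OF assms(2)])
    (auto simp: mono_mult_def ivl_mons_def intro!: supp_single supp_closed)

lemma sym_one_closed: "sym_one \<in> supp (ivl_mons I)"
  unfolding sym_one_def by (rule supp_single) (simp add: ivl_mons_def)

lemma sym_prod_closed: "(\<And>f. f \<in> set fs \<Longrightarrow> f \<in> supp (ivl_mons I)) \<Longrightarrow> sym_prod fs \<in> supp (ivl_mons I)"
  by (induction fs) (auto intro: sym_mult_closed sym_one_closed)

lemma time_rev_sym_prod:
  "(\<And>f. f \<in> set fs \<Longrightarrow> f \<in> supp (ivl_mons I)) \<Longrightarrow> time_rev (sym_prod fs) = sym_prod (map time_rev fs)"
proof (induction fs)
  case (Cons f fs)
  have "f \<in> supp (ivl_mons I)" "sym_prod fs \<in> supp (ivl_mons I)"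
    using Cons.prems by (auto intro: sym_prod_closed)
  then have "time_rev (sym_mult f (sym_prod fs)) = sym_mult (time_rev f) (time_rev (sym_prod fs))"
    by (intro time_rev_sym_mult ivl_mons_finite)
  then show ?case
    using Cons by simp
qed simp

text \<open>Containment of open intervals bounds their endpoints because a color is
  nonempty.\<close>

lemma D11_op_sites:
  assumes "D11_op Is J" "I \<in> set Is"
  shows "sites I \<subseteq> sites J" "inner_sites I \<subseteq> inner_sites J"
proof -
  have "color I" "{fst I<..<snd I} \<subseteq> {fst J<..<snd J}"
    using assms by (auto simp: D11_op_def ivl_set_def)
  then have "fst J \<le> fst I" "snd I \<le> snd J"
    by (auto simp: color_def greaterThanLessThan_subseteq_greaterThanLessThan)
  then show "sites I \<subseteq> sites J" "inner_sites I \<subseteq> inner_sites J"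
    by (auto simp: sites_def inner_sites_def)
qed

lemma ivl_mons_mono: "sites I \<subseteq> sites J \<Longrightarrow> inner_sites I \<subseteq> inner_sites J \<Longrightarrow> f \<in> supp (ivl_mons I) \<Longrightarrow> f \<in> supp (ivl_mons J)"
  by (erule supp_mono[rotated]) (auto simp: ivl_mons_def)

context lattice_field
begin

lemma time_rev_eom: "time_rev (eom x f) = eom (- x) (time_rev f)"
proof -
  have "- (x - 1) = - x + 1" "- (x + 1) = - x - 1" by simp_all
  then show ?thesis
    by (simp only: eom_def time_rev_lin time_rev_pos_mult time_rev_even_deriv) (simp add: algebra_simps)
qed

end

text \<open>The three kinds of scalars are treated at once: \<open>quantum_scalars_half\<close>
  derives \<open>emb_half\<close> for each of them.\<close>

locale quantum_field =
  fixes \<alpha> :: "'k::field_char_0" and emb :: "'k \<Rightarrow> 'r::comm_ring_1" and hb :: 'r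
  assumes emb_half: "emb (1 / 2) + emb (1 / 2) = 1"

sublocale quantum_field \<subseteq> lattice_field "emb (\<alpha> + inverse \<alpha>)" "emb (1 / 2)" hb
  by unfold_locales (rule emb_half)

section \<open>The differential and the equivariant structure\<close>

context quantum_field
begin

lemma even_elem_Q_op:
  assumes "x \<in> inner_sites I"
  shows "even_elem I (Q_op emb \<alpha> (delta x)) = Poly_Mapping.single ({#x - 1#}, {}) 1
    - scale (emb (\<alpha> + inverse \<alpha>)) (Poly_Mapping.single ({#x#}, {}) 1) + Poly_Mapping.single ({#x + 1#}, {}) 1"
proof -
  have lin: "even_elem I (\<lambda>y. f y - r * g y + h y) = even_elem I f - scale r (even_elem I g) + even_elem I h" for f g h r
    by (simp add: even_elem_def single_add single_diff sum.distrib sum_subtractf scale_sum scale_single)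
  have "Q_op emb \<alpha> (delta x) = (\<lambda>y. delta (x + 1) y - emb (\<alpha> + inverse \<alpha>) * delta x y + delta (x - 1) y)"
    by (auto simp: Q_op_def delta_def fun_eq_iff)
  then show ?thesis
    using assms by (simp only: lin) (simp add: even_elem_delta inner_sites_iff)
qed

text \<open>Both parts of the differential contain the odd derivative at \<open>x\<close>, which
  commutes with the even one; pulling it out leaves the equation of motion at
  \<open>x\<close>.\<close>

lemma diff_Oq: "diff (obj (Oq emb \<alpha> hb) I) f = (\<Sum>x\<in>inner_sites I. eom x (odd_deriv x f))"
proof -
  have "diff (obj (Oq emb \<alpha> hb) I) f =
      (\<Sum>x\<in>inner_sites I. sym_mult (even_elem I (Q_op emb \<alpha> (delta x))) (odd_deriv x f)
        + scale hb (odd_deriv x (even_deriv x f)))"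
    by (simp add: Oq_def Oq_complex_def d_classical_def BV_laplacian_def scale_sum sum.distrib)
  also have "\<dots> = (\<Sum>x\<in>inner_sites I. eom x (odd_deriv x f))"
    by (rule sum.cong)
      (simp_all only: even_elem_Q_op sym_mult_lin_left sym_mult_pos odd_even_deriv_commute eom_def)
  finally show ?thesis .
qed

lemma component_Oq [simp]: "component (obj (Oq emb \<alpha> hb) I) = sym_comp I"
  and scal_Oq [simp]: "scal (obj (Oq emb \<alpha> hb) I) = scale"
  and act_Oq [simp]: "act (Oq emb \<alpha> hb) Is J fs = sym_prod fs"
  by (simp_all add: Oq_def Oq_complex_def)

lemma eom_closed:
  assumes "x \<in> inner_sites I" "f \<in> supp (ivl_mons I)"
  shows "eom x f \<in> supp (ivl_mons I)"
proof -
  have "pos_mult y f \<in> supp (ivl_mons I)" if "y \<in> sites I" for y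
    using assms(2) that unfolding pos_mult_def
    by (elim lin_supp) (auto simp: ivl_mons_def intro!: supp_single)
  moreover have "even_deriv x f \<in> supp (ivl_mons I)"
    using assms(2) unfolding even_deriv_conv_lin
    by (elim lin_supp) (auto simp: ivl_mons_def intro!: supp_single dest: in_diffD)
  ultimately show ?thesis
    using assms(1) unfolding eom_def by (intro supp_closed) (auto simp: inner_sites_iff)
qed

lemma odd_deriv_closed: "f \<in> supp (ivl_mons I) \<Longrightarrow> odd_deriv x f \<in> supp (ivl_mons I)"
  unfolding odd_deriv_conv_lin by (erule lin_supp) (auto simp: ivl_mons_def intro!: supp_single supp_closed)

lemma diff_closed: "f \<in> supp (ivl_mons I) \<Longrightarrow> diff (obj (Oq emb \<alpha> hb) I) f \<in> supp (ivl_mons I)"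
  unfolding diff_Oq by (intro supp_sum eom_closed odd_deriv_closed)

lemma time_rev_diff:
  assumes "f \<in> supp (ivl_mons I)"
  shows "time_rev (diff (obj (Oq emb \<alpha> hb) I) f) = diff (obj (Oq emb \<alpha> hb) (neg_ivl I)) (time_rev f)"
proof -
  have "time_rev (diff (obj (Oq emb \<alpha> hb) I) f) =
      (\<Sum>x\<in>inner_sites I. eom (- x) (odd_deriv (- x) (time_rev f)))"
    by (simp add: diff_Oq time_rev_lin time_rev_eom time_rev_odd_deriv[OF ivl_mons_finite[OF assms]])
  also have "\<dots> = (\<Sum>x\<in>uminus ` inner_sites I. eom x (odd_deriv x (time_rev f)))"
    by (simp add: sum.reindex)
  finally show ?thesis
    by (simp add: diff_Oq inner_sites_neg_image)
qed

text \<open>The list of arguments keeps its order, so the operation maps ask for multiplicativity of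
  \<open>time_rev\<close>. Order reversal becomes visible only in \<open>star\<close>, where
  negation exchanges left and right.\<close>

theorem C2_equivariant_Oq: "C2_equivariant_structure (Oq emb \<alpha> hb) time_reversal"
  unfolding C2_equivariant_structure_def component_Oq act_Oq
proof (intro conjI allI impI ballI)
  note eq = time_reversal_eq[OF sym_comp_subset]
  fix I n f
  assume f: "f \<in> sym_comp I n"
  show "time_reversal (neg_ivl I) (time_reversal I f) = f"
    using f time_rev_comp[OF f] by (simp add: eq)
next
  note eq = time_reversal_eq[OF sym_comp_subset]
  fix I
  show "complex_iso (obj (Oq emb \<alpha> hb) I) (obj (Oq emb \<alpha> hb) (neg_ivl I)) (time_reversal I)"
    unfolding complex_iso_def component_Oq scal_Oq
  proof (intro conjI allI ballI)
    fix n
    have "bij_betw time_rev (sym_comp I n) (sym_comp (neg_ivl I) n)"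
      using time_rev_comp[of _ I n] time_rev_comp[of _ "neg_ivl I" n]
      by (intro bij_betw_byWitness[where f' = time_rev]) auto
    then show "bij_betw (time_reversal I) (sym_comp I n) (sym_comp (neg_ivl I) n)"
      by (rule bij_betw_cong[THEN iffD1, rotated]) (simp add: eq)
  next
    fix n and f g :: "'r symalg" assume f: "f \<in> sym_comp I n" and g: "g \<in> sym_comp I n"
    then have "f + g \<in> sym_comp I n" unfolding sym_comp_conv_supp by auto
    with f g show "time_reversal I (f + g) = time_reversal I f + time_reversal I g"
      by (simp add: eq time_rev_lin)
  next
    fix n r and f :: "'r symalg" assume f: "f \<in> sym_comp I n"
    then have "scale r f \<in> sym_comp I n" unfolding sym_comp_conv_supp by auto
    with f show "time_reversal I (scale r f) = scale r (time_reversal I f)"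
      by (simp add: eq time_rev_lin)
  next
    fix n and f :: "'r symalg" assume f: "f \<in> sym_comp I n"
    then show "time_reversal I (diff (obj (Oq emb \<alpha> hb) I) f) =
        diff (obj (Oq emb \<alpha> hb) (neg_ivl I)) (time_reversal I f)"
      by (simp add: eq time_reversal_eq[OF diff_closed] time_rev_diff sym_comp_subset)
  qed
next
  fix Is J and fs :: "'r symalg list"
  assume op: "D11_op Is J" and len: "length fs = length Is"
    and fs: "\<forall>i<length Is. \<exists>n. fs ! i \<in> sym_comp (Is ! i) n"
  have mem: "fs ! i \<in> supp (ivl_mons (Is ! i))" if "i < length Is" for i
    using fs that sym_comp_subset by blast
  then have memJ: "f \<in> supp (ivl_mons J)" if "f \<in> set fs" for f
    using that len D11_op_sites[OF op] ivl_mons_mono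
    by (metis in_set_conv_nth nth_mem)
  have "map2 time_reversal Is fs = map time_rev fs"
    using len mem by (intro nth_equalityI) (auto simp: time_reversal_eq)
  then show "time_reversal J (sym_prod fs) = sym_prod (map2 time_reversal Is fs)"
    by (simp only: time_reversal_eq[OF sym_prod_closed[OF memJ]] time_rev_sym_prod[OF memJ])
qed

end

section \<open>The Weyl algebra as a quotient\<close>

lemma weyl_class_conv: "weyl_class hb f = {h. wcong hb h f}"
proof (rule Set.set_eqI)
  fix h
  have "h \<in> weyl_class hb f \<longleftrightarrow> (\<exists>i\<in>weyl_ideal hb. h = i + f)"
    by (simp add: weyl_class_def a_r_coset_def' free_ring_def)
  also have "\<dots> \<longleftrightarrow> h - f \<in> weyl_ideal hb"
    by (metis add_diff_cancel_right' diff_add_cancel)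
  finally show "h \<in> weyl_class hb f \<longleftrightarrow> h \<in> {h. wcong hb h f}"
    by (simp add: wcong_def)
qed

lemma weyl_class_eq_iff: "weyl_class hb f = weyl_class hb g \<longleftrightarrow> wcong hb f g"
proof
  have "f \<in> weyl_class hb f"
    by (simp add: weyl_class_conv)
  then show "weyl_class hb f = weyl_class hb g \<Longrightarrow> wcong hb f g"
    by (simp add: weyl_class_conv)
next
  assume fg: "wcong hb f g"
  have "wcong hb h f \<longleftrightarrow> wcong hb h g" for h
    using wcong_trans[OF _ fg] wcong_trans[OF _ wcong_sym[OF fg]] by blast
  then show "weyl_class hb f = weyl_class hb g"
    by (simp add: weyl_class_conv)
qed

text \<open>Maps on cosets are unions over representatives, and this turns their evaluation into
  invariance under congruence.\<close>

lemma UN_weyl_class: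
  assumes "\<And>g. wcong hb g f \<Longrightarrow> F g = F f"
  shows "(\<Union>g\<in>weyl_class hb f. F g) = F f"
proof (rule SUP_eq_const)
  have "f \<in> weyl_class hb f"
    by (simp add: weyl_class_conv)
  then show "weyl_class hb f \<noteq> {}" by blast
  fix g assume "g \<in> weyl_class hb f"
  then show "F g = F f"
    by (intro assms) (simp add: weyl_class_conv)
qed

lemma weyl_alg_simps:
  "carrier (weyl_alg hb) = range (weyl_class hb)"
  "\<one>\<^bsub>weyl_alg hb\<^esub> = weyl_class hb 1"
  "\<zero>\<^bsub>weyl_alg hb\<^esub> = weyl_class hb 0"
  "weyl_class hb f \<otimes>\<^bsub>weyl_alg hb\<^esub> weyl_class hb g = weyl_class hb (f * g)"
  "weyl_class hb f \<oplus>\<^bsub>weyl_alg hb\<^esub> weyl_class hb g = weyl_class hb (f + g)"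
  "r \<odot>\<^bsub>weyl_alg hb\<^esub> weyl_class hb f = weyl_class hb (scale r f)"
proof -
  show "carrier (weyl_alg hb) = range (weyl_class hb)"
    by (auto simp: weyl_alg_def ring.defs module.defs FactRing_def A_RCOSETS_def' weyl_class_def)
      (auto simp: free_ring_def)
  show "\<one>\<^bsub>weyl_alg hb\<^esub> = weyl_class hb 1"
    by (simp add: weyl_alg_def ring.defs module.defs FactRing_def weyl_class_def) (simp add: free_ring_def)
  have "weyl_class hb 0 = weyl_ideal hb"
    by (auto simp: weyl_class_conv wcong_zero_iff)
  then show "\<zero>\<^bsub>weyl_alg hb\<^esub> = weyl_class hb 0"
    by (simp add: weyl_alg_def ring.defs module.defs FactRing_def)
  have "weyl_class hb f \<otimes>\<^bsub>weyl_alg hb\<^esub> weyl_class hb g =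
      (\<Union>a\<in>weyl_class hb f. \<Union>b\<in>weyl_class hb g. weyl_class hb (a * b))"
    by (simp add: weyl_alg_def ring.defs module.defs FactRing_def rcoset_mult_def weyl_class_def)
      (simp add: free_ring_def)
  also have "\<dots> = (\<Union>a\<in>weyl_class hb f. weyl_class hb (a * g))"
    by (intro SUP_cong refl UN_weyl_class) (simp add: weyl_class_eq_iff wcong_mult_left)
  also have "\<dots> = weyl_class hb (f * g)"
    by (rule UN_weyl_class) (simp add: weyl_class_eq_iff wcong_mult_right)
  finally show "weyl_class hb f \<otimes>\<^bsub>weyl_alg hb\<^esub> weyl_class hb g = weyl_class hb (f * g)" .
  have "weyl_class hb f \<oplus>\<^bsub>weyl_alg hb\<^esub> weyl_class hb g =
      (\<Union>a\<in>weyl_class hb f. \<Union>b\<in>weyl_class hb g. {a + b})"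
    by (simp add: weyl_alg_def ring.defs module.defs FactRing_def set_add_def' free_ring_def)
  also have "\<dots> = weyl_class hb (f + g)"
  proof -
    \<comment> \<open>Addition of cosets is the set of sums, so each \<open>h\<close> must be split,
      here as \<open>(h - g) + g\<close>.\<close>
    have "h \<in> (\<Union>a\<in>weyl_class hb f. \<Union>b\<in>weyl_class hb g. {a + b})" if "wcong hb h (f + g)" for h
    proof -
      have "wcong hb (h - g) f"
        using that by (simp add: wcong_def algebra_simps)
      then show ?thesis
        by (intro UN_I[of "h - g"] UN_I[of g]) (simp_all add: weyl_class_conv)
    qed
    then show ?thesis
      by (auto simp: weyl_class_conv intro: wcong_add)
  qed
  finally show "weyl_class hb f \<oplus>\<^bsub>weyl_alg hb\<^esub> weyl_class hb g = weyl_class hb (f + g)" .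
  have "r \<odot>\<^bsub>weyl_alg hb\<^esub> weyl_class hb f = (\<Union>g\<in>weyl_class hb f. weyl_class hb (scale r g))"
    by (simp add: weyl_alg_def ring.defs module.defs)
  also have "\<dots> = weyl_class hb (scale r f)"
    by (rule UN_weyl_class) (simp add: weyl_class_eq_iff wcong_scale)
  finally show "r \<odot>\<^bsub>weyl_alg hb\<^esub> weyl_class hb f = weyl_class hb (scale r f)" .
qed

lemma weyl_alg_a_inv: "\<ominus>\<^bsub>weyl_alg hb\<^esub> weyl_class hb f = weyl_class hb (- f)"
proof -
  let ?W = "weyl_alg hb"
  have "\<ominus>\<^bsub>?W\<^esub> weyl_class hb f = (THE y. y \<in> carrier ?W
      \<and> weyl_class hb f \<oplus>\<^bsub>?W\<^esub> y = \<zero>\<^bsub>?W\<^esub> \<and> y \<oplus>\<^bsub>?W\<^esub> weyl_class hb f = \<zero>\<^bsub>?W\<^esub>)"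
    by (simp add: a_inv_def m_inv_def)
  also have "\<dots> = weyl_class hb (- f)"
  proof (rule the_equality)
    show "weyl_class hb (- f) \<in> carrier ?W \<and> weyl_class hb f \<oplus>\<^bsub>?W\<^esub> weyl_class hb (- f) = \<zero>\<^bsub>?W\<^esub>
        \<and> weyl_class hb (- f) \<oplus>\<^bsub>?W\<^esub> weyl_class hb f = \<zero>\<^bsub>?W\<^esub>"
      unfolding weyl_alg_simps by (intro conjI rangeI) simp_all
    fix y assume y: "y \<in> carrier ?W \<and> weyl_class hb f \<oplus>\<^bsub>?W\<^esub> y = \<zero>\<^bsub>?W\<^esub>
        \<and> y \<oplus>\<^bsub>?W\<^esub> weyl_class hb f = \<zero>\<^bsub>?W\<^esub>"
    then obtain g where g: "y = weyl_class hb g"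
      unfolding weyl_alg_simps by blast
    with y have "wcong hb (f + g) 0"
      by (simp add: weyl_alg_simps weyl_class_eq_iff)
    then have "wcong hb g (- f)"
      by (simp add: wcong_def add.commute)
    then show "y = weyl_class hb (- f)"
      by (simp add: g weyl_class_eq_iff)
  qed
  finally show ?thesis .
qed

section \<open>Isomorphisms out of the Weyl algebra, and its reversal\<close>

lemma algebra_isoD:
  assumes "algebra_iso A B \<phi>"
  shows "\<phi> \<one>\<^bsub>A\<^esub> = \<one>\<^bsub>B\<^esub>"
    "x \<in> carrier A \<Longrightarrow> \<phi> x \<in> carrier B"
    "x \<in> carrier A \<Longrightarrow> y \<in> carrier A \<Longrightarrow> \<phi> (x \<otimes>\<^bsub>A\<^esub> y) = \<phi> x \<otimes>\<^bsub>B\<^esub> \<phi> y"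
    "x \<in> carrier A \<Longrightarrow> y \<in> carrier A \<Longrightarrow> \<phi> (x \<oplus>\<^bsub>A\<^esub> y) = \<phi> x \<oplus>\<^bsub>B\<^esub> \<phi> y"
    "x \<in> carrier A \<Longrightarrow> \<phi> (r \<odot>\<^bsub>A\<^esub> x) = r \<odot>\<^bsub>B\<^esub> \<phi> x"
proof -
  have hom: "\<phi> \<in> ring_hom A B"
    using assms by (simp add: algebra_iso_def ring_iso_def)
  show "\<phi> \<one>\<^bsub>A\<^esub> = \<one>\<^bsub>B\<^esub>"
    using hom by (rule ring_hom_one)
  show "x \<in> carrier A \<Longrightarrow> \<phi> x \<in> carrier B"
    using hom by (rule ring_hom_closed)
  show "x \<in> carrier A \<Longrightarrow> y \<in> carrier A \<Longrightarrow> \<phi> (x \<otimes>\<^bsub>A\<^esub> y) = \<phi> x \<otimes>\<^bsub>B\<^esub> \<phi> y"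
    using hom by (rule ring_hom_mult)
  show "x \<in> carrier A \<Longrightarrow> y \<in> carrier A \<Longrightarrow> \<phi> (x \<oplus>\<^bsub>A\<^esub> y) = \<phi> x \<oplus>\<^bsub>B\<^esub> \<phi> y"
    using hom by (rule ring_hom_add)
  show "x \<in> carrier A \<Longrightarrow> \<phi> (r \<odot>\<^bsub>A\<^esub> x) = r \<odot>\<^bsub>B\<^esub> \<phi> x"
    using assms by (simp add: algebra_iso_def)
qed

text \<open>The generators determine an isomorphism. With \<open>B\<close> the opposite algebra this
  gives uniqueness of the anti-involution; with \<open>B\<close> the observables, uniqueness of the
  identification.\<close>

lemma weyl_alg_iso_eqI:
  assumes F: "algebra_iso (weyl_alg hb) B F" and G: "algebra_iso (weyl_alg hb) B G"
    and q: "F (weyl_q hb) = G (weyl_q hb)" and p: "F (weyl_p hb) = G (weyl_p hb)"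
    and "u \<in> carrier (weyl_alg hb)"
  shows "F u = G u"
proof -
  have mem: "weyl_class hb f \<in> carrier (weyl_alg hb)" for f
    by (simp add: weyl_alg_simps)
  have "F (weyl_class hb f) = G (weyl_class hb f)" for f
  proof (induction f rule: free_alg_induct)
    case (add f g)
    then show ?case
      using algebra_isoD(4)[OF F mem mem, of f g] algebra_isoD(4)[OF G mem mem, of f g]
      by (simp add: weyl_alg_simps)
  next
    case (scale r f)
    then show ?case
      using algebra_isoD(5)[OF F mem, of r f] algebra_isoD(5)[OF G mem, of r f]
      by (simp add: weyl_alg_simps)
  next
    case one
    show ?case
      using algebra_isoD(1)[OF F] algebra_isoD(1)[OF G] by (simp add: weyl_alg_simps)
  next
    case (gen x f)
    have "F (weyl_class hb (free_gen x)) = G (weyl_class hb (free_gen x))"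
      using q p by (cases x) (simp_all add: weyl_q_def weyl_p_def)
    with gen show ?case
      using algebra_isoD(3)[OF F mem mem, of "free_gen x" f] algebra_isoD(3)[OF G mem mem, of "free_gen x" f]
      by (simp add: weyl_alg_simps)
  qed
  then show ?thesis
    using assms(5) by (auto simp: weyl_alg_simps)
qed

lemma algebra_isoI:
  assumes bij: "bij_betw \<phi> (carrier A) (carrier B)" and one: "\<phi> \<one>\<^bsub>A\<^esub> = \<one>\<^bsub>B\<^esub>"
    and mult: "\<And>x y. x \<in> carrier A \<Longrightarrow> y \<in> carrier A \<Longrightarrow> \<phi> (x \<otimes>\<^bsub>A\<^esub> y) = \<phi> x \<otimes>\<^bsub>B\<^esub> \<phi> y"
    and add: "\<And>x y. x \<in> carrier A \<Longrightarrow> y \<in> carrier A \<Longrightarrow> \<phi> (x \<oplus>\<^bsub>A\<^esub> y) = \<phi> x \<oplus>\<^bsub>B\<^esub> \<phi> y"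
    and smult: "\<And>r x. x \<in> carrier A \<Longrightarrow> \<phi> (r \<odot>\<^bsub>A\<^esub> x) = r \<odot>\<^bsub>B\<^esub> \<phi> x"
  shows "algebra_iso A B \<phi>"
proof -
  have 1: "\<phi> \<in> carrier A \<rightarrow> carrier B" using bij by (rule bij_betw_imp_funcset)
  have 2: "\<phi> \<in> ring_hom A B"
    unfolding ring_hom_def mem_Collect_eq
    by (intro conjI allI impI 1 one mult add; elim conjE; assumption)
  have 3: "\<phi> \<in> ring_iso A B"
    unfolding ring_iso_def mem_Collect_eq using 2 bij by (rule conjI)
  show ?thesis
    unfolding algebra_iso_def by (intro conjI allI ballI 3 smult)
qed

lemma opposite_simps [simp]:
  "carrier (opposite A) = carrier A" "\<one>\<^bsub>opposite A\<^esub> = \<one>\<^bsub>A\<^esub>"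
  "x \<otimes>\<^bsub>opposite A\<^esub> y = y \<otimes>\<^bsub>A\<^esub> x" "x \<oplus>\<^bsub>opposite A\<^esub> y = x \<oplus>\<^bsub>A\<^esub> y"
  "r \<odot>\<^bsub>opposite A\<^esub> x = r \<odot>\<^bsub>A\<^esub> x"
  by (simp_all add: opposite_def)

definition weyl_rev :: "'r::comm_ring_1 \<Rightarrow> 'r free_alg set \<Rightarrow> 'r free_alg set" where
  "weyl_rev hb u = (\<Union>f\<in>u. weyl_class hb (free_rev f))"

lemma weyl_rev_class: "weyl_rev hb (weyl_class hb f) = weyl_class hb (free_rev f)"
  unfolding weyl_rev_def by (rule UN_weyl_class) (simp add: weyl_class_eq_iff wcong_free_rev)

lemma weyl_reversal_weyl_rev: "weyl_reversal hb (weyl_rev hb)"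
proof -
  let ?W = "weyl_alg hb"
  have inv: "weyl_rev hb (weyl_rev hb u) = u" and closed: "weyl_rev hb u \<in> carrier ?W"
    if u: "u \<in> carrier ?W" for u
  proof -
    obtain f where "u = weyl_class hb f"
      using u unfolding weyl_alg_simps by (rule rangeE)
    then show "weyl_rev hb (weyl_rev hb u) = u" "weyl_rev hb u \<in> carrier ?W"
      by (simp_all add: weyl_rev_class weyl_alg_simps)
  qed
  have "algebra_iso ?W (opposite ?W) (weyl_rev hb)"
  proof (rule algebra_isoI)
    show "bij_betw (weyl_rev hb) (carrier ?W) (carrier (opposite ?W))"
      unfolding opposite_simps
      by (rule bij_betw_byWitness[where f' = "weyl_rev hb"]) (use inv closed in blast)+
    show "weyl_rev hb \<one>\<^bsub>?W\<^esub> = \<one>\<^bsub>opposite ?W\<^esub>"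
      by (simp add: weyl_alg_simps weyl_rev_class)
    fix u v assume "u \<in> carrier ?W" "v \<in> carrier ?W"
    then obtain f g where u: "u = weyl_class hb f" and v: "v = weyl_class hb g"
      unfolding weyl_alg_simps by blast
    show "weyl_rev hb (u \<otimes>\<^bsub>?W\<^esub> v) = weyl_rev hb u \<otimes>\<^bsub>opposite ?W\<^esub> weyl_rev hb v"
      by (simp add: u v weyl_alg_simps weyl_rev_class free_rev_mult)
    show "weyl_rev hb (u \<oplus>\<^bsub>?W\<^esub> v) = weyl_rev hb u \<oplus>\<^bsub>opposite ?W\<^esub> weyl_rev hb v"
      by (simp add: u v weyl_alg_simps weyl_rev_class free_rev_lin)
  next
    fix r u assume "u \<in> carrier ?W"
    then obtain f where u: "u = weyl_class hb f"
      unfolding weyl_alg_simps by blast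
    show "weyl_rev hb (r \<odot>\<^bsub>?W\<^esub> u) = r \<odot>\<^bsub>opposite ?W\<^esub> weyl_rev hb u"
      by (simp add: u weyl_alg_simps weyl_rev_class free_rev_lin)
  qed
  moreover have "weyl_rev hb (weyl_q hb) = weyl_q hb"
    by (simp add: weyl_q_def weyl_rev_class)
  moreover have "weyl_rev hb (weyl_p hb) = \<ominus>\<^bsub>?W\<^esub> weyl_p hb"
    by (simp add: weyl_p_def weyl_rev_class weyl_alg_a_inv)
  ultimately show ?thesis
    using inv by (simp add: weyl_reversal_def anti_involution_def)
qed

section \<open>The cohomology algebra\<close>

context lattice_field
begin

text \<open>The place where the order of the two intervals enters: the sorted list of a union is
  then the concatenation of the sorted lists.\<close>

lemma time_ord_sym_mult:
  assumes f: "f \<in> supp (even_mons A)" and g: "g \<in> supp (even_mons B)"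
    and le: "\<And>x y. x \<in> A \<Longrightarrow> y \<in> B \<Longrightarrow> x \<le> y"
  shows "time_ord (sym_mult f g) = time_ord f * time_ord g"
  using f
proof (rule is_lin_eq_on)
  fix k :: "int multiset \<times> int set"
  assume "k \<in> even_mons A"
  then obtain m where k: "k = (m, {})" "set_mset m \<subseteq> A" by (auto simp: even_mons_def)
  show "time_ord (sym_mult (Poly_Mapping.single k 1) g) = time_ord (Poly_Mapping.single k 1) * time_ord g"
    using g
  proof (rule is_lin_eq_on)
    fix l :: "int multiset \<times> int set"
    assume "l \<in> even_mons B"
    then obtain n where l: "l = (n, {})" "set_mset n \<subseteq> B" by (auto simp: even_mons_def)
    have "ordprod (m + n) = ordprod m * ordprod n"
      by (intro ordprod_union le) (use k l in auto)
    then show "time_ord (sym_mult (Poly_Mapping.single k 1) (Poly_Mapping.single l 1)) =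
        time_ord (Poly_Mapping.single k 1) * time_ord (Poly_Mapping.single l 1)"
      by (simp add: k l sym_mult_single)
  qed (rule is_lin_comp[OF is_lin_time_ord is_lin_sym_mult(2)] is_lin_comp[OF is_lin_mult(2) is_lin_time_ord])+
qed (rule is_lin_comp[OF is_lin_time_ord is_lin_sym_mult(1)] is_lin_comp[OF is_lin_mult(1) is_lin_time_ord])+

lemma phi_minus: "phi (- x) = free_rev (phi x)"
  by (simp add: phi_def free_rev_lin)

lemma ordprod_uminus: "ordprod (image_mset uminus m) = free_rev (ordprod m)"
proof -
  define l where "l = sorted_list_of_multiset m"
  have m: "m = mset l" and l: "sorted l" by (simp_all add: l_def)
  have "sorted (rev (map uminus l))"
    using l by (simp add: sorted_wrt_rev sorted_wrt_map)
  moreover have "image_mset uminus m = mset (rev (map uminus l))"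
    by (simp add: m)
  ultimately have "ordprod (image_mset uminus m) = prod_list (map phi (rev (map uminus l)))"
    by (simp only: ordprod_mset)
  also have "\<dots> = free_rev (ordprod m)"
    unfolding m ordprod_mset[OF l]
    by (simp add: free_rev_prod_list rev_map comp_def phi_minus)
  finally show ?thesis .
qed

lemma time_ord_time_rev:
  assumes "f \<in> supp (even_mons A)"
  shows "time_ord (time_rev f) = free_rev (time_ord f)"
  using assms
proof (rule is_lin_eq_on)
  fix k :: "int multiset \<times> int set"
  assume "k \<in> even_mons A"
  then obtain m where "k = (m, {})" by (auto simp: even_mons_def)
  then show "time_ord (time_rev (Poly_Mapping.single k 1)) = free_rev (time_ord (Poly_Mapping.single k 1))"
    by (simp add: time_rev_single ordprod_uminus)
qed (rule is_lin_comp[OF is_lin_time_ord is_lin_time_rev] is_lin_comp[OF is_lin_free_rev is_lin_time_ord])+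

lemma sym_mult_even_closed:
  assumes "f \<in> supp (even_mons A)" "g \<in> supp (even_mons A)"
  shows "sym_mult f g \<in> supp (even_mons A)"
  unfolding sym_mult_conv_lin
  by (intro lin_supp[OF assms(1)] lin_supp[OF assms(2)])
    (auto simp: mono_mult_def even_mons_def intro!: supp_single supp_closed)

end

section \<open>Degree-zero cohomology of an interval\<close>

lemma sym_comp_0: "sym_comp I 0 = supp (even_mons (sites I))"
proof -
  have "{(m, S). set_mset m \<subseteq> sites I \<and> S \<subseteq> inner_sites I \<and> - int (card S) = 0} = even_mons (sites I)"
    \<comment> \<open>Finiteness of the inner sites excludes an infinite \<open>S\<close>, whose
      \<open>card\<close> would also be zero.\<close>
    by (auto simp: even_mons_def card_0_eq dest: finite_subset[OF _ finite_inner_sites])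
  then show ?thesis by (simp add: sym_comp_conv_supp)
qed

text \<open>The shape required by \<open>time_ord_kernel\<close>, with \<open>b = - 3\<close> and
  \<open>t = 3\<close>.\<close>

lemma sites_J0: "sites J0 = {- 3..3}" and inner_sites_J0: "inner_sites J0 = {- 3<..<3}"
  by (auto simp: sites_def inner_sites_def J0_def)

lemma neg_J0 [simp]: "neg_ivl J0 = J0"
  by (simp add: neg_ivl_def J0_def)

text \<open>Length greater than 2 leaves room for the first two integers after the left endpoint,
  the two initial sites on which \<open>rho\<close> is based.\<close>

lemma color_initial_sites:
  assumes "color I"
  obtains b where "b \<in> sites I" "b + 1 \<in> sites I" "\<forall>y\<in>sites I. b \<le> y"
proof
  let ?b = "\<lfloor>fst I\<rfloor> + 1"
  show "?b \<in> sites I" "?b + 1 \<in> sites I" "\<forall>y\<in>sites I. ?b \<le> y"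
    using assms by (auto simp: sites_def color_def) linarith+
qed

text \<open>Builds a cochain with prescribed odd derivatives. It is applied in degree zero, where
  multiplying by an odd generator involves no sign and no repeated factor.\<close>

definition odd_mult :: "int \<Rightarrow> 'r::comm_ring_1 symalg \<Rightarrow> 'r symalg" where
  "odd_mult x = lin (\<lambda>(m, S). Poly_Mapping.single (m, insert x S) 1)"

lemma is_lin_odd_mult: "is_lin (odd_mult x)"
  by (simp add: odd_mult_def)

lemma odd_deriv_odd_mult:
  assumes "g \<in> supp (even_mons A)"
  shows "odd_deriv y (odd_mult x g) = (if y = x then g else 0)"
  using assms
proof (rule is_lin_eq_on)
  fix k :: "int multiset \<times> int set"
  assume "k \<in> even_mons A"
  then obtain m where "k = (m, {})" by (auto simp: even_mons_def)
  then show "odd_deriv y (odd_mult x (Poly_Mapping.single k (1::'a))) =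
      (if y = x then Poly_Mapping.single k 1 else 0)"
    by (simp add: odd_mult_def odd_deriv_single cong: conj_cong)
qed (rule is_lin_comp[OF is_lin_odd_deriv is_lin_odd_mult] is_lin_if[OF is_lin_id is_lin_zero])+

context quantum_field
begin

abbreviation cplx :: "ivl \<Rightarrow> ('r, 'r symalg) cochain" where
  "cplx I \<equiv> obj (Oq emb \<alpha> hb) I"

lemma cocycles_0: "cocycles (cplx I) 0 = supp (even_mons (sites I))"
proof -
  have "diff (cplx I) f = 0" if f: "f \<in> supp (even_mons (sites I))" for f
  proof -
    have "odd_deriv x f = 0" for x
      using f
    proof (rule is_lin_eq_on)
      fix k :: "int multiset \<times> int set"
      assume "k \<in> even_mons (sites I)"
      then show "odd_deriv x (Poly_Mapping.single k (1::'r)) = 0"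
        by (auto simp: even_mons_def odd_deriv_single)
    qed (rule is_lin_odd_deriv is_lin_zero)+
    then show ?thesis by (simp add: diff_Oq eom_lin)
  qed
  then show ?thesis by (auto simp: cocycles_def sym_comp_0)
qed

text \<open>Keys of degree \<open>- 1\<close> carry exactly one odd generator, so such a cochain is
  the same as a family of degree-zero coefficients, read off by \<open>odd_deriv\<close> and
  reassembled by \<open>odd_mult\<close>.\<close>

lemma coboundaries_0: "coboundaries (cplx I) 0 = bdry (sites I) (inner_sites I)"
proof (intro equalityI subsetI)
  fix h assume "h \<in> coboundaries (cplx I) 0"
  then obtain f where f: "f \<in> sym_comp I (- 1)" and h: "h = diff (cplx I) f"
    by (auto simp: coboundaries_def)
  have "odd_deriv x f \<in> supp (even_mons (sites I))" for x
    using f unfolding sym_comp_conv_supp odd_deriv_conv_lin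
    by (rule lin_supp) (auto simp: even_mons_def card_1_singleton_iff intro!: supp_single supp_closed)
  then show "h \<in> bdry (sites I) (inner_sites I)"
    unfolding h diff_Oq by (rule bdryI)
next
  fix h assume "h \<in> bdry (sites I) (inner_sites I)"
  then obtain g where h: "h = (\<Sum>x\<in>inner_sites I. eom x (g x))"
    and g: "\<And>x. x \<in> inner_sites I \<Longrightarrow> g x \<in> supp (even_mons (sites I))"
    by (auto simp: bdry_def)
  let ?f = "\<Sum>x\<in>inner_sites I. odd_mult x (g x)"
  have "odd_mult x (g x) \<in> sym_comp I (- 1)" if "x \<in> inner_sites I" for x
    using g[OF that] unfolding sym_comp_conv_supp odd_mult_def
    by (rule lin_supp) (use that in \<open>auto simp: even_mons_def intro!: supp_single\<close>)
  then have "?f \<in> sym_comp I (- 1)"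
    unfolding sym_comp_conv_supp by (intro supp_sum)
  moreover have "diff (cplx I) ?f = h"
    unfolding diff_Oq h
  proof (rule sum.cong[OF refl])
    fix y assume y: "y \<in> inner_sites I"
    have "odd_deriv y ?f = (\<Sum>x\<in>inner_sites I. if y = x then g x else 0)"
      unfolding odd_deriv_lin by (rule sum.cong) (simp_all add: odd_deriv_odd_mult[OF g])
    then show "eom y (odd_deriv y ?f) = eom y (g y)"
      using y by simp
  qed
  ultimately show "h \<in> coboundaries (cplx I) 0"
    by (auto simp: coboundaries_def)
qed

lemma cls_conv: "cls (cplx I) 0 f = {h. h - f \<in> bdry (sites I) (inner_sites I)}"
proof -
  have "h \<in> cls (cplx I) 0 f \<longleftrightarrow> h - f \<in> bdry (sites I) (inner_sites I)" for h
    by (auto simp: cls_def coboundaries_0 intro: exI[of _ "h - f"])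
  then show ?thesis by blast
qed

lemma cls_self: "f \<in> cls (cplx I) 0 f"
  by (simp add: cls_conv bdry_zero)

lemma cls_eqI:
  assumes "f - g \<in> bdry (sites I) (inner_sites I)"
  shows "cls (cplx I) 0 f = cls (cplx I) 0 g"
proof -
  have "h - f \<in> bdry (sites I) (inner_sites I) \<longleftrightarrow> h - g \<in> bdry (sites I) (inner_sites I)" for h
    using bdry_add[OF _ assms, of "h - f"] bdry_diff[OF _ assms, of "h - g"] by auto
  then show ?thesis by (simp add: cls_conv)
qed

lemma cls_eq_iff: "cls (cplx I) 0 f = cls (cplx I) 0 g \<longleftrightarrow> f - g \<in> bdry (sites I) (inner_sites I)"
  using cls_eqI[of f g I] cls_self[of f I] unfolding cls_conv by blast

abbreviation obs :: "ivl \<Rightarrow> 'r symalg set" where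
  "obs I \<equiv> supp (even_mons (sites I))"

lemma bdry_obs: "h \<in> bdry (sites I) (inner_sites I) \<Longrightarrow> h \<in> obs I"
  unfolding bdry_def eom_def
  by (auto intro!: supp_sum supp_closed pos_mult_closed even_deriv_closed simp: inner_sites_iff)

lemma cls_obs: "f \<in> obs I \<Longrightarrow> h \<in> cls (cplx I) 0 f \<Longrightarrow> h \<in> obs I"
  using supp_closed(2)[OF bdry_obs[of "h - f" I], of f] by (simp add: cls_conv)

lemma cls_time_ord: "h \<in> cls (cplx I) 0 f \<Longrightarrow> wcong hb (time_ord h) (time_ord f)"
  using time_ord_bdry[of "h - f"] by (simp add: cls_conv time_ord_lin wcong_iff_diff[of _ "time_ord h"])

definition cls_J0 :: "'r symalg \<Rightarrow> 'r symalg set" where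
  "cls_J0 f = cls (cplx J0) 0 f"

text \<open>Transports equality in cohomology to the Weyl algebra by \<open>time_ord_kernel\<close>;
  well-definedness of the operations on classes over \<open>J0\<close> is checked there.\<close>

lemma cls_J0_eq_iff:
  assumes "f \<in> obs J0" "g \<in> obs J0"
  shows "cls_J0 f = cls_J0 g \<longleftrightarrow> wcong hb (time_ord f) (time_ord g)"
proof -
  have "f - g \<in> obs J0"
    using assms by auto
  then have "f - g \<in> bdry (sites J0) (inner_sites J0) \<longleftrightarrow> wcong hb (time_ord (f - g)) 0"
    unfolding sites_J0 inner_sites_J0 by (intro time_ord_kernel[symmetric]) simp
  then show ?thesis
    by (simp add: cls_J0_def cls_eq_iff time_ord_lin wcong_iff_diff[of _ "time_ord f"])
qed

lemma cohomology_J0: "cohomology (cplx J0) 0 = cls_J0 ` obs J0"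
  by (simp add: cohomology_def cocycles_0 cls_J0_def[abs_def])

lemma UN_cls:
  assumes "f \<in> obs I" "\<And>h. h \<in> obs I \<Longrightarrow> wcong hb (time_ord h) (time_ord f) \<Longrightarrow> F h = F f"
  shows "(\<Union>h\<in>cls (cplx I) 0 f. F h) = F f"
proof (rule SUP_eq_const)
  show "cls (cplx I) 0 f \<noteq> {}"
    using cls_self by blast
  fix h assume "h \<in> cls (cplx I) 0 f"
  then show "F h = F f"
    by (intro assms(2) cls_obs[OF assms(1)] cls_time_ord)
qed

lemma induced_cls_J0:
  assumes "f \<in> obs J0"
    and "\<And>h. h \<in> obs J0 \<Longrightarrow> \<phi> h \<in> obs J0"
    and "\<And>h. h \<in> obs J0 \<Longrightarrow> wcong hb (time_ord h) (time_ord f)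
      \<Longrightarrow> wcong hb (time_ord (\<phi> h)) (time_ord (\<phi> f))"
  shows "induced (cplx J0) 0 \<phi> (cls_J0 f) = cls_J0 (\<phi> f)"
proof -
  have "induced (cplx J0) 0 \<phi> (cls_J0 f) = (\<Union>h\<in>cls (cplx J0) 0 f. cls_J0 (\<phi> h))"
    by (simp add: induced_def cls_J0_def)
  also have "\<dots> = cls_J0 (\<phi> f)"
    by (rule UN_cls[OF assms(1)]) (simp add: cls_J0_eq_iff assms)
  finally show ?thesis .
qed

lemma induced_time_reversal:
  assumes "f \<in> obs J0"
  shows "induced (cplx J0) 0 (time_reversal J0) (cls_J0 f) = cls_J0 (time_rev f)"
proof -
  have eq: "time_reversal J0 h = time_rev h" if "h \<in> obs J0" for h
    by (rule time_reversal_eq, rule sym_comp_subset[of _ _ 0]) (simp add: sym_comp_0 that)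
  have closed: "time_rev h \<in> obs J0" if "h \<in> obs J0" for h
    using time_rev_comp[of h J0 0] that by (simp add: sym_comp_0)
  have "induced (cplx J0) 0 (time_reversal J0) (cls_J0 f) = cls_J0 (time_reversal J0 f)"
    using assms by (intro induced_cls_J0) (auto simp: eq closed time_ord_time_rev intro: wcong_free_rev)
  then show ?thesis by (simp add: eq assms)
qed

lemma time_rev_obs_J0: "f \<in> obs J0 \<Longrightarrow> time_rev f \<in> obs J0"
  using time_rev_comp[of f J0 0] by (simp add: sym_comp_0)

section \<open>The star product computed by time ordering\<close>

text \<open>A section of time ordering on the observables of \<open>J0\<close>, based at its leftmost site.\<close>

definition lift :: "'r free_alg \<Rightarrow> 'r symalg" where
  "lift w = rho (- 3) w sym_one"

lemma lift_obs [simp]: "lift w \<in> obs J0"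
  unfolding lift_def sites_J0 by (rule rho_closed) simp_all

lemma time_ord_lift: "wcong hb (time_ord (lift w)) w"
  using time_ord_rho[of "- 3" "sites J0" sym_one w] by (simp add: lift_def sites_J0)

text \<open>\<open>inv_into\<close> returns some preimage. One exists because the first two sites of
  \<open>I\<close> already realize every time-ordered product; and any preimage has the right
  product, since inclusion keeps representatives and classes over \<open>J0\<close> detect
  it.\<close>

lemma restrict_classE:
  assumes "D11_op Is J0" "I \<in> set Is" "f \<in> obs J0"
  obtains g where "restrict_class emb \<alpha> hb I (cls_J0 f) = cls (cplx I) 0 g" "g \<in> obs I"
    "wcong hb (time_ord g) (time_ord f)"
proof -
  let ?ind = "induced (cplx J0) 0 (\<lambda>f. act (Oq emb \<alpha> hb) [I] J0 [f])"
  have sub: "g \<in> obs J0" if "g \<in> obs I" for g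
    using D11_op_sites(1)[OF assms(1,2)] that by (rule even_mons_mono)
  have ind: "?ind (cls (cplx I) 0 g) = cls_J0 g" if "g \<in> obs I" for g
    unfolding induced_def act_Oq sym_prod_simps sym_mult_one_right cls_J0_def[symmetric]
    by (rule UN_cls[OF that]) (simp add: cls_J0_eq_iff sub that)
  have "color I" using assms by (auto simp: D11_op_def)
  then obtain b where b: "b \<in> sites I" "b + 1 \<in> sites I" and le: "\<forall>y\<in>sites I. b \<le> y"
    by (rule color_initial_sites)
  let ?g = "rho b (time_ord f) sym_one"
  have g: "?g \<in> obs I"
    using b by (intro rho_closed) simp_all
  have "wcong hb (time_ord ?g) (time_ord f)"
    using time_ord_rho[OF b, of sym_one "time_ord f"] le by simp
  then have "cls_J0 ?g = cls_J0 f"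
    by (rule cls_J0_eq_iff[OF sub[OF g] assms(3), THEN iffD2])
  with ind[OF g] have "cls_J0 f = ?ind (cls (cplx I) 0 ?g)"
    by (simp only:)
  moreover have "cls (cplx I) 0 ?g \<in> cohomology (cplx I) 0"
    using g by (simp add: cohomology_def cocycles_0)
  ultimately have "cls_J0 f \<in> ?ind ` cohomology (cplx I) 0"
    by (rule image_eqI)
  then have "?ind (restrict_class emb \<alpha> hb I (cls_J0 f)) = cls_J0 f"
    and "restrict_class emb \<alpha> hb I (cls_J0 f) \<in> cohomology (cplx I) 0"
    unfolding restrict_class_def by (rule f_inv_into_f, rule inv_into_into)
  moreover from this(2) obtain g' where g': "restrict_class emb \<alpha> hb I (cls_J0 f) = cls (cplx I) 0 g'" "g' \<in> obs I"
    unfolding cohomology_def cocycles_0 by blast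
  ultimately have "cls_J0 g' = cls_J0 f"
    using ind[OF g'(2)] by metis
  then have "wcong hb (time_ord g') (time_ord f)"
    by (rule cls_J0_eq_iff[OF sub[OF g'(2)] assms(3), THEN iffD1])
  with g' show thesis by (rule that)
qed

text \<open>The result is characterized by its time-ordered product alone, so any convenient
  representative \<open>h\<close> may be used, whatever the two intervals.\<close>

lemma star_cls_J0:
  assumes pair: "left_right_pair I1 I2" and f: "f \<in> obs J0" and g: "g \<in> obs J0" and h: "h \<in> obs J0"
    and prod: "wcong hb (time_ord h) (time_ord f * time_ord g)"
  shows "star emb \<alpha> hb I1 I2 (cls_J0 f) (cls_J0 g) = cls_J0 h"
proof -
  have op: "D11_op [I1, I2] J0" and le: "snd I1 \<le> fst I2"
    using pair by (auto simp: left_right_pair_def)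
  obtain f' where f': "restrict_class emb \<alpha> hb I1 (cls_J0 f) = cls (cplx I1) 0 f'" "f' \<in> obs I1"
    "wcong hb (time_ord f') (time_ord f)"
    using restrict_classE[OF op _ f, of I1] by auto
  obtain g' where g': "restrict_class emb \<alpha> hb I2 (cls_J0 g) = cls (cplx I2) 0 g'" "g' \<in> obs I2"
    "wcong hb (time_ord g') (time_ord g)"
    using restrict_classE[OF op _ g, of I2] by auto
  have mult: "cls_J0 (sym_mult x y) = cls_J0 h"
    if x: "x \<in> obs I1" "wcong hb (time_ord x) (time_ord f')"
      and y: "y \<in> obs I2" "wcong hb (time_ord y) (time_ord g')" for x y
  proof -
    have "x \<in> obs J0" "y \<in> obs J0"
      using x y D11_op_sites(1)[OF op] even_mons_mono by (metis list.set_intros)+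
    then have "sym_mult x y \<in> obs J0"
      by (rule sym_mult_even_closed)
    moreover have "time_ord (sym_mult x y) = time_ord x * time_ord y"
    proof (rule time_ord_sym_mult[OF x(1) y(1)])
      fix s t assume "s \<in> sites I1" "t \<in> sites I2"
      then have "real_of_int s < real_of_int t"
        using le by (auto simp: sites_def)
      then show "s \<le> t" by simp
    qed
    moreover have "wcong hb (time_ord x * time_ord y) (time_ord f * time_ord g)"
      by (intro wcong_mult wcong_trans[OF x(2) f'(3)] wcong_trans[OF y(2) g'(3)])
    ultimately show ?thesis
      using h wcong_trans[OF _ wcong_sym[OF prod]] by (simp add: cls_J0_eq_iff)
  qed
  have "star emb \<alpha> hb I1 I2 (cls_J0 f) (cls_J0 g) =
      (\<Union>x\<in>cls (cplx I1) 0 f'. \<Union>y\<in>cls (cplx I2) 0 g'. cls_J0 (sym_mult x y))"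
    by (simp only: star_def induced2_def f'(1) g'(1) act_Oq sym_prod_simps sym_mult_one_right cls_J0_def[symmetric])
  also have "\<dots> = (\<Union>x\<in>cls (cplx I1) 0 f'. cls_J0 (sym_mult x g'))"
    by (intro SUP_cong refl UN_cls[OF g'(2)])
      (simp add: mult cls_obs[OF f'(2)] cls_time_ord g'(2))
  also have "\<dots> = cls_J0 (sym_mult f' g')"
    by (rule UN_cls[OF f'(2)]) (simp add: mult f'(2) g'(2))
  also have "\<dots> = cls_J0 h"
    by (rule mult) (simp_all add: f' g')
  finally show ?thesis .
qed

section \<open>The algebra structure on cohomology and its anti-involution\<close>

lemma A_alg_simps:
  "carrier (A_alg emb \<alpha> hb I1 I2) = cls_J0 ` obs J0"
  "\<one>\<^bsub>A_alg emb \<alpha> hb I1 I2\<^esub> = cls_J0 sym_one"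
  "u \<otimes>\<^bsub>A_alg emb \<alpha> hb I1 I2\<^esub> v = star emb \<alpha> hb I1 I2 u v"
  by (simp_all add: A_alg_def Let_def cohomology_J0 cls_J0_def)

lemma A_alg_smult:
  "f \<in> obs J0 \<Longrightarrow> r \<odot>\<^bsub>A_alg emb \<alpha> hb I1 I2\<^esub> cls_J0 f = cls_J0 (scale r f)"
proof -
  assume f: "f \<in> obs J0"
  have "induced (cplx J0) 0 (scale r) (cls_J0 f) = cls_J0 (scale r f)"
    by (rule induced_cls_J0[OF f]) (auto simp: time_ord_lin intro: wcong_scale)
  then show ?thesis by (simp add: A_alg_def Let_def)
qed

lemma A_alg_add:
  assumes f: "f \<in> obs J0" and g: "g \<in> obs J0"
  shows "cls_J0 f \<oplus>\<^bsub>A_alg emb \<alpha> hb I1 I2\<^esub> cls_J0 g = cls_J0 (f + g)"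
proof -
  have add_eq: "cls_J0 (x + y) = cls_J0 (f + g)"
    if "x \<in> obs J0" "wcong hb (time_ord x) (time_ord f)" "y \<in> obs J0" "wcong hb (time_ord y) (time_ord g)" for x y
    using that f g by (subst cls_J0_eq_iff) (auto simp: time_ord_lin intro: wcong_add)
  have "cls_J0 f \<oplus>\<^bsub>A_alg emb \<alpha> hb I1 I2\<^esub> cls_J0 g = (\<Union>x\<in>cls (cplx J0) 0 f. \<Union>y\<in>cls (cplx J0) 0 g. cls_J0 (x + y))"
    by (simp add: A_alg_def Let_def induced2_def cls_J0_def)
  also have "\<dots> = (\<Union>x\<in>cls (cplx J0) 0 f. cls_J0 (f + g))"
  proof (intro SUP_cong refl)
    fix x assume x: "x \<in> cls (cplx J0) 0 f"
    note add_x = add_eq[OF cls_obs[OF f x] cls_time_ord[OF x]]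
    have "(\<Union>y\<in>cls (cplx J0) 0 g. cls_J0 (x + y)) = cls_J0 (x + g)"
      by (rule UN_cls[OF g]) (simp only: add_x g wcong_refl)
    also have "\<dots> = cls_J0 (f + g)"
      by (rule add_x[OF g wcong_refl])
    finally show "(\<Union>y\<in>cls (cplx J0) 0 g. cls_J0 (x + y)) = cls_J0 (f + g)" .
  qed
  also have "\<dots> = cls_J0 (f + g)"
    using cls_self[of f J0] by (intro SUP_eq_const) auto
  finally show ?thesis .
qed

theorem anti_involution_A_alg:
  assumes pair: "left_right_pair I1 I2"
  shows "anti_involution (A_alg emb \<alpha> hb I1 I2) (induced (cplx J0) 0 (time_reversal J0))"
    (is "anti_involution ?A ?t")
  unfolding anti_involution_def
proof (intro conjI ballI algebra_isoI)
  show inv: "?t (?t u) = u" if "u \<in> carrier ?A" for u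
    using that by (auto simp: A_alg_simps induced_time_reversal time_rev_obs_J0)
  have "?t u \<in> carrier ?A" if "u \<in> carrier ?A" for u
    using that by (auto simp: A_alg_simps induced_time_reversal time_rev_obs_J0)
  with inv show "bij_betw ?t (carrier ?A) (carrier (opposite ?A))"
    by (intro bij_betw_byWitness[where f' = ?t]) auto
  show "?t \<one>\<^bsub>?A\<^esub> = \<one>\<^bsub>opposite ?A\<^esub>"
    by (simp add: A_alg_simps induced_time_reversal)
next
  fix u v assume "u \<in> carrier ?A" "v \<in> carrier ?A"
  then obtain f g where f: "u = cls_J0 f" "f \<in> obs J0" and g: "v = cls_J0 g" "g \<in> obs J0"
    by (auto simp: A_alg_simps)
  \<comment> \<open>A representative of the star product. \<open>free_rev\<close> reverses its
    time-ordered product, so \<open>time_rev ?h\<close> represents the star product of the reversed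
    factors in the opposite order.\<close>
  let ?h = "lift (time_ord f * time_ord g)"
  have h: "wcong hb (time_ord ?h) (time_ord f * time_ord g)"
    by (rule time_ord_lift)
  have "wcong hb (time_ord (time_rev ?h)) (time_ord (time_rev g) * time_ord (time_rev f))"
    using wcong_free_rev[OF h] f g
    by (simp add: time_ord_time_rev[OF lift_obs] time_ord_time_rev[OF f(2)] time_ord_time_rev[OF g(2)] free_rev_mult)
  then have "star emb \<alpha> hb I1 I2 (cls_J0 (time_rev g)) (cls_J0 (time_rev f)) = cls_J0 (time_rev ?h)"
    using f g by (intro star_cls_J0[OF pair]) (simp_all add: time_rev_obs_J0)
  moreover have "star emb \<alpha> hb I1 I2 (cls_J0 f) (cls_J0 g) = cls_J0 ?h"
    using f g h by (intro star_cls_J0[OF pair]) simp_all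
  ultimately show "?t (u \<otimes>\<^bsub>?A\<^esub> v) = ?t u \<otimes>\<^bsub>opposite ?A\<^esub> ?t v"
    using f g by (simp add: A_alg_simps induced_time_reversal)
  have "f + g \<in> obs J0" using f g by auto
  then show "?t (u \<oplus>\<^bsub>?A\<^esub> v) = ?t u \<oplus>\<^bsub>opposite ?A\<^esub> ?t v"
    using f g by (simp add: A_alg_add induced_time_reversal time_rev_obs_J0 time_rev_lin)
next
  fix r u assume "u \<in> carrier ?A"
  then obtain f where f: "u = cls_J0 f" "f \<in> obs J0"
    by (auto simp: A_alg_simps)
  then have "scale r f \<in> obs J0" by auto
  then show "?t (r \<odot>\<^bsub>?A\<^esub> u) = r \<odot>\<^bsub>opposite ?A\<^esub> ?t u"
    using f by (simp add: A_alg_smult induced_time_reversal time_rev_obs_J0 time_rev_lin)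
qed

section \<open>The identification with the Weyl algebra\<close>

definition weyl_iso :: "'r free_alg set \<Rightarrow> 'r symalg set" where
  "weyl_iso u = (\<Union>w\<in>u. cls_J0 (lift w))"

text \<open>On classes this inverts time ordering; \<open>lift w\<close> may be replaced by any
  observable with a congruent time-ordered product.\<close>

lemma weyl_iso_class:
  assumes "f \<in> obs J0" "wcong hb (time_ord f) w"
  shows "weyl_iso (weyl_class hb w) = cls_J0 f"
proof -
  have lift_eq: "cls_J0 (lift v) = cls_J0 f" if "wcong hb v w" for v
    using wcong_trans[OF time_ord_lift[of v] wcong_trans[OF that wcong_sym[OF assms(2)]]]
    by (simp add: cls_J0_eq_iff assms(1))
  have "weyl_iso (weyl_class hb w) = cls_J0 (lift w)"
    unfolding weyl_iso_def by (rule UN_weyl_class) (simp add: lift_eq)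
  then show ?thesis by (simp add: lift_eq)
qed

lemma weyl_iso_lift: "weyl_iso (weyl_class hb w) = cls_J0 (lift w)"
  by (rule weyl_iso_class) (simp_all add: time_ord_lift)

theorem weyl_identification_weyl_iso:
  assumes pair: "left_right_pair I1 I2"
  shows "weyl_identification emb \<alpha> hb I1 I2 weyl_iso"
  unfolding weyl_identification_def
proof (intro conjI algebra_isoI)
  let ?W = "weyl_alg hb" and ?A = "A_alg emb \<alpha> hb I1 I2"
  have "inj_on weyl_iso (carrier ?W)"
  proof (rule inj_onI)
    fix u v assume "u \<in> carrier ?W" "v \<in> carrier ?W" "weyl_iso u = weyl_iso v"
    then obtain w w' where w: "u = weyl_class hb w" "v = weyl_class hb w'" and "cls_J0 (lift w) = cls_J0 (lift w')"
      by (auto simp: weyl_alg_simps weyl_iso_lift)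
    then have "wcong hb (time_ord (lift w)) (time_ord (lift w'))"
      by (simp add: cls_J0_eq_iff)
    then have "wcong hb w w'"
      by (meson time_ord_lift wcong_sym wcong_trans)
    then show "u = v" by (simp add: w weyl_class_eq_iff)
  qed
  moreover have "weyl_iso ` carrier ?W = carrier ?A"
  proof (intro equalityI subsetI)
    fix u assume "u \<in> carrier ?A"
    then obtain f where "u = cls_J0 f" "f \<in> obs J0" by (auto simp: A_alg_simps)
    \<comment> \<open>The class of \<open>f\<close> is the image of its own time-ordered
      product.\<close>
    then show "u \<in> weyl_iso ` carrier ?W"
      using weyl_iso_class[of f "time_ord f"] by (auto simp: weyl_alg_simps intro!: rev_image_eqI)
  qed (auto simp: weyl_alg_simps weyl_iso_lift A_alg_simps)
  ultimately show "bij_betw weyl_iso (carrier ?W) (carrier ?A)"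
    by (simp add: bij_betw_def)
  show "weyl_iso \<one>\<^bsub>?W\<^esub> = \<one>\<^bsub>?A\<^esub>"
    by (simp add: weyl_alg_simps A_alg_simps weyl_iso_class)
  show "weyl_iso (weyl_q hb) = obs_class emb \<alpha> hb (delta 0)"
    unfolding weyl_q_def obs_class_def cls_J0_def[symmetric]
    by (rule weyl_iso_class) (simp_all add: sites_J0 even_elem_delta single_in_even_mons)
  have d: "even_elem J0 (\<lambda>x. emb (1 / 2) * (delta 1 x - delta (- 1) x)) =
      scale (emb (1 / 2)) (Poly_Mapping.single ({#1#}, {}) 1 - Poly_Mapping.single ({#- 1#}, {}) 1)"
  proof -
    have "even_elem J0 (\<lambda>x. emb (1 / 2) * (delta 1 x - delta (- 1) x)) =
        scale (emb (1 / 2)) (even_elem J0 (delta 1) - even_elem J0 (delta (- 1)))"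
      by (simp add: even_elem_def scale_sum scale_diff_right sum_subtractf scale_single single_diff algebra_simps)
    then show ?thesis by (simp add: even_elem_delta sites_J0 del: map_single)
  qed
  \<comment> \<open>The even parts cancel and the odd parts add up to twice \<open>p\<close>; the
    factor one half in the prescribed image of \<open>p\<close> compensates.\<close>
  have "phi 1 - phi (- 1) = free_gen Gen_p + free_gen Gen_p"
    by (simp add: phi_def)
  then have "scale (emb (1 / 2)) (phi 1 - phi (- 1)) = scale (emb (1 / 2) + emb (1 / 2)) (free_gen Gen_p)"
    by (simp only: scale_add_left scale_add_right)
  then have p: "scale (emb (1 / 2)) (phi 1 - phi (- 1)) = free_gen Gen_p"
    by (simp only: emb_half scale_one)
  show "weyl_iso (weyl_p hb) = obs_class emb \<alpha> hb (\<lambda>x. emb (1 / 2) * (delta 1 x - delta (- 1) x))"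
    unfolding weyl_p_def obs_class_def cls_J0_def[symmetric] d
  proof (rule weyl_iso_class)
    show "scale (emb (1 / 2)) (Poly_Mapping.single ({#1#}, {}) 1 - Poly_Mapping.single ({#- 1#}, {}) 1) \<in> obs J0"
      by (intro supp_closed single_in_even_mons) (simp_all add: sites_J0)
    show "wcong hb (time_ord (scale (emb (1 / 2))
        (Poly_Mapping.single ({#1#}, {}) 1 - Poly_Mapping.single ({#- 1#}, {}) 1))) (free_gen Gen_p)"
      by (simp only: time_ord_lin time_ord_single scale_one ordprod_single p wcong_refl)
  qed
next
  let ?W = "weyl_alg hb" and ?A = "A_alg emb \<alpha> hb I1 I2"
  fix u v assume "u \<in> carrier ?W" "v \<in> carrier ?W"
  then obtain f g where f: "u = weyl_class hb f" and g: "v = weyl_class hb g"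
    by (auto simp: weyl_alg_simps)
  have "wcong hb (time_ord (lift (f * g))) (time_ord (lift f) * time_ord (lift g))"
    by (rule wcong_trans[OF time_ord_lift]) (intro wcong_mult wcong_sym[OF time_ord_lift])
  then have "star emb \<alpha> hb I1 I2 (cls_J0 (lift f)) (cls_J0 (lift g)) = cls_J0 (lift (f * g))"
    by (rule star_cls_J0[OF pair lift_obs lift_obs lift_obs])
  then show "weyl_iso (u \<otimes>\<^bsub>?W\<^esub> v) = weyl_iso u \<otimes>\<^bsub>?A\<^esub> weyl_iso v"
    by (simp add: f g weyl_alg_simps A_alg_simps weyl_iso_lift)
  have "lift f + lift g \<in> obs J0" by (intro supp_closed lift_obs)
  then have "weyl_iso (weyl_class hb (f + g)) = cls_J0 (lift f + lift g)"
    by (rule weyl_iso_class) (auto simp: time_ord_lin intro: wcong_add time_ord_lift)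
  then show "weyl_iso (u \<oplus>\<^bsub>?W\<^esub> v) = weyl_iso u \<oplus>\<^bsub>?A\<^esub> weyl_iso v"
    by (simp add: f g weyl_alg_simps A_alg_add weyl_iso_lift)
next
  let ?W = "weyl_alg hb" and ?A = "A_alg emb \<alpha> hb I1 I2"
  fix r u assume "u \<in> carrier ?W"
  then obtain f where f: "u = weyl_class hb f" by (auto simp: weyl_alg_simps)
  have "scale r (lift f) \<in> obs J0" by (intro supp_closed lift_obs)
  then have "weyl_iso (weyl_class hb (scale r f)) = cls_J0 (scale r (lift f))"
    by (rule weyl_iso_class) (auto simp: time_ord_lin intro: wcong_scale time_ord_lift)
  then show "weyl_iso (r \<odot>\<^bsub>?W\<^esub> u) = r \<odot>\<^bsub>?A\<^esub> weyl_iso u"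
    by (simp add: f weyl_alg_simps A_alg_smult weyl_iso_lift)
qed

text \<open>Reversing \<open>lift w\<close> applies \<open>free_rev\<close> to its time-ordered
  product, so the result represents \<open>free_rev w\<close>.\<close>

lemma time_reversal_weyl_iso:
  "induced (cplx J0) 0 (time_reversal J0) (weyl_iso (weyl_class hb w)) = weyl_iso (weyl_rev hb (weyl_class hb w))"
proof -
  have "wcong hb (time_ord (time_rev (lift w))) (free_rev w)"
    unfolding time_ord_time_rev[OF lift_obs] by (rule wcong_free_rev[OF time_ord_lift])
  then have "weyl_iso (weyl_class hb (free_rev w)) = cls_J0 (time_rev (lift w))"
    by (intro weyl_iso_class) (simp_all add: time_rev_obs_J0)
  then show ?thesis
    by (simp add: weyl_rev_class weyl_iso_lift induced_time_reversal)
qed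

end

lemma quantum_scalars_half:
  assumes "quantum_scalars emb hb"
  shows "emb (1 / 2) + emb (1 / 2) = 1"
proof -
  have hom: "\<phi> x + \<phi> x = 1" if "comm_ring_iso \<phi>" "x + x = 1" for \<phi> :: "'c::comm_ring_1 \<Rightarrow> 'd::comm_ring_1" and x
    using that unfolding comm_ring_iso_def by metis
  consider "comm_ring_iso emb"
    | \<phi> :: "'a poly \<Rightarrow> 'b" where "comm_ring_iso \<phi>" "\<forall>c. emb c = \<phi> [:c:]"
    | \<phi> :: "'a fps \<Rightarrow> 'b" where "comm_ring_iso \<phi>" "\<forall>c. emb c = \<phi> (fps_const c)"
    using assms unfolding quantum_scalars_def by blast
  then show ?thesis
  proof cases
    case 1
    show ?thesis by (rule hom[OF 1]) simp
  next
    case (2 \<phi>)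
    have "\<phi> [:1 / 2:] + \<phi> [:1 / 2:] = 1"
      by (rule hom[OF 2(1)]) (simp add: one_pCons)
    then show ?thesis using 2(2) by simp
  next
    case (3 \<phi>)
    have "\<phi> (fps_const (1 / 2)) + \<phi> (fps_const (1 / 2)) = 1"
      by (rule hom[OF 3(1)]) simp
    then show ?thesis using 3(2) by simp
  qed
qed

theorem mainTheorem5:
  fixes \<alpha> :: "'k::field_char_0"
    and emb :: "'k \<Rightarrow> 'r::comm_ring_1"
    and hb :: 'r
  assumes "\<alpha> \<noteq> 0"
    and "quantum_scalars emb hb"
  shows "C2_equivariant_structure (Oq emb \<alpha> hb) time_reversal \<and>
    (\<forall>I1 I2. left_right_pair I1 I2 \<longrightarrow>
      (let \<tau> = induced (obj (Oq emb \<alpha> hb) J0) 0 (time_reversal J0) in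
        anti_involution (A_alg emb \<alpha> hb I1 I2) \<tau> \<and>
        (\<exists>\<Phi>. weyl_identification emb \<alpha> hb I1 I2 \<Phi>) \<and>
        (\<exists>\<sigma>. weyl_reversal hb \<sigma> \<and>
          (\<forall>\<sigma>'. weyl_reversal hb \<sigma>' \<longrightarrow> (\<forall>w \<in> carrier (weyl_alg hb). \<sigma>' w = \<sigma> w)) \<and>
          (\<forall>\<Phi>. weyl_identification emb \<alpha> hb I1 I2 \<Phi> \<longrightarrow>
            (\<forall>w \<in> carrier (weyl_alg hb). \<tau> (\<Phi> w) = \<Phi> (\<sigma> w))))))"
proof -
  interpret quantum_field \<alpha> emb hb
    by (rule quantum_field.intro) (rule quantum_scalars_half[OF assms(2)])
  \<comment> \<open>Both maps are isomorphisms onto the opposite algebra with the same values on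
    \<open>q\<close> and \<open>p\<close>.\<close>
  have unique: "\<sigma>' w = weyl_rev hb w" if "weyl_reversal hb \<sigma>'" "w \<in> carrier (weyl_alg hb)" for \<sigma>' w
  proof (rule weyl_alg_iso_eqI[OF _ _ _ _ that(2)])
    note rev = weyl_reversal_weyl_rev[of hb, unfolded weyl_reversal_def anti_involution_def]
    note rev' = that(1)[unfolded weyl_reversal_def anti_involution_def]
    show "algebra_iso (weyl_alg hb) (opposite (weyl_alg hb)) \<sigma>'"
      using rev' by blast
    show "algebra_iso (weyl_alg hb) (opposite (weyl_alg hb)) (weyl_rev hb)"
      using rev by blast
    show "\<sigma>' (weyl_q hb) = weyl_rev hb (weyl_q hb)" "\<sigma>' (weyl_p hb) = weyl_rev hb (weyl_p hb)"
      using rev rev' by (simp_all only:)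
  qed
  have intertwine: "induced (cplx J0) 0 (time_reversal J0) (\<Phi> w) = \<Phi> (weyl_rev hb w)"
    if pair: "left_right_pair I1 I2" and \<Phi>: "weyl_identification emb \<alpha> hb I1 I2 \<Phi>"
      and w: "w \<in> carrier (weyl_alg hb)" for I1 I2 \<Phi> w
  proof -
    \<comment> \<open>An identification is fixed on the carrier by its prescribed images of
      \<open>q\<close> and \<open>p\<close>, so intertwining has to be checked for
      \<open>weyl_iso\<close> only.\<close>
    have eq: "\<Phi> u = weyl_iso u" if "u \<in> carrier (weyl_alg hb)" for u
    proof (rule weyl_alg_iso_eqI[OF _ _ _ _ that])
      note ids = \<Phi>[unfolded weyl_identification_def]
        weyl_identification_weyl_iso[OF pair, unfolded weyl_identification_def]
      show "algebra_iso (weyl_alg hb) (A_alg emb \<alpha> hb I1 I2) \<Phi>"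
        "algebra_iso (weyl_alg hb) (A_alg emb \<alpha> hb I1 I2) weyl_iso"
        using ids by blast+
      show "\<Phi> (weyl_q hb) = weyl_iso (weyl_q hb)" "\<Phi> (weyl_p hb) = weyl_iso (weyl_p hb)"
        using ids by (simp_all only:)
    qed
    obtain f where f: "w = weyl_class hb f"
      using w by (auto simp: weyl_alg_simps)
    have "weyl_rev hb w \<in> carrier (weyl_alg hb)"
      by (simp add: f weyl_rev_class weyl_alg_simps)
    then show ?thesis
      using time_reversal_weyl_iso[of f] w by (simp add: eq f)
  qed
  show ?thesis
    unfolding Let_def
  proof (intro conjI allI impI)
    show "C2_equivariant_structure (Oq emb \<alpha> hb) time_reversal"
      by (rule C2_equivariant_Oq)
    fix I1 I2 assume pair: "left_right_pair I1 I2"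
    show "anti_involution (A_alg emb \<alpha> hb I1 I2) (induced (cplx J0) 0 (time_reversal J0))"
      by (rule anti_involution_A_alg[OF pair])
    show "\<exists>\<Phi>. weyl_identification emb \<alpha> hb I1 I2 \<Phi>"
      by (rule exI[where x = weyl_iso]) (rule weyl_identification_weyl_iso[OF pair])
    show "\<exists>\<sigma>. weyl_reversal hb \<sigma> \<and>
        (\<forall>\<sigma>'. weyl_reversal hb \<sigma>' \<longrightarrow> (\<forall>w \<in> carrier (weyl_alg hb). \<sigma>' w = \<sigma> w)) \<and>
        (\<forall>\<Phi>. weyl_identification emb \<alpha> hb I1 I2 \<Phi> \<longrightarrow>
          (\<forall>w \<in> carrier (weyl_alg hb). induced (cplx J0) 0 (time_reversal J0) (\<Phi> w) = \<Phi> (\<sigma> w)))"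
      by (rule exI[of _ "weyl_rev hb"])
        (intro conjI allI impI ballI weyl_reversal_weyl_rev unique intertwine[OF pair])
  qed
qed

end
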